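(* Let $(T,M,\mu)$, the separable rearrangement invariant space $L$ with associate space $L'$, the set $S$ of extremal points, the mean zero pregaussian random field $\xi=\{\xi(t)\}_{t\in T}$, its normed sums $S_n$, and the function $\psi$ with its Rosenthal transform $\psi_R$ be as in the context. In particular, suppose that $\sup_{t\in T}\|\xi(t)\|G\psi=1$, that for every non-random $g\in L'$ the integral $l_\xi(g)=\int_T\xi(t)g(t)\,\mu(dt)$ exists with probability one, and that $$D:=\sup_{g_1,g_2\in S}\rho(g_1,g_2)<\infty,\qquad \rho(g_1,g_2):=\|g_1-g_2\|_{L_1(T,\mu)} .$$ Let $v_R(y)=\ln\psi_R(1/y)$ and $v_{R,*}(x)=\inf_{y\ge0}(xy+v_R(y))$. Suppose in addition that $$J:=\int_0^D\exp\left(v_{R,*}\left(2+\ln N(S,\rho,\epsilon)\right)\right)d\epsilon<\infty .$$ Then the sequence of random fields $S_n(\cdot)$ satisfies the Central Limit Theorem in the space $L$.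
   Context: $(T,M,\mu)$ is a measure space with $\sigma$-finite separable measure $\mu$ (separable with respect to the distance $(A_1,A_2)\mapsto\mu(A_1\Delta A_2)$). $(L,\|\cdot\|L)$ is a separable rearrangement invariant Banach function space over $(T,M,\mu)$ in the sense of Bennett and Sharpley. $\xi(t)=\xi(t,\omega)$, $t\in T$, is a separable measurable numerical-valued random field on a probability space $(\Omega,B,\mathbf{P})$ with expectation $\mathbf{E}$. It is assumed that $\mathbf{E}\xi(t)=0$, $\sup_{t\in T}\mathbf{E}\xi^2(t)<\infty$, and that $\xi$ is pregaussian: the centered Gaussian random field $S_\infty(t)$ with the same covariance function $\mathbf{E}\xi(t)\xi(s)$ belongs to $L$ with probability one. Normed sums: $S_n(t)=n^{-1/2}\sum_{i=1}^n\xi_i(t)$, where $\xi_i$ are independent copies of $\xi$. The Central Limit Theorem in $L$ means that $S_n$ converges weakly (in distribution) in $L$ as $n\to\infty$ to a non-degenerate Gaussian random field $S_\infty$, i.e. $\mathbf{E}F(S_n)\to\mathbf{E}F(S_\infty)$ for every bounded continuous functional $F:L\to\mathbb{R}$. Grand Lebesgue spaces: for a random variable $\eta$ put $|\eta|_p=(\mathbf{E}|\eta|^p)^{1/p}$. For a continuous positive function $\psi$ on an open interval $(a,b)$, $1\le a<b\le\infty$, with $\inf_{p\in(a,b)}\psi(p)>0$ (the support of $\psi$ is $(a,b)$), put $\|\eta\|G\psi=\sup_{p\in(a,b)}|\eta|_p/\psi(p)$. Here $\psi$ has support $(a,\infty)$ with $1\le a\le 2$, and it is the natural function $\psi_0(p)=\sup_{t\in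 T}|\xi(t)|_p$ (assumed finite on $(a,\infty)$) or a majorant of it with the same support, normalized so that $\sup_{t\in T}\|\xi(t)\|G\psi=1$. Rosenthal transform: $\psi_R(p)=\frac{C_R\,p}{\ln p}\,\psi(p)$, $p\in(2,\infty)$, with $C_R=1.77638$; the support of $\psi_R$ is $(2,\infty)$. In the definition of $v_{R,*}$, $v_R(y)$ is understood as $+\infty$ when $1/y$ is outside the support of $\psi_R$. Associate space: $L'$ is the space of measurable $g$ defining bounded functionals $l_g(f)=\int_T f(t)g(t)\,\mu(dt)$ on $L$, with norm $\|g\|L'=\sup\{l_g(f):\ f\in L,\ \|f\|L=1\}$. $S$ denotes the set of all extremal points of the unit ball of $L'$; it is symmetric, $S=-S$, $\|g\|L'=1$ for $g\in S$, and it is taken as a standing convention that $\|f\|L=\sup_{g\in S}l_g(f)$ for all $f\in L$. Covering numbers: $N(X,\rho,\epsilon)$ is the minimal number of closed $\rho$-balls of radius $\epsilon$ covering $X$. *)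

theory Defs
  imports "HOL-Probability.Probability" "HOL-Library.Extended_Nat"
begin

subsection \<open>Separable measures and Banach function spaces\<close>

text \<open>
  The distance \<open>\<mu>(A \<Delta> B)\<close> is considered on the sets of finite measure.
\<close>

definition separable_measure :: "'t measure \<Rightarrow> bool" where
  "separable_measure \<mu> \<longleftrightarrow>
    (\<exists>\<D>. countable \<D> \<and> \<D> \<subseteq> {B \<in> sets \<mu>. emeasure \<mu> B < \<infinity>} \<and>
      (\<forall>A\<in>sets \<mu>. emeasure \<mu> A < \<infinity> \<longrightarrow>
        (\<forall>\<epsilon>>0. \<exists>B\<in>\<D>. emeasure \<mu> ((A - B) \<union> (B - A)) < ennreal \<epsilon>)))"

text \<open>
  Axioms (P1)--(P5) of Bennett and Sharpley for a function norm on the cone of measurable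
  functions with values in \<open>[0,\<infinity>]\<close>.
\<close>

locale banach_function_norm = sigma_finite_measure \<mu> for \<mu> :: "'t measure" +
  fixes N :: "('t \<Rightarrow> ennreal) \<Rightarrow> ennreal"
  assumes norm_zero_iff:
      "f \<in> borel_measurable \<mu> \<Longrightarrow> N f = 0 \<longleftrightarrow> (AE t in \<mu>. f t = 0)"
    and norm_scale:
      "f \<in> borel_measurable \<mu> \<Longrightarrow> 0 \<le> a \<Longrightarrow> N (\<lambda>t. ennreal a * f t) = ennreal a * N f"
    and norm_triangle:
      "f \<in> borel_measurable \<mu> \<Longrightarrow> g \<in> borel_measurable \<mu> \<Longrightarrow> N (\<lambda>t. f t + g t) \<le> N f + N g"
    and norm_mono:
      "f \<in> borel_measurable \<mu> \<Longrightarrow> g \<in> borel_measurable \<mu> \<Longrightarrow> (AE t in \<mu>. g t \<le> f t) \<Longrightarrow> N g \<le> N f"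
    and norm_Fatou:
      "(\<And>n. h n \<in> borel_measurable \<mu>) \<Longrightarrow> f \<in> borel_measurable \<mu> \<Longrightarrow>
        (AE t in \<mu>. incseq (\<lambda>n. h n t) \<and> (\<lambda>n. h n t) \<longlonglongrightarrow> f t) \<Longrightarrow> (\<lambda>n. N (h n)) \<longlonglongrightarrow> N f"
    and norm_indicator:
      "E \<in> sets \<mu> \<Longrightarrow> emeasure \<mu> E < \<infinity> \<Longrightarrow> N (indicator E) < \<infinity>"
    and norm_local_L1:
      "E \<in> sets \<mu> \<Longrightarrow> emeasure \<mu> E < \<infinity> \<Longrightarrow>
        \<exists>C>0. \<forall>f\<in>borel_measurable \<mu>. (\<integral>\<^sup>+t\<in>E. f t \<partial>\<mu>) \<le> ennreal C * N f"

definition equimeasurable :: "'t measure \<Rightarrow> ('t \<Rightarrow> ennreal) \<Rightarrow> ('t \<Rightarrow> ennreal) \<Rightarrow> bool" where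
  "equimeasurable \<mu> f g \<longleftrightarrow>
    (\<forall>s\<ge>0. emeasure \<mu> {t\<in>space \<mu>. ennreal s < f t} = emeasure \<mu> {t\<in>space \<mu>. ennreal s < g t})"

locale rearrangement_invariant_norm = banach_function_norm +
  assumes norm_equimeasurable:
    "f \<in> borel_measurable \<mu> \<Longrightarrow> g \<in> borel_measurable \<mu> \<Longrightarrow>
      (AE t in \<mu>. f t < \<infinity>) \<Longrightarrow> (AE t in \<mu>. g t < \<infinity>) \<Longrightarrow> equimeasurable \<mu> f g \<Longrightarrow> N f = N g"

text \<open>
  Elements of the spaces below are real functions on \<open>space \<mu>\<close>; functions that agree
  almost everywhere are not identified, so all distances are pseudometrics.
\<close>

definition fs_norm :: "(('t \<Rightarrow> ennreal) \<Rightarrow> ennreal) \<Rightarrow> ('t \<Rightarrow> real) \<Rightarrow> ennreal" where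
  "fs_norm N f = N (\<lambda>t. ennreal \<bar>f t\<bar>)"

definition fspace :: "'t measure \<Rightarrow> (('t \<Rightarrow> ennreal) \<Rightarrow> ennreal) \<Rightarrow> ('t \<Rightarrow> real) set" where
  "fspace \<mu> N = {f \<in> borel_measurable \<mu>. fs_norm N f < \<infinity>}"

definition separable_fspace :: "'t measure \<Rightarrow> (('t \<Rightarrow> ennreal) \<Rightarrow> ennreal) \<Rightarrow> bool" where
  "separable_fspace \<mu> N \<longleftrightarrow>
    (\<exists>H. countable H \<and> H \<subseteq> fspace \<mu> N \<and>
      (\<forall>f\<in>fspace \<mu> N. \<forall>\<epsilon>>0. \<exists>h\<in>H. fs_norm N (\<lambda>t. f t - h t) < ennreal \<epsilon>))"


subsection \<open>The associate space and the extremal points of its unit ball\<close>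

definition pairing :: "'t measure \<Rightarrow> ('t \<Rightarrow> real) \<Rightarrow> ('t \<Rightarrow> real) \<Rightarrow> real" where
  "pairing \<mu> g f = (\<integral>t. f t * g t \<partial>\<mu>)"

definition assoc_space :: "'t measure \<Rightarrow> (('t \<Rightarrow> ennreal) \<Rightarrow> ennreal) \<Rightarrow> ('t \<Rightarrow> real) set" where
  "assoc_space \<mu> N =
    {g \<in> borel_measurable \<mu>.
      (\<forall>f\<in>fspace \<mu> N. integrable \<mu> (\<lambda>t. f t * g t)) \<and>
      (\<exists>C\<ge>0. \<forall>f\<in>fspace \<mu> N. ennreal \<bar>pairing \<mu> g f\<bar> \<le> ennreal C * fs_norm N f)}"

text \<open>
  Since \<open>{f. \<parallel>f\<parallel> = 1}\<close> is symmetric, cutting off negative values of the pairing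
  does not change the supremum.
\<close>

definition assoc_norm ::
    "'t measure \<Rightarrow> (('t \<Rightarrow> ennreal) \<Rightarrow> ennreal) \<Rightarrow> ('t \<Rightarrow> real) \<Rightarrow> ennreal" where
  "assoc_norm \<mu> N g = (SUP f\<in>{f\<in>fspace \<mu> N. fs_norm N f = 1}. ennreal (pairing \<mu> g f))"

definition assoc_ball :: "'t measure \<Rightarrow> (('t \<Rightarrow> ennreal) \<Rightarrow> ennreal) \<Rightarrow> ('t \<Rightarrow> real) set" where
  "assoc_ball \<mu> N = {g\<in>assoc_space \<mu> N. assoc_norm \<mu> N g \<le> 1}"

text \<open>
  As in \<open>extreme_point_of\<close>, but with equality almost everywhere.
\<close>

definition extremal_points :: "'t measure \<Rightarrow> (('t \<Rightarrow> ennreal) \<Rightarrow> ennreal) \<Rightarrow> ('t \<Rightarrow> real) set" where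
  "extremal_points \<mu> N =
    {g\<in>assoc_ball \<mu> N. \<forall>g1\<in>assoc_ball \<mu> N. \<forall>g2\<in>assoc_ball \<mu> N. \<forall>u::real. 0 < u \<longrightarrow> u < 1 \<longrightarrow>
      (AE t in \<mu>. g t = (1 - u) * g1 t + u * g2 t) \<longrightarrow> (AE t in \<mu>. g1 t = g2 t)}"

definition L1_dist :: "'t measure \<Rightarrow> ('t \<Rightarrow> real) \<Rightarrow> ('t \<Rightarrow> real) \<Rightarrow> ennreal" where
  "L1_dist \<mu> g1 g2 = (\<integral>\<^sup>+t. ennreal \<bar>g1 t - g2 t\<bar> \<partial>\<mu>)"


subsection \<open>Random fields\<close>

text \<open>
  A random field is given as \<open>X t \<omega>\<close>; its index set is \<open>space \<mu>\<close>.
\<close>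

definition measurable_field :: "'t measure \<Rightarrow> 'w measure \<Rightarrow> ('t \<Rightarrow> 'w \<Rightarrow> real) \<Rightarrow> bool" where
  "measurable_field \<mu> P X \<longleftrightarrow> (\<lambda>(t, \<omega>). X t \<omega>) \<in> borel_measurable (\<mu> \<Otimes>\<^sub>M P)"

text \<open>
  Doob separability. The index set carries no topology, so the condition only refers to the
  values of the field; separability with respect to any topology on the index set implies it.
\<close>

definition separable_field :: "'t measure \<Rightarrow> 'w measure \<Rightarrow> ('t \<Rightarrow> 'w \<Rightarrow> real) \<Rightarrow> bool" where
  "separable_field \<mu> P X \<longleftrightarrow>
    (\<exists>T0. countable T0 \<and> T0 \<subseteq> space \<mu> \<and>
      (\<exists>\<Omega>0\<in>null_sets P. \<forall>\<omega>\<in>space P - \<Omega>0. \<forall>t\<in>space \<mu>. X t \<omega> \<in> closure ((\<lambda>s. X s \<omega>) ` T0)))"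

definition field_path :: "'t measure \<Rightarrow> ('t \<Rightarrow> 'w \<Rightarrow> real) \<Rightarrow> 'w \<Rightarrow> 't \<Rightarrow> real" where
  "field_path \<mu> X \<omega> = (\<lambda>t\<in>space \<mu>. X t \<omega>)"

text \<open>
  Identity in law and independence are those of the fields as random elements of the product
  space, i.e. of their finite-dimensional distributions.
\<close>

definition independent_copies ::
    "'t measure \<Rightarrow> 'w measure \<Rightarrow> ('t \<Rightarrow> 'w \<Rightarrow> real) \<Rightarrow> 'v measure \<Rightarrow> (nat \<Rightarrow> 't \<Rightarrow> 'v \<Rightarrow> real) \<Rightarrow> bool" where
  "independent_copies \<mu> P X Q Y \<longleftrightarrow>
    (\<forall>i\<ge>1. measurable_field \<mu> Q (Y i) \<and>
      distr Q (\<Pi>\<^sub>M t\<in>space \<mu>. borel) (field_path \<mu> (Y i)) =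
      distr P (\<Pi>\<^sub>M t\<in>space \<mu>. borel) (field_path \<mu> X)) \<and>
    prob_space.indep_vars Q (\<lambda>i. \<Pi>\<^sub>M t\<in>space \<mu>. borel) (\<lambda>i. field_path \<mu> (Y i)) {1..}"

definition normed_sum :: "(nat \<Rightarrow> 't \<Rightarrow> 'v \<Rightarrow> real) \<Rightarrow> nat \<Rightarrow> 't \<Rightarrow> 'v \<Rightarrow> real" where
  "normed_sum Y n t \<omega> = (\<Sum>i=1..n. Y i t \<omega>) / sqrt (real n)"

definition centered_gaussian :: "'w measure \<Rightarrow> ('w \<Rightarrow> real) \<Rightarrow> bool" where
  "centered_gaussian P X \<longleftrightarrow> X \<in> borel_measurable P \<and>
    ((AE \<omega> in P. X \<omega> = 0) \<or>
     (\<exists>\<sigma>>0. distributed P lborel X (\<lambda>x. ennreal (normal_density 0 \<sigma> x))))"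

definition centered_gaussian_field :: "'t measure \<Rightarrow> 'w measure \<Rightarrow> ('t \<Rightarrow> 'w \<Rightarrow> real) \<Rightarrow> bool" where
  "centered_gaussian_field \<mu> P X \<longleftrightarrow>
    (\<forall>I c. finite I \<longrightarrow> I \<subseteq> space \<mu> \<longrightarrow> centered_gaussian P (\<lambda>\<omega>. \<Sum>t\<in>I. c t * X t \<omega>))"


subsection \<open>Weak convergence in the function space\<close>

text \<open>
  Bounded continuous functionals on \<open>fspace \<mu> N\<close>; continuity with respect to the pseudonorm
  makes them invariant under changes on null sets.
\<close>

definition bdd_cont_functional ::
    "'t measure \<Rightarrow> (('t \<Rightarrow> ennreal) \<Rightarrow> ennreal) \<Rightarrow> (('t \<Rightarrow> real) \<Rightarrow> real) \<Rightarrow> bool" where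
  "bdd_cont_functional \<mu> N F \<longleftrightarrow>
    (\<exists>B. \<forall>f\<in>fspace \<mu> N. \<bar>F f\<bar> \<le> B) \<and>
    (\<forall>f\<in>fspace \<mu> N. \<forall>\<epsilon>>0. \<exists>\<delta>>0. \<forall>h\<in>fspace \<mu> N.
      fs_norm N (\<lambda>t. h t - f t) < ennreal \<delta> \<longrightarrow> \<bar>F h - F f\<bar> < \<epsilon>)"

definition path_event ::
    "'t measure \<Rightarrow> (('t \<Rightarrow> ennreal) \<Rightarrow> ennreal) \<Rightarrow> 'w measure \<Rightarrow> ('t \<Rightarrow> 'w \<Rightarrow> real) \<Rightarrow> 'w set" where
  "path_event \<mu> N P X = {\<omega>\<in>space P. (\<lambda>t. X t \<omega>) \<in> fspace \<mu> N}"

text \<open>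
  The measurability clause is Borel measurability of \<open>\<omega> \<mapsto> X(\<cdot>,\<omega>)\<close>, expressed by bounded
  continuous functionals; it ensures that the integrals below are genuine expectations.
\<close>

definition random_element ::
    "'t measure \<Rightarrow> (('t \<Rightarrow> ennreal) \<Rightarrow> ennreal) \<Rightarrow> 'w measure \<Rightarrow> ('t \<Rightarrow> 'w \<Rightarrow> real) \<Rightarrow> bool" where
  "random_element \<mu> N P X \<longleftrightarrow>
    (AE \<omega> in P. (\<lambda>t. X t \<omega>) \<in> fspace \<mu> N) \<and>
    (\<forall>F. bdd_cont_functional \<mu> N F \<longrightarrow>
      set_borel_measurable P (path_event \<mu> N P X) (\<lambda>\<omega>. F (\<lambda>t. X t \<omega>)))"

definition functional_expectation ::
    "'t measure \<Rightarrow> (('t \<Rightarrow> ennreal) \<Rightarrow> ennreal) \<Rightarrow> 'w measure \<Rightarrow> ('t \<Rightarrow> 'w \<Rightarrow> real) \<Rightarrow>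
      (('t \<Rightarrow> real) \<Rightarrow> real) \<Rightarrow> real" where
  "functional_expectation \<mu> N P X F = (LINT \<omega>:path_event \<mu> N P X|P. F (\<lambda>t. X t \<omega>))"

definition weakly_convergent_to ::
    "'t measure \<Rightarrow> (('t \<Rightarrow> ennreal) \<Rightarrow> ennreal) \<Rightarrow> 'v measure \<Rightarrow> (nat \<Rightarrow> 't \<Rightarrow> 'v \<Rightarrow> real) \<Rightarrow>
      'w measure \<Rightarrow> ('t \<Rightarrow> 'w \<Rightarrow> real) \<Rightarrow> bool" where
  "weakly_convergent_to \<mu> N Q X R Z \<longleftrightarrow>
    (\<forall>n\<ge>1. random_element \<mu> N Q (X n)) \<and> random_element \<mu> N R Z \<and>
    (\<forall>F. bdd_cont_functional \<mu> N F \<longrightarrow>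
      (\<lambda>n. functional_expectation \<mu> N Q (X n) F) \<longlonglongrightarrow> functional_expectation \<mu> N R Z F)"

text \<open>
  The limit is a Gaussian random field that is non-degenerate, i.e. it does not vanish
  identically as a random field on \<open>space \<mu>\<close>.
\<close>

definition central_limit_theorem_in ::
    "'t measure \<Rightarrow> (('t \<Rightarrow> ennreal) \<Rightarrow> ennreal) \<Rightarrow> 'v measure \<Rightarrow> (nat \<Rightarrow> 't \<Rightarrow> 'v \<Rightarrow> real) \<Rightarrow>
      'w measure \<Rightarrow> ('t \<Rightarrow> 'w \<Rightarrow> real) \<Rightarrow> bool" where
  "central_limit_theorem_in \<mu> N Q X R Z \<longleftrightarrow>
    centered_gaussian_field \<mu> R Z \<and> (\<exists>t\<in>space \<mu>. \<not> (AE \<omega> in R. Z t \<omega> = 0)) \<and>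
    weakly_convergent_to \<mu> N Q X R Z"


subsection \<open>Grand Lebesgue norms and the Rosenthal transform\<close>

definition Lp_norm :: "'w measure \<Rightarrow> real \<Rightarrow> ('w \<Rightarrow> real) \<Rightarrow> ennreal" where
  "Lp_norm P p \<eta> =
    (let I = \<integral>\<^sup>+\<omega>. ennreal (\<bar>\<eta> \<omega>\<bar> powr p) \<partial>P
     in if I = \<infinity> then \<infinity> else ennreal (enn2real I powr (1 / p)))"

text \<open>\<open>I\<close> is the support of \<open>\<psi>\<close>.\<close>

definition grand_norm :: "'w measure \<Rightarrow> real set \<Rightarrow> (real \<Rightarrow> real) \<Rightarrow> ('w \<Rightarrow> real) \<Rightarrow> ennreal" where
  "grand_norm P I \<psi> \<eta> = (SUP p\<in>I. Lp_norm P p \<eta> / ennreal (\<psi> p))"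

definition natural_fun :: "'t measure \<Rightarrow> 'w measure \<Rightarrow> ('t \<Rightarrow> 'w \<Rightarrow> real) \<Rightarrow> real \<Rightarrow> ennreal" where
  "natural_fun \<mu> P X p = (SUP t\<in>space \<mu>. Lp_norm P p (X t))"

definition Rosenthal_const :: real where
  "Rosenthal_const = 1.77638"

definition psi_R :: "(real \<Rightarrow> real) \<Rightarrow> real \<Rightarrow> real" where
  "psi_R \<psi> p = Rosenthal_const * p / ln p * \<psi> p"

text \<open>The support of \<open>psi_R \<psi>\<close> is \<open>(2,\<infinity>)\<close>.\<close>

definition v_R :: "(real \<Rightarrow> real) \<Rightarrow> real \<Rightarrow> ereal" where
  "v_R \<psi> y = (if 0 < y \<and> 2 < 1 / y then ereal (ln (psi_R \<psi> (1 / y))) else \<infinity>)"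

definition v_R_star :: "(real \<Rightarrow> real) \<Rightarrow> ereal \<Rightarrow> ereal" where
  "v_R_star \<psi> x = (INF y\<in>{0..}. x * ereal y + v_R \<psi> y)"


subsection \<open>Metric entropy\<close>

text \<open>Closed balls with centres in \<open>X\<close>; the value is \<open>\<infinity>\<close> if there is no finite cover.\<close>

definition covering_number :: "'a set \<Rightarrow> ('a \<Rightarrow> 'a \<Rightarrow> ennreal) \<Rightarrow> real \<Rightarrow> enat" where
  "covering_number X d \<epsilon> =
    (INF C\<in>{C. finite C \<and> C \<subseteq> X \<and> (\<forall>x\<in>X. \<exists>c\<in>C. d c x \<le> ennreal \<epsilon>)}. enat (card C))"

definition ln_enat :: "enat \<Rightarrow> ereal" where
  "ln_enat n = (case n of enat k \<Rightarrow> ereal (ln (real k)) | \<infinity> \<Rightarrow> \<infinity>)"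

definition exp_ereal :: "ereal \<Rightarrow> ennreal" where
  "exp_ereal x = (case x of ereal r \<Rightarrow> ennreal (exp r) | PInfty \<Rightarrow> \<infinity> | MInfty \<Rightarrow> 0)"

definition diam :: "'a set \<Rightarrow> ('a \<Rightarrow> 'a \<Rightarrow> ennreal) \<Rightarrow> ennreal" where
  "diam X d = (SUP x\<in>X. SUP y\<in>X. d x y)"

definition entropy_integral ::
    "(real \<Rightarrow> real) \<Rightarrow> 'a set \<Rightarrow> ('a \<Rightarrow> 'a \<Rightarrow> ennreal) \<Rightarrow> ennreal" where
  "entropy_integral \<psi> X d =
    (\<integral>\<^sup>+\<epsilon>\<in>{0..enn2real (diam X d)}.
        exp_ereal (v_R_star \<psi> (2 + ln_enat (covering_number X d \<epsilon>))) \<partial>lborel)"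

end

theory Submission
  imports Defs
begin

text \<open>
  The set \<open>S\<close> of extremal points is invariant under multiplication by measurable signs, and
  finiteness of the entropy integral makes it totally bounded in \<open>L\<^sub>1\<close>. Hence the measurable
  subsets of any set on which some \<open>g \<in> S\<close> is bounded away from \<open>0\<close> are totally bounded for
  the distance \<open>\<mu>(A \<Delta> B)\<close>, which forces \<open>\<mu>\<close> to be purely atomic: up to null sets the paths of
  a measurable field are given by their values at countably many points \<open>\<tau> i\<close>.

  The norm is at most the supremum of \<open>\<integral>\<bar>f\<bar>\<bar>g\<bar>\<close> over a countable subset of \<open>S\<close>. Chaining along
  nets of \<open>S\<close> bounds the expected norm of a field outside the first \<open>j\<close> atoms in terms of the
  moments \<open>\<bar>\<xi>(t)\<bar>\<^sub>p\<close> only, and the bound tends to \<open>0\<close> with \<open>j\<close>. It applies uniformly to all \<open>S\<^sub>n\<close>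
  and to the Gaussian limit, since both satisfy Rosenthal's inequality (even with \<open>sqrt p\<close> in
  place of \<open>p / ln p\<close>). For a bounded Lipschitz functional this reduces the claim to the central
  limit theorem for the random vectors \<open>(S\<^sub>n(\<tau> 0), \<dots>, S\<^sub>n(\<tau> (j - 1)))\<close>, which follows from the
  one-dimensional one through characteristic functions and Gaussian smoothing.
\<close>

subsection \<open>Inequalities for real powers\<close>

text \<open>The copies are tied to \<open>\<xi>\<close> only through finite-dimensional
  distributions, whereas a functional on the space sees whole paths. Pure atomicity closes this gap:
  finitely many fixed values determine the path up to a remainder that chaining makes uniformly
  small. It is forced because flipping the sign of \<open>g\<close> off a set \<open>E\<close> gives
  another extremal point, and the points obtained from \<open>E\<close> and \<open>E'\<close> differ
  in the L1 norm by twice the integral of \<open>|g|\<close> over the symmetric difference. The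
  entropy integral enters through the substitution \<open>y = 1 / q\<close>:
  \<open>exp ((2 + ln n) * y + ln (psi_R \<psi> q))\<close> dominates
  \<open>n powr (1 / q) * psi_R \<psi> q\<close>, the cost of a maximum of \<open>n\<close> weighted
  integrals of a field whose \<open>q\<close>-th moments are bounded by
  \<open>psi_R \<psi> q\<close>. The integral is thus compared with a Dudley-type sum of these costs
  times the mesh. Sums have moment constant \<open>4 * sqrt p\<close>, which lies below
  \<open>8 * (Rosenthal_const * p / ln p)\<close>; this is the origin of the constant 8 in the final
  estimate.\<close>

lemma one_plus_powr_le:
  fixes x p :: real
  assumes "0 \<le> x" "1 \<le> p"
  shows "1 + p * (x - 1) \<le> x powr p"
proof (cases "x = 0")
  case False
  \<comment> \<open>Weighted AM-GM for \<open>x powr p\<close> and \<open>1\<close> with weights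
    \<open>1 / p\<close> and \<open>1 - 1 / p\<close>; rearranged, it is Bernoulli's inequality with
    a real exponent.\<close>
  have "x * 1 = (x powr p) powr (1 / p) * 1 powr (1 - 1 / p)"
    using assms by (simp add: powr_powr)
  also have "\<dots> \<le> 1 / p * x powr p + (1 - 1 / p) * 1"
    using assms False by (intro Youngs_inequality_0) auto
  finally have "p * x \<le> p * (1 / p * x powr p + (1 - 1 / p) * 1)"
    using assms by (intro mult_left_mono) auto
  also have "\<dots> = x powr p + (p - 1)"
    using assms by (simp add: distrib_left right_diff_distrib)
  finally show ?thesis
    by (simp add: algebra_simps)
qed (use assms in auto)

text \<open>The tangent to the convex function \<open>x powr p\<close> at \<open>A\<close>, solved
  for \<open>x\<close>; equality holds at \<open>x = A\<close>. The weight \<open>A\<close> is later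
  chosen as a mean or as the expected size of a maximum.\<close>

lemma Young_scaled:
  fixes x A p :: real
  assumes "0 \<le> x" "0 < A" "1 \<le> p"
  shows "x \<le> A powr (1 - p) * x powr p / p + (1 - 1 / p) * A"
proof -
  have "1 + p * (x / A - 1) \<le> (x / A) powr p"
    using assms by (intro one_plus_powr_le) auto
  also have "\<dots> = x powr p * A powr (- p)"
    using assms by (simp add: powr_divide powr_minus_divide)
  finally have "A / p * (1 + p * (x / A - 1)) \<le> A / p * (x powr p * A powr (- p))"
    using assms by (intro mult_left_mono) auto
  moreover have "A / p * (x powr p * A powr (- p)) = A powr (1 - p) * x powr p / p"
    using assms by (simp add: powr_diff powr_minus_divide)
  moreover have "A / p * (1 + p * (x / A - 1)) = A / p + x - A"
    using assms by (simp add: field_simps)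
  ultimately show ?thesis
    by (simp only: left_diff_distrib) simp
qed

text \<open>Weighted AM-GM with the conjugate exponents \<open>p / (p - 2)\<close> and
  \<open>p / 2\<close>. It splits a mixed moment into pure \<open>p\<close>-th moments in place of
  Hoelder's inequality; with \<open>x = 1\<close> it compares second and \<open>p\<close>-th
  moments.\<close>

lemma Young_powr_mult_square:
  fixes x y p :: real
  assumes "0 \<le> x" "0 \<le> y" "2 < p"
  shows "x powr (p - 2) * y\<^sup>2 \<le> (1 - 2 / p) * x powr p + 2 / p * y powr p"
proof (cases "x = 0 \<or> y = 0")
  case False
  with assms have pos: "0 < x" "0 < y" by auto
  have "(x powr p) powr (1 - 2 / p) * (y powr p) powr (2 / p)
      \<le> (1 - 2 / p) * x powr p + 2 / p * y powr p"
    using assms pos by (intro Youngs_inequality_0) (auto simp: field_simps)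
  moreover have "(x powr p) powr (1 - 2 / p) = x powr (p - 2)"
    using assms by (simp add: powr_powr right_diff_distrib)
  moreover have "(y powr p) powr (2 / p) = y\<^sup>2"
    using assms pos by (simp add: powr_powr)
  ultimately show ?thesis by simp
qed (use assms in auto)

text \<open>The mean value theorem is applied twice to \<open>u powr p\<close> along the segment
  from \<open>s\<close> to \<open>s + x\<close>, which has to stay positive. If
  \<open>s + x \<le> 0\<close>, then \<open>s \<le> \<bar>x\<bar>\<close> and the left side as well
  as the linear term are dominated by multiples of the quadratic one.\<close>

lemma abs_add_powr_le_aux:
  fixes s x p :: real
  assumes p: "2 < p" and s: "0 < s"
  shows "\<bar>s + x\<bar> powr p \<le> s powr p + p * s powr (p - 1) * x + p\<^sup>2 * (s + \<bar>x\<bar>) powr (p - 2) * x\<^sup>2"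
proof (cases "s + x > 0")
  case True
  have d1: "((\<lambda>u. u powr p) has_real_derivative p * u powr (p - 1)) (at u)" if "u > 0" for u
    using that by (rule has_real_derivative_powr)
  have d2: "((\<lambda>u. p * u powr (p - 1)) has_real_derivative p * (p - 1) * u powr (p - 2)) (at u)"
    if "u > 0" for u
    using DERIV_cmult[OF has_real_derivative_powr[OF that, of "p - 1"], of p] by (simp add: mult.assoc)
  have mvt: "\<exists>z. min u v \<le> z \<and> z \<le> max u v \<and> f v - f u = (v - u) * f' z"
    if f: "\<And>u. u > 0 \<Longrightarrow> (f has_real_derivative f' u) (at u)" and uv: "u > 0" "v > 0"
    for u v :: real and f f' :: "real \<Rightarrow> real"
  proof (cases u v rule: linorder_cases)
    case less
    then obtain z where "u < z" "z < v" "f v - f u = (v - u) * f' z"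
      using MVT2[of u v f f'] f uv by force
    then show ?thesis using less by (intro exI[of _ z]) auto
  next
    case equal
    then show ?thesis by auto
  next
    case greater
    then obtain z where "v < z" "z < u" "f u - f v = (u - v) * f' z"
      using MVT2[of v u f f'] f uv by force
    then show ?thesis using greater by (intro exI[of _ z]) (auto simp: algebra_simps)
  qed
  obtain z where z: "min s (s + x) \<le> z" "z \<le> max s (s + x)"
    "(s + x) powr p - s powr p = x * (p * z powr (p - 1))"
    using mvt[OF d1 s True] by auto
  have zpos: "z > 0" using z True s by auto
  obtain w where w: "min s z \<le> w" "w \<le> max s z"
    "p * z powr (p - 1) - p * s powr (p - 1) = (z - s) * (p * (p - 1) * w powr (p - 2))"
    using mvt[OF d2 s zpos] by auto
  have wpos: "w > 0" "w \<le> s + \<bar>x\<bar>" using w zpos z s by auto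
  have zs: "x * (z - s) \<le> x\<^sup>2"
  proof -
    have "x * (z - s) \<le> \<bar>x\<bar> * \<bar>z - s\<bar>" by (metis abs_ge_self abs_mult)
    also have "\<dots> \<le> \<bar>x\<bar> * \<bar>x\<bar>" using z by (intro mult_left_mono) auto
    finally show ?thesis by (simp add: power2_eq_square)
  qed
  have "x * (z - s) * (p * (p - 1) * w powr (p - 2)) \<le> x\<^sup>2 * (p * p * (s + \<bar>x\<bar>) powr (p - 2))"
    using zs wpos p by (intro mult_mono powr_mono2) auto
  moreover have "\<bar>s + x\<bar> powr p = s powr p + p * s powr (p - 1) * x
      + x * (z - s) * (p * (p - 1) * w powr (p - 2))"
  proof -
    have "p * z powr (p - 1) = p * s powr (p - 1) + (z - s) * (p * (p - 1) * w powr (p - 2))"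
      using w(3) by linarith
    moreover have "\<bar>s + x\<bar> powr p = s powr p + x * (p * z powr (p - 1))"
      using z(3) True by simp
    ultimately show ?thesis by (simp only:) (simp add: distrib_left mult.assoc mult.left_commute)
  qed
  ultimately show ?thesis by (simp add: power2_eq_square algebra_simps)
next
  case False
  define y where "y = \<bar>x\<bar>"
  have y: "y \<ge> s" "x = - y" "y > 0" using False s by (auto simp: y_def)
  have "\<bar>s + x\<bar> powr p = (y - s) powr (p - 2) * (y - s)\<^sup>2"
  proof (cases "y = s")
    case False
    then have "y - s > 0" using y by auto
    then have "(y - s) powr p = (y - s) powr (p - 2) * (y - s) powr 2"
      by (subst powr_add[symmetric]) simp
    then show ?thesis using y False by (simp add: powr_numeral)
  qed (use y in auto)
  also have "\<dots> \<le> (s + y) powr (p - 2) * y\<^sup>2"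
    using y s p by (intro mult_mono powr_mono2 power_mono) auto
  finally have 1: "\<bar>s + x\<bar> powr p \<le> (s + y) powr (p - 2) * y\<^sup>2" .
  have "s powr (p - 1) * y = s powr (p - 2) * (s * y)"
    using s by (simp add: powr_diff power2_eq_square)
  also have "\<dots> \<le> (s + y) powr (p - 2) * y\<^sup>2"
    using y s p unfolding power2_eq_square by (intro mult_mono powr_mono2) auto
  finally have 2: "p * (s powr (p - 1) * y) \<le> p * ((s + y) powr (p - 2) * y\<^sup>2)"
    using p by (intro mult_left_mono) auto
  \<comment> \<open>The bounds labelled 1 and 2 together cost \<open>1 + p\<close> copies of the
    quadratic term; the coefficient \<open>p * p\<close> has room for them because
    \<open>p > 2\<close>.\<close>
  have "p * 2 \<le> p * p" using p by (intro mult_left_mono) auto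
  then have "1 + p \<le> p\<^sup>2" using p unfolding power2_eq_square by linarith
  then have "(1 + p) * ((s + y) powr (p - 2) * y\<^sup>2) \<le> p\<^sup>2 * ((s + y) powr (p - 2) * y\<^sup>2)"
    by (intro mult_right_mono) auto
  with 1 2 have "\<bar>s + x\<bar> powr p \<le> - (p * (s powr (p - 1) * y)) + p\<^sup>2 * ((s + y) powr (p - 2) * y\<^sup>2)"
    by (simp add: algebra_simps)
  moreover have "0 \<le> s powr p" by simp
  ultimately have "\<bar>s + x\<bar> powr p \<le> s powr p - p * (s powr (p - 1) * y) + p\<^sup>2 * ((s + y) powr (p - 2) * y\<^sup>2)"
    by linarith
  then show ?thesis
    using y by (simp add: mult.assoc)
qed

text \<open>Reflection of \<open>s\<close> and \<open>x\<close> reduces negative \<open>s\<close> to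
  positive \<open>s\<close>. The coefficient of \<open>x\<close> depends on \<open>s\<close> alone,
  so the linear term has expectation zero once \<open>x\<close> is replaced by a centered variable
  independent of \<open>s\<close>.\<close>

lemma abs_add_powr_le:
  fixes s x p :: real
  assumes p: "2 < p"
  shows "\<bar>s + x\<bar> powr p \<le> \<bar>s\<bar> powr p + p * (sgn s * \<bar>s\<bar> powr (p - 1)) * x
    + p\<^sup>2 * ((\<bar>s\<bar> + \<bar>x\<bar>) powr (p - 2) * x\<^sup>2)"
proof (cases s "0::real" rule: linorder_cases)
  case less
  have "\<bar>s + x\<bar> = \<bar>- s + - x\<bar>" by auto
  then show ?thesis
    using abs_add_powr_le_aux[OF p, of "-s" "-x"] less by (simp add: algebra_simps)
next
  case equal
  show ?thesis
  proof (cases "x = 0")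
    case False
    then have "\<bar>x\<bar> powr p = \<bar>x\<bar> powr (p - 2) * \<bar>x\<bar> powr 2"
      by (subst powr_add[symmetric]) simp
    then have "\<bar>x\<bar> powr p = 1 * (\<bar>x\<bar> powr (p - 2) * x\<^sup>2)"
      using False by (simp add: powr_numeral)
    also have "\<dots> \<le> p\<^sup>2 * (\<bar>x\<bar> powr (p - 2) * x\<^sup>2)"
      using p by (intro mult_right_mono) (auto intro: one_le_power)
    finally show ?thesis using equal by simp
  qed (use equal p in simp)
next
  case greater
  then show ?thesis
    using abs_add_powr_le_aux[OF p, of s x] by (simp add: algebra_simps)
qed

lemma exp_one_le_4: "exp (1::real) \<le> 4"
  using exp_le by simp

text \<open>Cutting at \<open>\<bar>x\<bar> = \<bar>s\<bar> / p\<close> keeps the coefficient of the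
  \<open>s\<close> term below \<open>exp 1\<close>, since
  \<open>(1 + 1 / p) powr (p - 2) \<le> exp 1\<close>; a cut at
  \<open>\<bar>x\<bar> = \<bar>s\<bar>\<close> would cost a power of 2 there. The price
  \<open>p powr (p - 2)\<close> falls on the pure moment of \<open>x\<close>.\<close>

lemma abs_add_powr_split:
  fixes s x p :: real
  assumes p: "2 < p"
  shows "(\<bar>s\<bar> + \<bar>x\<bar>) powr (p - 2) * x\<^sup>2
    \<le> exp 1 * (\<bar>s\<bar> powr (p - 2) * x\<^sup>2) + exp 1 * p powr (p - 2) * \<bar>x\<bar> powr p"
proof -
  have e: "(1 + 1 / p) powr (p - 2) \<le> exp 1"
  proof -
    have "(1 + 1 / p) powr (p - 2) = exp ((p - 2) * ln (1 + 1 / p))"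
      using p by (simp add: powr_def add_pos_pos[THEN less_imp_neq, symmetric])
    also have "\<dots> \<le> exp (p * (1 / p))"
      using p by (intro iffD2[OF exp_le_cancel_iff] mult_mono ln_add_one_self_le_self) auto
    finally show ?thesis using p by simp
  qed
  show ?thesis
  proof (cases "\<bar>x\<bar> \<le> \<bar>s\<bar> / p")
    case True
    have "(\<bar>s\<bar> + \<bar>x\<bar>) powr (p - 2) \<le> (\<bar>s\<bar> * (1 + 1 / p)) powr (p - 2)"
      using True p by (intro powr_mono2) (auto simp: algebra_simps)
    also have "\<dots> = \<bar>s\<bar> powr (p - 2) * (1 + 1 / p) powr (p - 2)"
      using p by (simp add: powr_mult)
    also have "\<dots> \<le> \<bar>s\<bar> powr (p - 2) * exp 1"
      using e by (intro mult_left_mono) auto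
    finally have "(\<bar>s\<bar> + \<bar>x\<bar>) powr (p - 2) * x\<^sup>2 \<le> \<bar>s\<bar> powr (p - 2) * exp 1 * x\<^sup>2"
      by (intro mult_right_mono) auto
    moreover have "\<bar>s\<bar> powr (p - 2) * exp 1 * x\<^sup>2 = exp 1 * (\<bar>s\<bar> powr (p - 2) * x\<^sup>2)" by simp
    moreover have "0 \<le> exp 1 * p powr (p - 2) * \<bar>x\<bar> powr p" by simp
    ultimately show ?thesis by linarith
  next
    case False
    have x0: "x \<noteq> 0" using False p by auto
    have "(\<bar>s\<bar> + \<bar>x\<bar>) powr (p - 2) \<le> (p * \<bar>x\<bar> * (1 + 1 / p)) powr (p - 2)"
      using False p by (intro powr_mono2) (auto simp: field_simps)
    also have "\<dots> = p powr (p - 2) * \<bar>x\<bar> powr (p - 2) * (1 + 1 / p) powr (p - 2)"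
      using p by (simp add: powr_mult)
    also have "\<dots> \<le> p powr (p - 2) * \<bar>x\<bar> powr (p - 2) * exp 1"
      using e by (intro mult_left_mono) auto
    finally have "(\<bar>s\<bar> + \<bar>x\<bar>) powr (p - 2) * x\<^sup>2 \<le> p powr (p - 2) * \<bar>x\<bar> powr (p - 2) * exp 1 * x\<^sup>2"
      by (intro mult_right_mono) auto
    moreover have xp: "\<bar>x\<bar> powr p = \<bar>x\<bar> powr (p - 2) * x\<^sup>2"
    proof -
      have "\<bar>x\<bar> powr p = \<bar>x\<bar> powr (p - 2) * \<bar>x\<bar> powr 2"
        by (subst powr_add[symmetric]) simp
      then show ?thesis using x0 by (simp add: powr_numeral)
    qed
    moreover have "p powr (p - 2) * \<bar>x\<bar> powr (p - 2) * exp 1 * x\<^sup>2 = exp 1 * p powr (p - 2) * \<bar>x\<bar> powr p"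
      unfolding xp by simp
    moreover have "0 \<le> exp 1 * (\<bar>s\<bar> powr (p - 2) * x\<^sup>2)" by simp
    ultimately show ?thesis by linarith
  qed
qed

lemma power_mean_powr:
  fixes f :: "nat \<Rightarrow> real"
  assumes p: "1 \<le> p" and n: "0 < n"
  shows "\<bar>\<Sum>i=1..n. f i\<bar> powr p \<le> real n powr (p - 1) * (\<Sum>i=1..n. \<bar>f i\<bar> powr p)"
proof (cases "(\<Sum>i=1..n. \<bar>f i\<bar>) = 0")
  case True
  then show ?thesis by (simp add: sum_nonneg_eq_0_iff)
next
  case False
  \<comment> \<open>Young's inequality is used with the arithmetic mean as weight, the point at
    which Jensen's inequality has its tangent.\<close>
  define A where "A = (\<Sum>i=1..n. \<bar>f i\<bar>) / n"
  have A: "A > 0"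
  proof -
    have "0 \<le> (\<Sum>i=1..n. \<bar>f i\<bar>)" by (intro sum_nonneg) simp
    then have "0 < (\<Sum>i=1..n. \<bar>f i\<bar>)" using False by linarith
    then show ?thesis using n unfolding A_def by (intro divide_pos_pos) auto
  qed
  have "real n * A = (\<Sum>i=1..n. \<bar>f i\<bar>)" using n by (simp add: A_def)
  also have "\<dots> \<le> (\<Sum>i=1..n. A powr (1 - p) * \<bar>f i\<bar> powr p / p + (1 - 1 / p) * A)"
    using A p by (intro sum_mono Young_scaled) auto
  also have "\<dots> = A powr (1 - p) / p * (\<Sum>i=1..n. \<bar>f i\<bar> powr p) + (1 - 1 / p) * real n * A"
    by (simp add: sum.distrib sum_distrib_left)
  finally have "real n * A / p \<le> A powr (1 - p) / p * (\<Sum>i=1..n. \<bar>f i\<bar> powr p)"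
    by (simp add: algebra_simps)
  then have "real n * A \<le> A powr (1 - p) * (\<Sum>i=1..n. \<bar>f i\<bar> powr p)"
    using p by (simp add: field_simps)
  note le = this
  have "real n * A powr p = A powr (p - 1) * (real n * A)"
    using A by (simp add: powr_diff)
  also have "\<dots> \<le> A powr (p - 1) * (A powr (1 - p) * (\<Sum>i=1..n. \<bar>f i\<bar> powr p))"
    using le by (rule mult_left_mono) simp
  also have "\<dots> = A powr (p - 1 + (1 - p)) * (\<Sum>i=1..n. \<bar>f i\<bar> powr p)"
    unfolding powr_add by (rule mult.assoc[symmetric])
  also have "\<dots> = (\<Sum>i=1..n. \<bar>f i\<bar> powr p)"
    using A by simp
  finally have *: "real n * A powr p \<le> (\<Sum>i=1..n. \<bar>f i\<bar> powr p)" .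
  have "\<bar>\<Sum>i=1..n. f i\<bar> powr p \<le> (real n * A) powr p"
    using p n by (intro powr_mono2) (auto simp: A_def)
  also have "\<dots> = real n powr (p - 1) * (real n * A powr p)"
    using n A by (simp add: powr_mult powr_diff)
  also have "\<dots> \<le> real n powr (p - 1) * (\<Sum>i=1..n. \<bar>f i\<bar> powr p)"
    using * by (intro mult_left_mono) auto
  finally show ?thesis .
qed

subsection \<open>Moments of sums of independent centered variables\<close>

text \<open>The induction step of the moment bound, normalized to \<open>K = 1\<close>. With
  \<open>q = p / 2\<close> and \<open>b = 16 * p * n\<close>, Bernoulli's inequality shows that
  passing from \<open>n\<close> to \<open>n + 1\<close> gains at least
  \<open>b powr q * (q / n)\<close>. Each of the two error terms takes at most half of this gain;
  the factor 4, that is 16 in \<open>b\<close>, is chosen for that. The second one uses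
  \<open>p \<le> n\<close> in the form \<open>p * p \<le> b\<close>.\<close>

lemma moment_recursion_bound:
  fixes p n a :: real
  assumes p: "2 < p" "p \<le> n" and a: "a = 4 * sqrt p * sqrt n"
  shows "a powr p + p\<^sup>2 * exp 1 * a powr (p - 2) + exp 1 * p powr p \<le> (4 * sqrt p * sqrt (n + 1)) powr p"
proof -
  define b where "b = 16 * p * n"
  define q where "q = p / 2"
  have n: "n > 0" and b: "b > 0" and q: "q > 1" using p by (auto simp: b_def q_def)
  have sq: "4 * sqrt p * sqrt x = (16 * p * x) powr (1 / 2)" if "x > 0" for x
  proof -
    have "4 = sqrt 16" by simp
    then show ?thesis using that p by (simp add: powr_half_sqrt real_sqrt_mult)
  qed
  have ap: "a powr p = b powr q" "a powr (p - 2) = b powr q / b"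
    using sq[OF n] n b p unfolding a b_def[symmetric] q_def
    by (simp_all add: powr_powr diff_divide_distrib powr_diff)
  have "(4 * sqrt p * sqrt (n + 1)) powr p = (16 * p * (n + 1)) powr q"
    using sq[of "n + 1"] n p by (simp add: powr_powr q_def)
  also have "16 * p * (n + 1) = b * (1 + 1 / n)"
    using n by (simp add: b_def field_simps)
  also have "(b * (1 + 1 / n)) powr q = b powr q * (1 + 1 / n) powr q"
    using b n by (simp add: powr_mult)
  finally have rhs: "(4 * sqrt p * sqrt (n + 1)) powr p = b powr q * (1 + 1 / n) powr q" .
  have "1 + q / n \<le> (1 + 1 / n) powr q"
    using one_plus_powr_le[of "1 + 1 / n" q] n q by simp
  then have "b powr q * (1 + q / n) \<le> b powr q * (1 + 1 / n) powr q"
    by (intro mult_left_mono) auto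
  then have main: "b powr q + b powr q * (q / n) \<le> (4 * sqrt p * sqrt (n + 1)) powr p"
    unfolding rhs by (simp add: distrib_left)
  have "p\<^sup>2 * exp 1 * (b powr q / b) = b powr q * (exp 1 * (p / (16 * n)))"
    using n p by (simp add: b_def power2_eq_square)
  also have "\<dots> \<le> b powr q * (4 * (p / (16 * n)))"
    using exp_one_le_4 n p by (intro mult_left_mono mult_right_mono) auto
  also have "\<dots> = b powr q * (q / n) / 2"
    by (simp add: q_def)
  finally have 1: "p\<^sup>2 * exp 1 * (b powr q / b) \<le> b powr q * (q / n) / 2" .
  have "exp 1 * p powr p \<le> 4 * p powr p"
    using exp_one_le_4 by (intro mult_right_mono) auto
  also have "4 * p powr p = 4 * (p\<^sup>2 * (p * p) powr (q - 1))"
  proof -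
    have "p powr p = (p * p) powr q"
      using p by (simp add: powr_mult q_def powr_add[symmetric])
    also have "\<dots> = (p * p) * (p * p) powr (q - 1)"
      using p by (simp add: powr_diff)
    finally show ?thesis by (simp add: power2_eq_square)
  qed
  also have "4 * (p\<^sup>2 * (p * p) powr (q - 1)) \<le> 4 * (p\<^sup>2 * b powr (q - 1))"
  proof -
    have "p * p \<le> (16 * p) * n" using p by (intro mult_mono) auto
    then show ?thesis
      using p q unfolding b_def by (intro mult_left_mono powr_mono2) auto
  qed
  also have "\<dots> = b powr q * (q / n) / 2"
    using b n p by (simp add: powr_diff b_def q_def power2_eq_square)
  finally have 2: "exp 1 * p powr p \<le> b powr q * (q / n) / 2" .
  show ?thesis using main 1 2 unfolding ap by linarith
qed

lemma norm_le_norm_real: "0 \<le> a \<Longrightarrow> a \<le> b \<Longrightarrow> norm a \<le> norm (b::real)"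
  by simp

context prob_space
begin

lemma integrable_powr_lower:
  fixes X :: "'a \<Rightarrow> real"
  assumes "integrable M (\<lambda>\<omega>. \<bar>X \<omega>\<bar> powr p)" and [measurable]: "X \<in> borel_measurable M" and q: "0 \<le> q" "q \<le> p"
  shows "integrable M (\<lambda>\<omega>. \<bar>X \<omega>\<bar> powr q)"
proof (rule Bochner_Integration.integrable_bound)
  show "integrable M (\<lambda>\<omega>. 1 + \<bar>X \<omega>\<bar> powr p)" using assms by simp
  have "\<bar>x\<bar> powr q \<le> 1 + \<bar>x\<bar> powr p" for x :: real
  proof (cases "\<bar>x\<bar> \<le> 1")
    case True
    then have "\<bar>x\<bar> powr q \<le> 1 powr q" using q by (intro powr_mono2) auto
    then have "\<bar>x\<bar> powr q \<le> 1" by simp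
    moreover have "0 \<le> \<bar>x\<bar> powr p" by simp
    ultimately show ?thesis by linarith
  next
    case False
    then have "\<bar>x\<bar> powr q \<le> \<bar>x\<bar> powr p" using q by (intro powr_mono) auto
    then show ?thesis by simp
  qed
  then show "AE \<omega> in M. norm (\<bar>X \<omega>\<bar> powr q) \<le> norm (1 + \<bar>X \<omega>\<bar> powr p)"
    by (intro AE_I2) (simp add: abs_of_nonneg)
qed simp

text \<open>
  The classical route to such a bound symmetrizes and uses Khinchine's inequality; here the
  second order expansion of \<open>\<bar>s\<bar> powr p\<close> gives the factor \<open>sqrt p\<close> directly, because
  for \<open>n \<le> p + 1\<close> the power mean inequality suffices.
\<close>

lemma moment_sum_le:
  fixes X :: "nat \<Rightarrow> 'a \<Rightarrow> real"
  assumes indep: "indep_vars (\<lambda>_. borel) X {1..}" and p: "2 < p" and K: "0 < K"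
    and int: "\<And>i. 1 \<le> i \<Longrightarrow> integrable M (\<lambda>\<omega>. \<bar>X i \<omega>\<bar> powr p)"
    and le: "\<And>i. 1 \<le> i \<Longrightarrow> expectation (\<lambda>\<omega>. \<bar>X i \<omega>\<bar> powr p) \<le> K powr p"
    and mean: "\<And>i. 1 \<le> i \<Longrightarrow> expectation (X i) = 0"
  shows "integrable M (\<lambda>\<omega>. \<bar>\<Sum>i=1..n. X i \<omega>\<bar> powr p)
    \<and> expectation (\<lambda>\<omega>. \<bar>\<Sum>i=1..n. X i \<omega>\<bar> powr p) \<le> (4 * sqrt p * sqrt n * K) powr p"
proof (induction n)
  case 0
  then show ?case by simp
next
  case (Suc n)
  have X [measurable]: "X i \<in> borel_measurable M" if "1 \<le> i" for i
    using indep that unfolding indep_vars_def by auto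
  have meas: "(\<lambda>\<omega>. \<Sum>i=1..m. X i \<omega>) \<in> borel_measurable M" for m
    by (intro borel_measurable_sum) auto
  show ?case
  proof (cases "real (Suc n) \<le> p + 1")
    case True
    let ?g = "\<lambda>\<omega>. real (Suc n) powr (p - 1) * (\<Sum>i=1..Suc n. \<bar>X i \<omega>\<bar> powr p)"
    have g: "integrable M ?g"
      using int by (intro integrable_mult_right Bochner_Integration.integrable_sum) auto
    have le': "\<bar>\<Sum>i=1..Suc n. X i \<omega>\<bar> powr p \<le> ?g \<omega>" for \<omega>
      using p by (intro power_mean_powr) auto
    have "integrable M (\<lambda>\<omega>. \<bar>\<Sum>i=1..Suc n. X i \<omega>\<bar> powr p)"
    proof (rule Bochner_Integration.integrable_bound[OF g])
      show "AE \<omega> in M. norm (\<bar>\<Sum>i=1..Suc n. X i \<omega>\<bar> powr p) \<le> norm (?g \<omega>)"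
        by (intro AE_I2 norm_le_norm_real le') simp
    qed (use meas[of "Suc n"] in measurable)
    moreover have "expectation (\<lambda>\<omega>. \<bar>\<Sum>i=1..Suc n. X i \<omega>\<bar> powr p) \<le> expectation ?g"
      using g le' calculation by (intro integral_mono) auto
    moreover have "expectation ?g = real (Suc n) powr (p - 1) * (\<Sum>i=1..Suc n. expectation (\<lambda>\<omega>. \<bar>X i \<omega>\<bar> powr p))"
      using int by (subst integral_mult_right_zero, subst Bochner_Integration.integral_sum) auto
    moreover have "\<dots> \<le> real (Suc n) powr (p - 1) * (\<Sum>i=1..Suc n. K powr p)"
      using le by (intro mult_left_mono sum_mono) auto
    moreover have "\<dots> = (real (Suc n) * K) powr p"
      using K by (simp add: powr_mult powr_diff del: of_nat_Suc)
    moreover have "\<dots> \<le> (4 * sqrt p * sqrt (real (Suc n)) * K) powr p"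
    proof -
      \<comment> \<open>The power mean inequality costs a full factor \<open>Suc n\<close>. As
        \<open>Suc n \<le> 16 * p\<close>, one of its two square roots can be traded for
        \<open>4 * sqrt p\<close>.\<close>
      have "sqrt (real (Suc n)) \<le> sqrt (16 * p)" using True p by (intro real_sqrt_le_mono) linarith
      also have "\<dots> = 4 * sqrt p" by (simp add: real_sqrt_mult)
      finally have "sqrt (real (Suc n)) * sqrt (real (Suc n)) \<le> 4 * sqrt p * sqrt (real (Suc n))"
        by (intro mult_right_mono) auto
      then have "real (Suc n) \<le> 4 * sqrt p * sqrt (real (Suc n))"
        by (simp del: of_nat_Suc)
      then show ?thesis
        using K p by (intro powr_mono2 mult_right_mono) auto
    qed
    ultimately show ?thesis by linarith
  next
    case False
    then have pn: "p \<le> real n" by simp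
    then have n: "n > 0" using p by (intro gr0I) auto
    define S where "S = (\<lambda>\<omega>. \<Sum>i=1..n. X i \<omega>)"
    define Z where "Z = X (Suc n)"
    define A where "A = 4 * sqrt p * sqrt n * K"
    have A: "A > 0" using p n K by (simp add: A_def)
    have S [measurable]: "S \<in> borel_measurable M" unfolding S_def by (rule meas)
    have Z [measurable]: "Z \<in> borel_measurable M" unfolding Z_def by (rule X) simp
    have intS: "integrable M (\<lambda>\<omega>. \<bar>S \<omega>\<bar> powr p)"
      and ES: "expectation (\<lambda>\<omega>. \<bar>S \<omega>\<bar> powr p) \<le> A powr p"
      using Suc.IH by (auto simp: S_def A_def)
    have intZ: "integrable M (\<lambda>\<omega>. \<bar>Z \<omega>\<bar> powr p)"
      and EZ: "expectation (\<lambda>\<omega>. \<bar>Z \<omega>\<bar> powr p) \<le> K powr p"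
      and mZ: "expectation Z = 0"
      using int[of "Suc n"] le[of "Suc n"] mean[of "Suc n"] by (auto simp: Z_def)
    have "integrable M (\<lambda>\<omega>. \<bar>Z \<omega>\<bar> powr 1)"
      using p by (intro integrable_powr_lower[OF intZ]) auto
    then have iZ: "integrable M Z"
      by (subst integrable_abs_iff[symmetric]) auto
    \<comment> \<open>Up to the factor \<open>p\<close>, this is the derivative of
      \<open>\<bar>s\<bar> powr p\<close> at \<open>S\<close>. As a function of \<open>S\<close> it
      is independent of the centered variable \<open>Z\<close>, which removes the linear term of the
      expansion.\<close>
    define T where "T = (\<lambda>\<omega>. sgn (S \<omega>) * \<bar>S \<omega>\<bar> powr (p - 1))"
    have iT: "integrable M T"
    proof (rule Bochner_Integration.integrable_bound)
      show "integrable M (\<lambda>\<omega>. \<bar>S \<omega>\<bar> powr (p - 1))"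
        using p by (intro integrable_powr_lower[OF intS]) auto
      show "AE \<omega> in M. norm (T \<omega>) \<le> norm (\<bar>S \<omega>\<bar> powr (p - 1))"
        by (intro AE_I2) (auto simp: T_def abs_mult abs_sgn_eq)
    qed (simp add: T_def)
    have "{1..Suc n} = insert (Suc n) {1..n}" by auto
    then have "indep_vars (\<lambda>_. borel) X (insert (Suc n) {1..n})"
      using indep_vars_subset[OF indep, of "{1..Suc n}"] by auto
    then have "indep_var borel (X (Suc n)) borel (\<lambda>\<omega>. \<Sum>i\<in>{1..n}. X i \<omega>)"
      by (intro indep_vars_sum) auto
    then have "indep_var borel Z borel S" by (simp add: Z_def S_def)
    then have "indep_var borel ((\<lambda>x. x) \<circ> Z) borel ((\<lambda>s. sgn s * \<bar>s\<bar> powr (p - 1)) \<circ> S)"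
      by (rule indep_var_compose) measurable
    then have ind: "indep_var borel Z borel T"
      by (simp add: T_def comp_def)
    have iTZ: "integrable M (\<lambda>\<omega>. Z \<omega> * T \<omega>)"
      using indep_var_integrable[OF ind iZ iT] .
    have ETZ: "expectation (\<lambda>\<omega>. Z \<omega> * T \<omega>) = 0"
      using indep_var_lebesgue_integral[OF ind iZ iT] mZ by simp
    \<comment> \<open>Young's upper bound for the mixed term, with \<open>S\<close> and
      \<open>Z\<close> normalized by their moment bounds \<open>A\<close> and \<open>K\<close>. This
      normalization makes the expectation of \<open>Y\<close> at most 1.\<close>
    define Y where "Y = (\<lambda>\<omega>. (1 - 2 / p) * (\<bar>S \<omega>\<bar> powr p / A powr p) + 2 / p * (\<bar>Z \<omega>\<bar> powr p / K powr p))"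
    let ?G = "\<lambda>\<omega>. \<bar>S \<omega>\<bar> powr p + p * (Z \<omega> * T \<omega>)
      + p\<^sup>2 * (exp 1 * (A powr (p - 2) * K\<^sup>2 * Y \<omega>) + exp 1 * p powr (p - 2) * \<bar>Z \<omega>\<bar> powr p)"
    have iY: "integrable M Y"
      unfolding Y_def using intS intZ
      by (intro Bochner_Integration.integrable_add integrable_mult_right integrable_divide)
    have iG: "integrable M ?G"
      using intS intZ iTZ iY by (intro Bochner_Integration.integrable_add integrable_mult_right)
    have bd: "\<bar>S \<omega> + Z \<omega>\<bar> powr p \<le> ?G \<omega>" for \<omega>
    proof -
      have "(\<bar>S \<omega>\<bar> / A) powr (p - 2) * (\<bar>Z \<omega>\<bar> / K)\<^sup>2
          \<le> (1 - 2 / p) * (\<bar>S \<omega>\<bar> / A) powr p + 2 / p * (\<bar>Z \<omega>\<bar> / K) powr p"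
        using A K p by (intro Young_powr_mult_square) auto
      also have "\<dots> = Y \<omega>" using A K by (simp add: powr_divide Y_def)
      finally have "A powr (p - 2) * K\<^sup>2 * ((\<bar>S \<omega>\<bar> / A) powr (p - 2) * (\<bar>Z \<omega>\<bar> / K)\<^sup>2)
          \<le> A powr (p - 2) * K\<^sup>2 * Y \<omega>"
        by (intro mult_left_mono) auto
      moreover have "A powr (p - 2) * K\<^sup>2 * ((\<bar>S \<omega>\<bar> / A) powr (p - 2) * (\<bar>Z \<omega>\<bar> / K)\<^sup>2)
          = \<bar>S \<omega>\<bar> powr (p - 2) * (Z \<omega>)\<^sup>2"
        using A K by (simp add: powr_divide power_divide)
      ultimately have "\<bar>S \<omega>\<bar> powr (p - 2) * (Z \<omega>)\<^sup>2 \<le> A powr (p - 2) * K\<^sup>2 * Y \<omega>" by simp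
      then have "p\<^sup>2 * (exp 1 * (\<bar>S \<omega>\<bar> powr (p - 2) * (Z \<omega>)\<^sup>2) + exp 1 * p powr (p - 2) * \<bar>Z \<omega>\<bar> powr p)
        \<le> p\<^sup>2 * (exp 1 * (A powr (p - 2) * K\<^sup>2 * Y \<omega>) + exp 1 * p powr (p - 2) * \<bar>Z \<omega>\<bar> powr p)"
        by (intro mult_left_mono add_right_mono) auto
      moreover have "p\<^sup>2 * ((\<bar>S \<omega>\<bar> + \<bar>Z \<omega>\<bar>) powr (p - 2) * (Z \<omega>)\<^sup>2)
        \<le> p\<^sup>2 * (exp 1 * (\<bar>S \<omega>\<bar> powr (p - 2) * (Z \<omega>)\<^sup>2) + exp 1 * p powr (p - 2) * \<bar>Z \<omega>\<bar> powr p)"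
        by (intro mult_left_mono abs_add_powr_split[OF p]) auto
      moreover have "p * (sgn (S \<omega>) * \<bar>S \<omega>\<bar> powr (p - 1)) * Z \<omega> = p * (Z \<omega> * T \<omega>)"
        by (simp add: T_def)
      ultimately show ?thesis
        using abs_add_powr_le[OF p, of "S \<omega>" "Z \<omega>"] by linarith
    qed
    have iSZ: "integrable M (\<lambda>\<omega>. \<bar>S \<omega> + Z \<omega>\<bar> powr p)"
    proof (rule Bochner_Integration.integrable_bound[OF iG])
      show "AE \<omega> in M. norm (\<bar>S \<omega> + Z \<omega>\<bar> powr p) \<le> norm (?G \<omega>)"
        by (intro AE_I2 norm_le_norm_real bd) simp
    qed simp
    have EY: "expectation Y \<le> 1"
    proof -
      have "expectation Y = (1 - 2 / p) * (expectation (\<lambda>\<omega>. \<bar>S \<omega>\<bar> powr p) / A powr p)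
          + 2 / p * (expectation (\<lambda>\<omega>. \<bar>Z \<omega>\<bar> powr p) / K powr p)"
        unfolding Y_def using intS intZ by (subst Bochner_Integration.integral_add) auto
      also have "\<dots> \<le> (1 - 2 / p) * 1 + 2 / p * 1"
        using ES EZ A K p by (intro add_mono mult_left_mono) auto
      finally show ?thesis by simp
    qed
    have "expectation (\<lambda>\<omega>. \<bar>S \<omega> + Z \<omega>\<bar> powr p) \<le> expectation ?G"
      using iSZ iG bd by (intro integral_mono) auto
    also have "\<dots> = expectation (\<lambda>\<omega>. \<bar>S \<omega>\<bar> powr p) + p * expectation (\<lambda>\<omega>. Z \<omega> * T \<omega>)
      + p\<^sup>2 * (exp 1 * (A powr (p - 2) * K\<^sup>2 * expectation Y)
          + exp 1 * p powr (p - 2) * expectation (\<lambda>\<omega>. \<bar>Z \<omega>\<bar> powr p))"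
      using intS intZ iTZ iY by (simp only: Bochner_Integration.integral_add integral_mult_right_zero
          Bochner_Integration.integrable_add integrable_mult_right)
    also have "\<dots> \<le> A powr p + p * 0
      + p\<^sup>2 * (exp 1 * (A powr (p - 2) * K\<^sup>2 * 1) + exp 1 * p powr (p - 2) * K powr p)"
      using ES EZ EY ETZ p by (intro add_mono mult_left_mono) auto
    \<comment> \<open>Factoring out \<open>K powr p\<close> leaves the left side of
      \<open>moment_recursion_bound\<close> for \<open>a = A / K\<close>.\<close>
    also have "\<dots> = ((A / K) powr p + p\<^sup>2 * exp 1 * (A / K) powr (p - 2) + exp 1 * p powr p) * K powr p"
    proof -
      have "K powr p = K powr (p - 2) * K\<^sup>2" "p powr p = p powr (p - 2) * p\<^sup>2"
        using K p by (simp_all add: powr_diff)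
      then show ?thesis
        using A K p by (simp add: powr_divide distrib_left distrib_right)
    qed
    also have "\<dots> \<le> (4 * sqrt p * sqrt (real n + 1)) powr p * K powr p"
      using pn p K by (intro mult_right_mono moment_recursion_bound) (auto simp: A_def)
    also have "\<dots> = (4 * sqrt p * sqrt (real (Suc n)) * K) powr p"
      using p K by (simp add: powr_mult add.commute)
    finally show ?thesis
      using iSZ by (simp add: S_def Z_def)
  qed
qed

end

subsection \<open>From characteristic functions to bounded Lipschitz functions of random vectors\<close>

lemma product_prob_space_std_normal: "product_prob_space (\<lambda>_. std_normal_distribution)"
  by (auto simp: product_prob_space_def product_prob_space_axioms_def product_sigma_finite_def
      intro!: prob_space_imp_sigma_finite prob_space_normal_density)

text \<open>Smoothing by independent centered normal noise of standard deviation \<open>s\<close> in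
  each of \<open>m\<close> coordinates. The smoothed law has a density that is an explicit integral
  of the characteristic function, while a Lipschitz function changes its expectation only by a
  multiple of \<open>s\<close>. Convergence of characteristic functions can therefore be transferred
  to densities.\<close>

locale smoothing =
  fixes m :: nat and s :: real
  assumes s_pos: "0 < s"
begin

definition Leb :: "(nat \<Rightarrow> real) measure" where
  "Leb = PiM {..<m} (\<lambda>_. lborel)"

definition kern :: "(nat \<Rightarrow> real) \<Rightarrow> (nat \<Rightarrow> real) \<Rightarrow> real" where
  "kern x y = (\<Prod>i<m. normal_density (x i) s (y i))"

sublocale L: product_sigma_finite "\<lambda>_::nat. lborel :: real measure" ..

sublocale Leb: sigma_finite_measure Leb
  unfolding Leb_def by (rule L.sigma_finite) simp

lemma kern_nonneg [simp]: "0 \<le> kern x y"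
  unfolding kern_def by (intro prod_nonneg) simp

lemma measurable_Leb_component [measurable]: "i < m \<Longrightarrow> (\<lambda>y. y i) \<in> borel_measurable Leb"
  unfolding Leb_def by (rule measurable_component_singleton[where M="\<lambda>_. lborel", simplified]) simp

lemma integrable_kern: "integrable Leb (kern x)"
  unfolding Leb_def kern_def using s_pos
  by (intro L.product_integrable_prod) auto

lemma integral_kern: "(\<integral>y. kern x y \<partial>Leb) = 1"
  unfolding Leb_def kern_def using s_pos
  by (subst L.product_integral_prod) auto

lemma nn_integral_kern: "(\<integral>\<^sup>+y. kern x y \<partial>Leb) = 1"
  by (subst nn_integral_eq_integral[OF integrable_kern]) (auto simp: integral_kern)

lemma kern_first_moment:
  assumes "i < m"
  shows "integrable Leb (\<lambda>y. \<bar>y i - x i\<bar> * kern x y)"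
    and "(\<integral>y. \<bar>y i - x i\<bar> * kern x y \<partial>Leb) = s * sqrt (2 / pi)"
proof -
  define g where "g j t = (if j = i then \<bar>t - x i\<bar> else 1) * normal_density (x j) s t" for j t
  have eq: "\<bar>y i - x i\<bar> * kern x y = (\<Prod>j<m. g j (y j))" for y
    using assms by (simp add: g_def kern_def prod.distrib)
  have 1: "has_bochner_integral lborel (g i) (s * sqrt (2 / pi))"
    using normal_moment_abs_odd[of s "x i" 0] s_pos by (simp add: g_def[abs_def] mult.commute)
  have 2: "has_bochner_integral lborel (g j) 1" if "j \<noteq> i" for j
    using that s_pos by (simp add: g_def[abs_def] has_bochner_integral_iff)
  have int: "integrable lborel (g j)" for j
    using 1 2 by (cases "j = i") (auto simp: has_bochner_integral_iff)
  have val: "integral\<^sup>L lborel (g j) = (if j = i then s * sqrt (2 / pi) else 1)" for j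
    using 1 2 by (cases "j = i") (auto simp: has_bochner_integral_iff)
  show "integrable Leb (\<lambda>y. \<bar>y i - x i\<bar> * kern x y)"
    unfolding eq Leb_def by (intro L.product_integrable_prod int) auto
  show "(\<integral>y. \<bar>y i - x i\<bar> * kern x y \<partial>Leb) = s * sqrt (2 / pi)"
    unfolding eq Leb_def using assms by (subst L.product_integral_prod) (auto simp: int val)
qed

text \<open>The Gaussian is its own Fourier transform: the kernel is, up to a constant, the
  characteristic function of a standard normal vector \<open>G\<close> at
  \<open>(y - x) / s\<close>. This takes the place of an inversion formula.\<close>

lemma kern_char:
  "complex_of_real (kern x y) = complex_of_real ((1 / sqrt (2 * pi * s\<^sup>2)) ^ m) *
    (CLINT G|PiM {..<m} (\<lambda>_. std_normal_distribution). (\<Prod>j<m. iexp (G j * ((y j - x j) / s))))"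
proof -
  interpret N: product_prob_space "\<lambda>_::nat. std_normal_distribution" "{..<m}"
    by (rule product_prob_space_std_normal)
  have nd: "complex_of_real (normal_density a s b)
      = complex_of_real (1 / sqrt (2 * pi * s\<^sup>2)) * (CLINT g|std_normal_distribution. iexp (g * ((b - a) / s)))"
    for a b
  proof -
    have "(CLINT g|std_normal_distribution. iexp (g * ((b - a) / s))) = char std_normal_distribution ((b - a) / s)"
      by (simp add: char_def mult.commute)
    also have "\<dots> = complex_of_real (exp (- (((b - a) / s)\<^sup>2) / 2))"
      by (simp only: char_std_normal_distribution)
    finally show ?thesis
      by (simp add: normal_density_def power_divide mult.commute)
  qed
  have "complex_of_real (kern x y) = (\<Prod>j<m. complex_of_real (1 / sqrt (2 * pi * s\<^sup>2)) *
      (CLINT g|std_normal_distribution. iexp (g * ((y j - x j) / s))))"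
    by (simp only: kern_def of_real_prod nd)
  also have "\<dots> = complex_of_real ((1 / sqrt (2 * pi * s\<^sup>2)) ^ m) *
      (\<Prod>j<m. CLINT g|std_normal_distribution. iexp (g * ((y j - x j) / s)))"
    by (simp only: prod.distrib prod_constant card_lessThan of_real_power)
  also have "(\<Prod>j<m. CLINT g|std_normal_distribution. iexp (g * ((y j - x j) / s)))
      = (CLINT G|PiM {..<m} (\<lambda>_. std_normal_distribution). (\<Prod>j<m. iexp (G j * ((y j - x j) / s))))"
  proof (rule N.product_integral_prod[symmetric])
    show "complex_integrable std_normal_distribution (\<lambda>g. iexp (g * ((y j - x j) / s)))" for j
      by (rule N.M.integrable_const_bound[of _ 1]) (simp_all only: norm_exp_i_times, auto)
  qed simp
  finally show ?thesis .
qed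

end

text \<open>The Lipschitz bound makes \<open>f\<close> continuous for the product topology and
  dependent on the coordinates below \<open>m\<close> only. The remaining coordinates of
  \<open>X\<close> may fail to be measurable, so they are first replaced by 0.\<close>

lemma borel_measurable_Lipschitz_coordinates:
  fixes f :: "(nat \<Rightarrow> real) \<Rightarrow> real"
  assumes lip: "\<And>x y. \<bar>f x - f y\<bar> \<le> (\<Sum>i<m. c i * \<bar>x i - y i\<bar>)"
    and X: "\<And>i. i < m \<Longrightarrow> (\<lambda>\<omega>. X \<omega> i) \<in> borel_measurable M"
  shows "(\<lambda>\<omega>. f (X \<omega>)) \<in> borel_measurable M"
proof -
  define X' where "X' \<omega> i = (if i < m then X \<omega> i else 0)" for \<omega> i
  have "continuous_on UNIV f"
    unfolding continuous_on_def
  proof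
    fix a :: "nat \<Rightarrow> real"
    have t: "((\<lambda>x. x i) \<longlongrightarrow> a i) (at a)" for i
      using continuous_on_product_coordinates[of i] unfolding continuous_on_def by auto
    have "((\<lambda>x. \<Sum>i<m. c i * \<bar>x i - a i\<bar>) \<longlongrightarrow> (\<Sum>i<m. c i * \<bar>a i - a i\<bar>)) (at a)"
      by (intro tendsto_intros t)
    then have z: "((\<lambda>x. \<Sum>i<m. c i * \<bar>x i - a i\<bar>) \<longlongrightarrow> 0) (at a)" by simp
    have "((\<lambda>x. f x - f a) \<longlongrightarrow> 0) (at a)"
      by (rule Lim_null_comparison[OF _ z]) (simp add: lip)
    then show "(f \<longlongrightarrow> f a) (at a within UNIV)" by (simp add: LIM_zero_iff)
  qed
  then have f: "f \<in> borel_measurable borel" by (rule borel_measurable_continuous_onI)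
  have "X' \<in> borel_measurable M"
  proof (rule measurable_coordinatewise_then_product)
    show "(\<lambda>\<omega>. X' \<omega> i) \<in> borel_measurable M" for i
      by (cases "i < m") (auto simp: X'_def X)
  qed
  then have "(\<lambda>\<omega>. f (X' \<omega>)) \<in> borel_measurable M"
    using f by (rule measurable_compose)
  moreover have "f (X' \<omega>) = f (X \<omega>)" for \<omega>
    using lip[of "X' \<omega>" "X \<omega>"] by (simp add: X'_def)
  ultimately show ?thesis by simp
qed

locale smoothed_law = smoothing m s + prob_space M
  for m s and M :: "'a measure" +
  fixes X :: "'a \<Rightarrow> nat \<Rightarrow> real"
  assumes meas_X: "\<And>i. i < m \<Longrightarrow> (\<lambda>\<omega>. X \<omega> i) \<in> borel_measurable M"
begin

text \<open>The density of the law of \<open>X\<close> convolved with the normal law of variance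
  \<open>s * s\<close> in each coordinate.\<close>

definition dens :: "(nat \<Rightarrow> real) \<Rightarrow> real" where
  "dens y = (\<integral>\<omega>. kern (X \<omega>) y \<partial>M)"

sublocale prd: pair_sigma_finite M Leb ..

lemma measurable_kern_X [measurable]: "(\<lambda>(\<omega>, y). kern (X \<omega>) y) \<in> borel_measurable (M \<Otimes>\<^sub>M Leb)"
proof -
  have [measurable]: "(\<lambda>z. X (fst z) i) \<in> borel_measurable (M \<Otimes>\<^sub>M Leb)"
    "(\<lambda>z. snd z i) \<in> borel_measurable (M \<Otimes>\<^sub>M Leb)" if "i < m" for i
    using measurable_compose[OF measurable_fst meas_X[OF that]]
      measurable_compose[OF measurable_snd measurable_Leb_component[OF that]] by auto
  show ?thesis
    unfolding kern_def normal_density_def split_beta' by measurable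
qed

lemma integrable_bounded_kern:
  assumes [measurable]: "(\<lambda>(\<omega>, y). g \<omega> y) \<in> borel_measurable (M \<Otimes>\<^sub>M Leb)"
    and bd: "\<And>\<omega> y. \<bar>g \<omega> y\<bar> \<le> B"
  shows "integrable (M \<Otimes>\<^sub>M Leb) (\<lambda>(\<omega>, y). g \<omega> y * kern (X \<omega>) y)"
proof (rule integrableI_bounded)
  have m: "(\<lambda>(\<omega>, y). ennreal (norm (g \<omega> y * kern (X \<omega>) y))) \<in> borel_measurable (M \<Otimes>\<^sub>M Leb)"
    by measurable
  have B: "0 \<le> B" using bd[of undefined undefined] by linarith
  have "(\<integral>\<^sup>+z. ennreal (norm (case z of (\<omega>, y) \<Rightarrow> g \<omega> y * kern (X \<omega>) y)) \<partial>(M \<Otimes>\<^sub>M Leb))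
      = (\<integral>\<^sup>+\<omega>. \<integral>\<^sup>+y. ennreal (norm (g \<omega> y * kern (X \<omega>) y)) \<partial>Leb \<partial>M)"
    using Leb.nn_integral_fst[OF m] by (simp add: split_beta')
  also have "\<dots> \<le> (\<integral>\<^sup>+\<omega>. \<integral>\<^sup>+y. ennreal B * ennreal (kern (X \<omega>) y) \<partial>Leb \<partial>M)"
    using bd B by (intro nn_integral_mono)
      (auto simp: ennreal_mult[symmetric] abs_mult intro!: ennreal_leI mult_right_mono)
  also have "\<dots> = ennreal B"
    using integrable_kern by (simp add: nn_integral_cmult nn_integral_kern emeasure_space_1)
  finally show "(\<integral>\<^sup>+z. ennreal (norm (case z of (\<omega>, y) \<Rightarrow> g \<omega> y * kern (X \<omega>) y)) \<partial>(M \<Otimes>\<^sub>M Leb)) < \<infinity>"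
    by (simp add: le_less_trans[OF _ ennreal_less_top])
qed measurable

lemma integrable_dens: "integrable Leb dens"
  using prd.integrable_snd[of "\<lambda>\<omega> y. kern (X \<omega>) y"] integrable_bounded_kern[of "\<lambda>_ _. 1" 1]
  by (simp add: dens_def[abs_def])

lemma dens_nonneg [simp]: "0 \<le> dens y"
  unfolding dens_def by (intro Bochner_Integration.integral_nonneg) simp

lemma integral_dens: "(\<integral>y. dens y \<partial>Leb) = 1"
proof -
  have i: "integrable (M \<Otimes>\<^sub>M Leb) (\<lambda>(\<omega>, y). kern (X \<omega>) y)"
    using integrable_bounded_kern[of "\<lambda>_ _. 1" 1] by simp
  have "(\<integral>y. dens y \<partial>Leb) = (\<integral>\<omega>. (\<integral>y. kern (X \<omega>) y \<partial>Leb) \<partial>M)"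
    unfolding dens_def using prd.Fubini_integral[OF i] by simp
  then show ?thesis by (simp add: integral_kern prob_space)
qed

text \<open>Adding the noise moves coordinate \<open>i\<close> by \<open>s * sqrt (2 / pi)\<close>
  on average, the first absolute moment of a centered normal variable with deviation
  \<open>s\<close>.\<close>

lemma expectation_smoothed:
  fixes f :: "(nat \<Rightarrow> real) \<Rightarrow> real"
  assumes bd: "\<And>x. \<bar>f x\<bar> \<le> B"
    and lip: "\<And>x y. \<bar>f x - f y\<bar> \<le> (\<Sum>i<m. c i * \<bar>x i - y i\<bar>)"
  shows "\<bar>expectation (\<lambda>\<omega>. f (X \<omega>)) - (\<integral>y. f y * dens y \<partial>Leb)\<bar> \<le> (\<Sum>i<m. c i) * (s * sqrt (2 / pi))"
proof -
  have fX [measurable]: "(\<lambda>\<omega>. f (X \<omega>)) \<in> borel_measurable M"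
    by (rule borel_measurable_Lipschitz_coordinates[OF lip]) (rule meas_X)
  have f [measurable]: "f \<in> borel_measurable Leb"
    by (rule borel_measurable_Lipschitz_coordinates[OF lip]) simp
  have i: "integrable (M \<Otimes>\<^sub>M Leb) (\<lambda>(\<omega>, y). f y * kern (X \<omega>) y)"
    by (rule integrable_bounded_kern[of "\<lambda>_ y. f y" B]) (auto simp: bd)
  have j: "integrable M (\<lambda>\<omega>. f (X \<omega>))"
    by (rule integrable_const_bound[of _ B]) (auto simp: bd)
  have k: "integrable M (\<lambda>\<omega>. \<integral>y. f y * kern (X \<omega>) y \<partial>Leb)"
    using prd.integrable_fst[OF i] by simp
  have bk: "integrable Leb (\<lambda>y. f y * kern x y)" for x
  proof (rule Bochner_Integration.integrable_bound)
    show "integrable Leb (\<lambda>y. B * kern x y)" using integrable_kern by simp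
    show "AE y in Leb. norm (f y * kern x y) \<le> norm (B * kern x y)"
      using bd by (intro AE_I2) (auto simp: abs_mult intro!: mult_right_mono order_trans[OF bd abs_ge_self])
  qed (use integrable_kern in simp)
  have step: "\<bar>f x - (\<integral>y. f y * kern x y \<partial>Leb)\<bar> \<le> (\<Sum>i<m. c i) * (s * sqrt (2 / pi))" for x
  proof -
    have im: "integrable Leb (\<lambda>y. \<Sum>i<m. c i * (\<bar>y i - x i\<bar> * kern x y))"
      by (intro Bochner_Integration.integrable_sum integrable_mult_right kern_first_moment) auto
    have id: "integrable Leb (\<lambda>y. f x * kern x y - f y * kern x y)"
      using integrable_kern bk by simp
    have "f x - (\<integral>y. f y * kern x y \<partial>Leb) = (\<integral>y. f x * kern x y - f y * kern x y \<partial>Leb)"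
      using integrable_kern bk by (simp add: integral_kern)
    also have "\<bar>\<dots>\<bar> \<le> (\<integral>y. \<bar>f x * kern x y - f y * kern x y\<bar> \<partial>Leb)"
      using integral_norm_bound[of Leb "\<lambda>y. f x * kern x y - f y * kern x y"] by simp
    also have "\<dots> \<le> (\<integral>y. (\<Sum>i<m. c i * (\<bar>y i - x i\<bar> * kern x y)) \<partial>Leb)"
    proof (intro integral_mono im integrable_abs id)
      fix y
      have "\<bar>f x * kern x y - f y * kern x y\<bar> = \<bar>f y - f x\<bar> * kern x y"
        by (simp add: left_diff_distrib[symmetric] abs_mult abs_minus_commute)
      also have "\<dots> \<le> (\<Sum>i<m. c i * \<bar>y i - x i\<bar>) * kern x y"
        by (intro mult_right_mono lip) simp
      finally show "\<bar>f x * kern x y - f y * kern x y\<bar> \<le> (\<Sum>i<m. c i * (\<bar>y i - x i\<bar> * kern x y))"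
        by (simp add: sum_distrib_right mult.assoc)
    qed
    also have "\<dots> = (\<Sum>i<m. c i * (s * sqrt (2 / pi)))"
      using kern_first_moment
      by (subst Bochner_Integration.integral_sum) (auto intro!: integrable_mult_right sum.cong)
    finally show ?thesis by (simp add: sum_distrib_right)
  qed
  have "(\<integral>y. f y * dens y \<partial>Leb) = (\<integral>\<omega>. (\<integral>y. f y * kern (X \<omega>) y \<partial>Leb) \<partial>M)"
    unfolding dens_def using prd.Fubini_integral[OF i] by simp
  then have "expectation (\<lambda>\<omega>. f (X \<omega>)) - (\<integral>y. f y * dens y \<partial>Leb)
      = (\<integral>\<omega>. f (X \<omega>) - (\<integral>y. f y * kern (X \<omega>) y \<partial>Leb) \<partial>M)"
    using j k by simp
  also have "\<bar>\<dots>\<bar> \<le> (\<integral>\<omega>. \<bar>f (X \<omega>) - (\<integral>y. f y * kern (X \<omega>) y \<partial>Leb)\<bar> \<partial>M)"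
    using integral_norm_bound[of M "\<lambda>\<omega>. f (X \<omega>) - (\<integral>y. f y * kern (X \<omega>) y \<partial>Leb)"] by simp
  also have "\<dots> \<le> (\<integral>\<omega>. (\<Sum>i<m. c i) * (s * sqrt (2 / pi)) \<partial>M)"
    using j k step by (intro integral_mono) auto
  finally show ?thesis by (simp add: prob_space)
qed

text \<open>After \<open>kern_char\<close>, Fubini brings the expectation over \<open>M\<close>
  inside. The density then depends on the law of \<open>X\<close> only through its characteristic
  function, at the random argument \<open>- G / s\<close>.\<close>

lemma dens_char:
  "complex_of_real (dens y) = complex_of_real ((1 / sqrt (2 * pi * s\<^sup>2)) ^ m) *
    (CLINT G|PiM {..<m} (\<lambda>_. std_normal_distribution).
      iexp (\<Sum>j<m. G j * y j / s) * (CLINT \<omega>|M. iexp (\<Sum>j<m. (- G j / s) * X \<omega> j)))"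
proof -
  interpret N: product_prob_space "\<lambda>_::nat. std_normal_distribution" "{..<m}"
    by (rule product_prob_space_std_normal)
  let ?N = "PiM {..<m} (\<lambda>_. std_normal_distribution)"
  interpret MN: pair_prob_space M ?N ..
  define e where "e \<omega> G = iexp (\<Sum>j<m. G j * ((y j - X \<omega> j) / s))" for \<omega> and G :: "nat \<Rightarrow> real"
  have e: "e \<omega> G = (\<Prod>j<m. iexp (G j * ((y j - X \<omega> j) / s)))" for \<omega> G
    unfolding e_def by (simp add: exp_sum[symmetric] sum_distrib_left)
  have e': "e \<omega> G = iexp (\<Sum>j<m. G j * y j / s) * iexp (\<Sum>j<m. (- G j / s) * X \<omega> j)" for \<omega> G
    unfolding e_def exp_add[symmetric] distrib_left[symmetric] of_real_add[symmetric] sum.distrib[symmetric]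
    by (intro arg_cong[of _ _ exp] arg_cong[of _ _ "\<lambda>x. \<i> * complex_of_real x"] sum.cong refl)
      (simp add: field_simps diff_divide_distrib)
  have [measurable]: "(\<lambda>z. X (fst z) i) \<in> borel_measurable (M \<Otimes>\<^sub>M ?N)"
    "(\<lambda>z. snd z i) \<in> borel_measurable (M \<Otimes>\<^sub>M ?N)" if "i < m" for i
  proof -
    show "(\<lambda>z. X (fst z) i) \<in> borel_measurable (M \<Otimes>\<^sub>M ?N)"
      by (rule measurable_compose[OF measurable_fst meas_X[OF that]])
    have "(\<lambda>G. G i) \<in> measurable ?N std_normal_distribution"
      using that by (intro measurable_component_singleton) simp
    then have "(\<lambda>G. G i) \<in> borel_measurable ?N" by simp
    then show "(\<lambda>z. snd z i) \<in> borel_measurable (M \<Otimes>\<^sub>M ?N)"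
      by (rule measurable_compose[OF measurable_snd])
  qed
  have int: "integrable (M \<Otimes>\<^sub>M ?N) (\<lambda>(\<omega>, G). e \<omega> G)"
  proof (rule MN.P.integrable_const_bound[of _ 1])
    show "(\<lambda>(\<omega>, G). e \<omega> G) \<in> borel_measurable (M \<Otimes>\<^sub>M ?N)"
      unfolding e_def split_beta' by measurable
  qed (auto simp: e_def)
  have "complex_of_real (dens y) = (CLINT \<omega>|M. complex_of_real (kern (X \<omega>) y))"
    unfolding dens_def by (simp add: integral_of_real)
  also have "\<dots> = (CLINT \<omega>|M. complex_of_real ((1 / sqrt (2 * pi * s\<^sup>2)) ^ m) * (CLINT G|?N. e \<omega> G))"
    by (simp only: kern_char e)
  also have "\<dots> = complex_of_real ((1 / sqrt (2 * pi * s\<^sup>2)) ^ m) * (CLINT \<omega>|M. CLINT G|?N. e \<omega> G)"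
    by (rule integral_mult_right_zero)
  also have "(CLINT \<omega>|M. CLINT G|?N. e \<omega> G) = (CLINT G|?N. CLINT \<omega>|M. e \<omega> G)"
    using MN.Fubini_integral[OF int] by simp
  finally show ?thesis
    unfolding e' by (simp only: integral_mult_right_zero)
qed

end

text \<open>For fixed \<open>s\<close> the smoothed densities converge pointwise by dominated
  convergence in \<open>G\<close>, and then in L1 by Scheffe's lemma. The smoothing level is chosen
  beforehand so that both smoothing errors stay below \<open>e / 3\<close>, independently of
  \<open>n\<close>.\<close>

lemma tendsto_expectation_of_char:
  fixes V :: "nat \<Rightarrow> 'v \<Rightarrow> nat \<Rightarrow> real" and W :: "'u \<Rightarrow> nat \<Rightarrow> real"
  assumes Q: "prob_space Q" and R: "prob_space R"
    and V: "\<And>n i. i < m \<Longrightarrow> (\<lambda>\<omega>. V n \<omega> i) \<in> borel_measurable Q"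
    and W: "\<And>i. i < m \<Longrightarrow> (\<lambda>\<omega>. W \<omega> i) \<in> borel_measurable R"
    and conv: "\<And>c. (\<lambda>n. CLINT \<omega>|Q. iexp (\<Sum>j<m. c j * V n \<omega> j)) \<longlonglongrightarrow> (CLINT \<omega>|R. iexp (\<Sum>j<m. c j * W \<omega> j))"
    and bd: "\<And>x. \<bar>f x\<bar> \<le> B"
    and lip: "\<And>x y. \<bar>f x - f y\<bar> \<le> (\<Sum>i<m. c i * \<bar>x i - y i\<bar>)"
  shows "(\<lambda>n. \<integral>\<omega>. f (V n \<omega>) \<partial>Q) \<longlonglongrightarrow> (\<integral>\<omega>. f (W \<omega>) \<partial>R)"
proof (rule LIMSEQ_I)
  fix e :: real assume e: "0 < e"
  \<comment> \<open>The summand 1 keeps \<open>C\<close> positive even if the Lipschitz constants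
    add up to 0.\<close>
  define C where "C = \<bar>\<Sum>i<m. c i\<bar> * sqrt (2 / pi) + 1"
  have C: "C > 0" by (auto simp: C_def intro!: add_nonneg_pos mult_nonneg_nonneg)
  define s where "s = e / (3 * C)"
  have s: "s > 0" using e C by (simp add: s_def)
  have sC: "(\<Sum>i<m. c i) * (s * sqrt (2 / pi)) \<le> e / 3"
  proof -
    have "(\<Sum>i<m. c i) * (s * sqrt (2 / pi)) \<le> \<bar>\<Sum>i<m. c i\<bar> * (s * sqrt (2 / pi))"
      using s by (intro mult_right_mono) auto
    also have "\<dots> = s * (C - 1)" by (simp add: C_def)
    also have "\<dots> \<le> s * C" using s by (intro mult_left_mono) auto
    also have "\<dots> = e / 3" using C by (simp add: s_def)
    finally show ?thesis .
  qed
  interpret sm: smoothing m s using s by unfold_locales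
  interpret R: smoothed_law m s R W
    using R W s by (simp add: smoothed_law_def smoothed_law_axioms_def smoothing_def)
  have "smoothed_law m s Q (V n)" for n
    using Q V s by (simp add: smoothed_law_def smoothed_law_axioms_def smoothing_def)
  then interpret Q: smoothed_law m s Q "V n" for n .
  interpret N: product_prob_space "\<lambda>_::nat. std_normal_distribution" "{..<m}"
    by (rule product_prob_space_std_normal)
  let ?N = "PiM {..<m} (\<lambda>_. std_normal_distribution)"
  interpret NQ: pair_prob_space ?N Q ..
  interpret NR: pair_prob_space ?N R ..
  have comp [measurable]: "(\<lambda>G. G i) \<in> borel_measurable ?N" if "i < m" for i
  proof -
    have "(\<lambda>G. G i) \<in> measurable ?N std_normal_distribution"
      using that by (intro measurable_component_singleton) simp
    then show ?thesis by simp
  qed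
  have pw: "(\<lambda>n. Q.dens n y) \<longlonglongrightarrow> R.dens y" for y
  proof -
    define g where "g = (\<lambda>n G. iexp (\<Sum>j<m. G j * y j / s) * (CLINT \<omega>|Q. iexp (\<Sum>j<m. (- G j / s) * V n \<omega> j)))"
    define g0 where "g0 = (\<lambda>G. iexp (\<Sum>j<m. G j * y j / s) * (CLINT \<omega>|R. iexp (\<Sum>j<m. (- G j / s) * W \<omega> j)))"
    have mq: "g n \<in> borel_measurable ?N" for n
    proof -
      have [measurable]: "(\<lambda>z. V n (snd z) i) \<in> borel_measurable (?N \<Otimes>\<^sub>M Q)"
        "(\<lambda>z. fst z i) \<in> borel_measurable (?N \<Otimes>\<^sub>M Q)" if "i < m" for i
        using measurable_compose[OF measurable_snd V[OF that]] measurable_compose[OF measurable_fst comp[OF that]]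
        by auto
      have "(\<lambda>(G, \<omega>). iexp (\<Sum>j<m. (- G j / s) * V n \<omega> j)) \<in> borel_measurable (?N \<Otimes>\<^sub>M Q)"
        unfolding split_beta' by measurable
      then have [measurable]: "(\<lambda>G. CLINT \<omega>|Q. iexp (\<Sum>j<m. (- G j / s) * V n \<omega> j)) \<in> borel_measurable ?N"
        by (rule Q.borel_measurable_lebesgue_integral)
      show ?thesis unfolding g_def by measurable
    qed
    have mr: "g0 \<in> borel_measurable ?N"
    proof -
      have [measurable]: "(\<lambda>z. W (snd z) i) \<in> borel_measurable (?N \<Otimes>\<^sub>M R)"
        "(\<lambda>z. fst z i) \<in> borel_measurable (?N \<Otimes>\<^sub>M R)" if "i < m" for i
        using measurable_compose[OF measurable_snd W[OF that]] measurable_compose[OF measurable_fst comp[OF that]]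
        by auto
      have "(\<lambda>(G, \<omega>). iexp (\<Sum>j<m. (- G j / s) * W \<omega> j)) \<in> borel_measurable (?N \<Otimes>\<^sub>M R)"
        unfolding split_beta' by measurable
      then have [measurable]: "(\<lambda>G. CLINT \<omega>|R. iexp (\<Sum>j<m. (- G j / s) * W \<omega> j)) \<in> borel_measurable ?N"
        by (rule R.borel_measurable_lebesgue_integral)
      show ?thesis unfolding g0_def by measurable
    qed
    have "(\<lambda>n. CLINT G|?N. g n G) \<longlonglongrightarrow> (CLINT G|?N. g0 G)"
    proof (rule integral_dominated_convergence[where w="\<lambda>_. 1"])
      show "AE G in ?N. (\<lambda>n. g n G) \<longlonglongrightarrow> g0 G"
        unfolding g_def g0_def by (intro AE_I2 tendsto_mult tendsto_const conv)
      have "norm (CLINT \<omega>|Q. iexp (\<Sum>j<m. (- G j / s) * V n \<omega> j)) \<le> 1" for n G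
      proof -
        have "norm (CLINT \<omega>|Q. iexp (\<Sum>j<m. (- G j / s) * V n \<omega> j))
            \<le> (\<integral>\<omega>. norm (iexp (\<Sum>j<m. (- G j / s) * V n \<omega> j)) \<partial>Q)"
          by (rule integral_norm_bound)
        also have "\<dots> = 1" by (simp only: norm_exp_i_times) (simp add: Q.prob_space)
        finally show ?thesis .
      qed
      then show "AE G in ?N. norm (g n G) \<le> 1" for n
        unfolding g_def by (intro AE_I2) (simp only: norm_mult norm_exp_i_times mult_1_left)
    qed (use mq mr in auto)
    then have "(\<lambda>n. complex_of_real (Q.dens n y)) \<longlonglongrightarrow> complex_of_real (R.dens y)"
      unfolding Q.dens_char R.dens_char g_def g0_def by (rule tendsto_mult_left)
    then show ?thesis by (simp add: tendsto_of_real_iff)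
  qed
  \<comment> \<open>Equal total masses together with pointwise convergence are what Scheffe's lemma
    asks for; no mass can escape, so tightness needs no separate argument.\<close>
  have nn: "(\<integral>\<^sup>+y. norm (Q.dens n y) \<partial>sm.Leb) = 1" "(\<integral>\<^sup>+y. norm (R.dens y) \<partial>sm.Leb) = 1" for n
    using nn_integral_eq_integral[OF Q.integrable_dens] nn_integral_eq_integral[OF R.integrable_dens]
    by (auto simp: Q.integral_dens R.integral_dens)
  have "(\<lambda>n. \<integral>\<^sup>+y. norm (Q.dens n y - R.dens y) \<partial>sm.Leb) \<longlonglongrightarrow> 0"
    by (rule Scheffe_lemma2) (use nn pw Q.integrable_dens R.integrable_dens in auto)
  then have "(\<lambda>n. ennreal (\<integral>y. norm (Q.dens n y - R.dens y) \<partial>sm.Leb)) \<longlonglongrightarrow> ennreal 0"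
    using Q.integrable_dens R.integrable_dens by (subst (asm) nn_integral_eq_integral) auto
  then have L1: "(\<lambda>n. \<integral>y. norm (Q.dens n y - R.dens y) \<partial>sm.Leb) \<longlonglongrightarrow> 0"
    by (subst (asm) tendsto_ennreal_iff) (auto intro!: Bochner_Integration.integral_nonneg)
  have B: "0 \<le> B" using bd[of undefined] by linarith
  have f [measurable]: "f \<in> borel_measurable sm.Leb"
    by (rule borel_measurable_Lipschitz_coordinates[OF lip]) simp
  have fi: "integrable sm.Leb (\<lambda>y. f y * g y)" if g: "integrable sm.Leb g" for g
  proof (rule Bochner_Integration.integrable_bound)
    show "integrable sm.Leb (\<lambda>y. B * g y)" using g by simp
    show "AE y in sm.Leb. norm (f y * g y) \<le> norm (B * g y)"
      by (intro AE_I2) (auto simp: abs_mult intro!: mult_right_mono order_trans[OF bd abs_ge_self])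
  qed (use g in simp)
  have "(\<lambda>n. B * (\<integral>y. norm (Q.dens n y - R.dens y) \<partial>sm.Leb)) \<longlonglongrightarrow> B * 0"
    by (intro tendsto_intros L1)
  from LIMSEQ_D[OF this, of "e / 3"] obtain n0
    where n0: "\<And>n. n \<ge> n0 \<Longrightarrow> \<bar>B * (\<integral>y. norm (Q.dens n y - R.dens y) \<partial>sm.Leb)\<bar> < e / 3"
    using e by auto
  show "\<exists>no. \<forall>n\<ge>no. norm ((\<integral>\<omega>. f (V n \<omega>) \<partial>Q) - (\<integral>\<omega>. f (W \<omega>) \<partial>R)) < e"
  proof (intro exI allI impI)
    fix n assume n: "n \<ge> n0"
    have "(\<integral>y. f y * Q.dens n y \<partial>sm.Leb) - (\<integral>y. f y * R.dens y \<partial>sm.Leb)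
        = (\<integral>y. f y * (Q.dens n y - R.dens y) \<partial>sm.Leb)"
      using fi[OF Q.integrable_dens] fi[OF R.integrable_dens] by (simp add: right_diff_distrib)
    also have "\<bar>\<dots>\<bar> \<le> (\<integral>y. norm (f y * (Q.dens n y - R.dens y)) \<partial>sm.Leb)"
      using integral_norm_bound[of sm.Leb "\<lambda>y. f y * (Q.dens n y - R.dens y)"] by simp
    also have "\<dots> \<le> (\<integral>y. B * norm (Q.dens n y - R.dens y) \<partial>sm.Leb)"
      using Q.integrable_dens R.integrable_dens bd
      by (intro integral_mono integrable_norm fi) (auto simp: abs_mult intro!: mult_right_mono)
    also have "\<dots> = B * (\<integral>y. norm (Q.dens n y - R.dens y) \<partial>sm.Leb)" by simp
    also have "\<dots> < e / 3" using n0[OF n] by linarith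
    finally have 1: "\<bar>(\<integral>y. f y * Q.dens n y \<partial>sm.Leb) - (\<integral>y. f y * R.dens y \<partial>sm.Leb)\<bar> < e / 3" .
    have 2: "\<bar>(\<integral>\<omega>. f (V n \<omega>) \<partial>Q) - (\<integral>y. f y * Q.dens n y \<partial>sm.Leb)\<bar> \<le> e / 3"
      using Q.expectation_smoothed[OF bd lip, of n] sC by linarith
    have 3: "\<bar>(\<integral>\<omega>. f (W \<omega>) \<partial>R) - (\<integral>y. f y * R.dens y \<partial>sm.Leb)\<bar> \<le> e / 3"
      using R.expectation_smoothed[OF bd lip] sC by linarith
    show "norm ((\<integral>\<omega>. f (V n \<omega>) \<partial>Q) - (\<integral>\<omega>. f (W \<omega>) \<partial>R)) < e"
      using 1 2 3 unfolding real_norm_def by linarith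
  qed
qed

subsection \<open>Characteristic functions of normed sums and of Gaussian variables\<close>

context prob_space
begin

text \<open>Serves to shift the copies, numbered from 1, to a sequence numbered from 0.\<close>

lemma indep_sets_reindex:
  assumes indep: "indep_sets F I" and g: "inj_on g J" "g ` J \<subseteq> I"
  shows "indep_sets (\<lambda>j. F (g j)) J"
proof (rule indep_setsI)
  show "F (g i) \<subseteq> events" if "i \<in> J" for i
    using indep g that by (auto simp: indep_sets_def)
  fix A K assume K: "K \<noteq> {}" "K \<subseteq> J" "finite K" and A: "\<forall>j\<in>K. A j \<in> F (g j)"
  have inj: "inj_on g K" using g K by (blast intro: inj_on_subset)
  define A' where "A' = A \<circ> the_inv_into K g"
  have A': "A' (g j) = A j" if "j \<in> K" for j
    using that inj by (simp add: A'_def the_inv_into_f_f)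
  have "prob (\<Inter>i\<in>g ` K. A' i) = (\<Prod>i\<in>g ` K. prob (A' i))"
  proof (rule indep_setsD[OF indep])
    show "g ` K \<subseteq> I" using K(2) g(2) by blast
  qed (use K A A' in auto)
  then show "prob (\<Inter>j\<in>K. A j) = (\<Prod>j\<in>K. prob (A j))"
    using A' by (simp add: prod.reindex[OF inj])
qed

lemma indep_vars_reindex:
  assumes "indep_vars M' X I" "inj_on g J" "g ` J \<subseteq> I"
  shows "indep_vars (\<lambda>j. M' (g j)) (\<lambda>j. X (g j)) J"
  using assms indep_sets_reindex[of _ I g J] unfolding indep_vars_def2 by fast

text \<open>The sums normed by \<open>sqrt (n * v)\<close> converge to the standard normal law;
  evaluating their characteristic functions at \<open>sqrt v\<close> undoes the division by the
  deviation. For \<open>v = 0\<close> this division is impossible, but then all variables vanish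
  almost surely.\<close>

lemma char_CLT:
  fixes X :: "nat \<Rightarrow> 'a \<Rightarrow> real"
  assumes indep: "indep_vars (\<lambda>_. borel) X {1..}"
    and sq: "\<And>i. 1 \<le> i \<Longrightarrow> integrable M (\<lambda>\<omega>. (X i \<omega>)\<^sup>2)"
    and mean: "\<And>i. 1 \<le> i \<Longrightarrow> expectation (X i) = 0"
    and law: "\<And>i. 1 \<le> i \<Longrightarrow> distr M borel (X i) = D"
    and v: "expectation (\<lambda>\<omega>. (X 1 \<omega>)\<^sup>2) = v"
  shows "(\<lambda>n. CLINT \<omega>|M. iexp ((\<Sum>i=1..n. X i \<omega>) / sqrt n)) \<longlonglongrightarrow> complex_of_real (exp (- v / 2))"
proof -
  have X [measurable]: "X i \<in> borel_measurable M" if "1 \<le> i" for i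
    using indep that unfolding indep_vars_def by auto
  have law_sq: "expectation (\<lambda>\<omega>. (X i \<omega>)\<^sup>2) = v" if "1 \<le> i" for i
  proof -
    have "expectation (\<lambda>\<omega>. (X i \<omega>)\<^sup>2) = (\<integral>x. x\<^sup>2 \<partial>distr M borel (X i))"
      using that by (subst integral_distr) auto
    also have "\<dots> = (\<integral>x. x\<^sup>2 \<partial>distr M borel (X 1))"
      using law that by simp
    also have "\<dots> = v"
      using v by (subst integral_distr) auto
    finally show ?thesis .
  qed
  have v0: "0 \<le> v" unfolding v[symmetric] by (intro Bochner_Integration.integral_nonneg) simp
  show ?thesis
  proof (cases "v = 0")
    case True
    have "AE \<omega> in M. X i \<omega> = 0" if "1 \<le> i" for i
    proof -
      have "AE \<omega> in M. (X i \<omega>)\<^sup>2 = 0"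
        using integral_nonneg_eq_0_iff_AE[OF sq[OF that]] law_sq[OF that] True by auto
      then show ?thesis by simp
    qed
    then have "AE \<omega> in M. \<forall>i\<in>{1..}. X i \<omega> = 0"
      by (subst AE_ball_countable) auto
    then have "AE \<omega> in M. \<forall>n. (\<Sum>i=1..n. X i \<omega>) = 0"
      by (rule AE_mp) (auto intro!: sum.neutral)
    then have "AE \<omega> in M. iexp ((\<Sum>i=1..n. X i \<omega>) / sqrt n) = 1" for n
      by (rule AE_mp) (auto intro!: AE_I2)
    then have "(CLINT \<omega>|M. iexp ((\<Sum>i=1..n. X i \<omega>) / sqrt n)) = (CLINT \<omega>|M. 1)" for n
      by (intro integral_cong_AE) (auto intro!: borel_measurable_sum)
    then show ?thesis using True by (simp add: prob_space)
  next
    case False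
    define \<sigma> where "\<sigma> = sqrt v"
    have \<sigma>: "\<sigma> > 0" "\<sigma>\<^sup>2 = v" using v0 False by (auto simp: \<sigma>_def)
    define Y where "Y i = X (Suc i)" for i
    have "indep_vars (\<lambda>_. borel) Y UNIV"
      unfolding Y_def[abs_def]
      by (rule indep_vars_reindex[OF indep]) auto
    then have w: "weak_conv_m (\<lambda>n. distr M borel (\<lambda>x. (\<Sum>i<n. Y i x) / sqrt (n * \<sigma>\<^sup>2))) std_normal_distribution"
      using \<sigma> sq mean law law_sq
      by (intro central_limit_theorem_zero_mean[of Y \<sigma> D]) (auto simp: Y_def)
    have my: "(\<lambda>x. (\<Sum>i<n. Y i x) / sqrt (n * \<sigma>\<^sup>2)) \<in> borel_measurable M" for n
      unfolding Y_def by (intro borel_measurable_divide borel_measurable_sum) auto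
    have "(\<lambda>n. char (distr M borel (\<lambda>x. (\<Sum>i<n. Y i x) / sqrt (n * \<sigma>\<^sup>2))) \<sigma>)
      \<longlonglongrightarrow> char std_normal_distribution \<sigma>"
      by (intro levy_continuity1[OF _ real_dist_normal_dist w] real_distribution_distr my)
    moreover have "char (distr M borel (\<lambda>x. (\<Sum>i<n. Y i x) / sqrt (n * \<sigma>\<^sup>2))) \<sigma>
      = (CLINT \<omega>|M. iexp ((\<Sum>i=1..n. X i \<omega>) / sqrt n))" for n
    proof -
      have "(\<Sum>i<n. Y i x) = (\<Sum>i=1..n. X i x)" for x
        unfolding Y_def by (rule sum.reindex_bij_witness[of _ "\<lambda>i. i - 1" Suc]) auto
      then have "\<sigma> * ((\<Sum>i<n. Y i x) / sqrt (n * \<sigma>\<^sup>2)) = (\<Sum>i=1..n. X i x) / sqrt n" for x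
        using \<sigma>(1) by (simp add: real_sqrt_mult)
      then show ?thesis
        unfolding char_def using my[of n] by (subst integral_distr) (auto simp del: of_real_mult of_real_divide)
    qed
    ultimately show ?thesis
      using \<sigma>(2) by (simp only: char_std_normal_distribution)
  qed
qed

section \<open>Characteristic function and absolute moments of centered Gaussian variables\<close>

lemma centered_gaussian_cases:
  assumes "centered_gaussian M U"
  obtains (degenerate) "AE \<omega> in M. U \<omega> = 0" "expectation (\<lambda>\<omega>. (U \<omega>)\<^sup>2) = 0"
      "integrable M (\<lambda>\<omega>. (U \<omega>)\<^sup>2)"
  | (normal) \<sigma> where "0 < \<sigma>" "distributed M lborel U (\<lambda>x. ennreal (normal_density 0 \<sigma> x))"
      "expectation (\<lambda>\<omega>. (U \<omega>)\<^sup>2) = \<sigma>\<^sup>2" "integrable M (\<lambda>\<omega>. (U \<omega>)\<^sup>2)"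
proof -
  have U [measurable]: "U \<in> borel_measurable M" using assms by (simp add: centered_gaussian_def)
  consider "AE \<omega> in M. U \<omega> = 0" | \<sigma> where "\<sigma> > 0" "distributed M lborel U (\<lambda>x. ennreal (normal_density 0 \<sigma> x))"
    using assms by (auto simp: centered_gaussian_def)
  then show ?thesis
  proof cases
    case 1
    then have z: "AE \<omega> in M. (U \<omega>)\<^sup>2 = 0" by auto
    have "expectation (\<lambda>\<omega>. (U \<omega>)\<^sup>2) = (\<integral>\<omega>. 0 \<partial>M)"
      using z by (intro integral_cong_AE) auto
    moreover have "integrable M (\<lambda>\<omega>. (U \<omega>)\<^sup>2)"
      by (rule integrable_cong_AE_imp[of _ "\<lambda>_. 0"]) (use z in auto)
    ultimately show ?thesis using 1 degenerate by auto
  next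
    case 2
    have h: "has_bochner_integral lborel (\<lambda>x. normal_density 0 \<sigma> x * x\<^sup>2) (\<sigma>\<^sup>2)"
      using normal_moment_even[of \<sigma> 0 1] 2(1) by (simp add: fact_numeral)
    have "integrable M (\<lambda>\<omega>. (U \<omega>)\<^sup>2)"
      using h 2 by (subst distributed_integrable[OF 2(2), symmetric]) (auto simp: has_bochner_integral_iff)
    moreover have "expectation (\<lambda>\<omega>. (U \<omega>)\<^sup>2) = \<sigma>\<^sup>2"
      using h 2 by (subst distributed_integral[OF 2(2), symmetric]) (auto simp: has_bochner_integral_iff)
    ultimately show ?thesis using normal 2 by blast
  qed
qed

lemma integrable_square_centered_gaussian:
  "centered_gaussian M U \<Longrightarrow> integrable M (\<lambda>\<omega>. (U \<omega>)\<^sup>2)"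
  by (erule centered_gaussian_cases)

lemma char_centered_gaussian:
  assumes "centered_gaussian M U"
  shows "(CLINT \<omega>|M. iexp (U \<omega>)) = complex_of_real (exp (- expectation (\<lambda>\<omega>. (U \<omega>)\<^sup>2) / 2))"
  using assms
proof (cases rule: centered_gaussian_cases)
  case degenerate
  have [measurable]: "U \<in> borel_measurable M" using assms by (simp add: centered_gaussian_def)
  have "(CLINT \<omega>|M. iexp (U \<omega>)) = (CLINT \<omega>|M. 1)"
    using degenerate(1) by (intro integral_cong_AE) auto
  then show ?thesis using degenerate by (simp add: prob_space)
next
  case (normal \<sigma>)
  have [measurable]: "U \<in> borel_measurable M" using assms by (simp add: centered_gaussian_def)
  have d: "distributed M lborel (\<lambda>x. (U x - 0) / \<sigma>) (\<lambda>x. ennreal (std_normal_density x))"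
    using normal_standard_normal_convert[OF normal(1), of U 0] normal(2) by simp
  have "distr M borel (\<lambda>x. U x / \<sigma>) = distr M lborel (\<lambda>x. U x / \<sigma>)"
    by (rule distr_cong) auto
  also have "\<dots> = std_normal_distribution"
    using distributed_distr_eq_density[OF d] by simp
  finally have eq: "distr M borel (\<lambda>x. U x / \<sigma>) = std_normal_distribution" .
  have "(CLINT \<omega>|M. iexp (U \<omega>)) = (CLINT \<omega>|M. iexp (\<sigma> * (U \<omega> / \<sigma>)))"
    using normal(1) by simp
  also have "\<dots> = char (distr M borel (\<lambda>x. U x / \<sigma>)) \<sigma>"
    unfolding char_def by (subst integral_distr) auto
  also have "\<dots> = complex_of_real (exp (- \<sigma>\<^sup>2 / 2))"
    unfolding eq by (simp only: char_std_normal_distribution)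
  finally show ?thesis using normal by simp
qed

text \<open>Half of the Gaussian exponent absorbs the power: \<open>u \<le> exp u\<close> for
  \<open>u = x\<^sup>2 / (2 * p * \<sigma>\<^sup>2)\<close>, raised to the power
  \<open>p / 2\<close>, bounds \<open>\<bar>x\<bar> powr p\<close> times the density by a multiple
  of the density with doubled variance, whose integral is 1. Gamma function values are
  avoided.\<close>

lemma moment_centered_gaussian:
  assumes U: "centered_gaussian M U" and p: "2 < p"
    and K: "expectation (\<lambda>\<omega>. (U \<omega>)\<^sup>2) \<le> K\<^sup>2" "0 \<le> K"
  shows "(\<integral>\<^sup>+\<omega>. ennreal (\<bar>U \<omega>\<bar> powr p) \<partial>M) \<le> ennreal ((2 * sqrt p * K) powr p)"
  using U
proof (cases rule: centered_gaussian_cases)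
  case degenerate
  have [measurable]: "U \<in> borel_measurable M" using assms by (simp add: centered_gaussian_def)
  have "(\<integral>\<^sup>+\<omega>. ennreal (\<bar>U \<omega>\<bar> powr p) \<partial>M) = (\<integral>\<^sup>+\<omega>. 0 \<partial>M)"
    using degenerate(1) by (intro nn_integral_cong_AE) (auto elim!: AE_mp)
  then show ?thesis by simp
next
  case (normal \<sigma>)
  have \<sigma>K: "\<sigma> \<le> K" using normal K by (auto intro: power2_le_imp_le)
  define C where "C = (2 * p * \<sigma>\<^sup>2) powr (p / 2)"
  have pw: "normal_density 0 \<sigma> x * \<bar>x\<bar> powr p \<le> (C * sqrt 2) * normal_density 0 (sqrt 2 * \<sigma>) x" for x
  proof -
    define u where "u = x\<^sup>2 / (2 * p * \<sigma>\<^sup>2)"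
    have pos: "2 * p * \<sigma>\<^sup>2 > 0" using p normal(1) by simp
    have u: "u \<ge> 0" using pos unfolding u_def by (intro divide_nonneg_pos) auto
    have "\<bar>x\<bar> powr p = (x\<^sup>2) powr (p / 2)"
    proof (cases "x = 0")
      case False
      then have "x\<^sup>2 = \<bar>x\<bar> powr 2" by simp
      then show ?thesis by (simp only: powr_powr) simp
    qed (use p in simp)
    also have "x\<^sup>2 = (2 * p * \<sigma>\<^sup>2) * u" using p normal(1) by (simp add: u_def)
    also have "((2 * p * \<sigma>\<^sup>2) * u) powr (p / 2) = C * u powr (p / 2)"
      using pos u by (simp add: C_def powr_mult)
    also have "u powr (p / 2) \<le> exp u powr (p / 2)"
    proof -
      have "u \<le> exp u" using exp_ge_add_one_self[of u] by linarith
      then show ?thesis using u p by (intro powr_mono2) auto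
    qed
    then have "C * u powr (p / 2) \<le> C * exp u powr (p / 2)"
      by (intro mult_left_mono) (auto simp: C_def)
    also have "exp u powr (p / 2) = exp (x\<^sup>2 / (4 * \<sigma>\<^sup>2))"
      using p by (simp add: powr_def u_def)
    finally have "normal_density 0 \<sigma> x * \<bar>x\<bar> powr p \<le> normal_density 0 \<sigma> x * (C * exp (x\<^sup>2 / (4 * \<sigma>\<^sup>2)))"
      by (intro mult_left_mono) auto
    also have "\<dots> = C * (sqrt 2 * normal_density 0 (sqrt 2 * \<sigma>) x)"
    proof -
      let ?q1 = "sqrt (2 * pi * \<sigma>\<^sup>2)" and ?q2 = "sqrt (2 * pi * (sqrt 2 * \<sigma>)\<^sup>2)"
      have e: "exp (- x\<^sup>2 / (2 * \<sigma>\<^sup>2)) * exp (x\<^sup>2 / (4 * \<sigma>\<^sup>2)) = exp (- x\<^sup>2 / (4 * \<sigma>\<^sup>2))"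
        unfolding exp_add[symmetric] by (rule arg_cong[of _ _ exp]) (use normal(1) in \<open>simp add: field_simps\<close>)
      have "2 * pi * (sqrt 2 * \<sigma>)\<^sup>2 = 2 * (2 * pi * \<sigma>\<^sup>2)"
        by (simp add: power_mult_distrib)
      then have "?q2 = sqrt 2 * ?q1"
        by (simp only: real_sqrt_mult[of 2 "2 * pi * \<sigma>\<^sup>2"])
      then have q: "sqrt 2 / ?q2 = 1 / ?q1"
        by (simp del: real_sqrt_mult)
      have "normal_density 0 \<sigma> x * (C * exp (x\<^sup>2 / (4 * \<sigma>\<^sup>2)))
          = C * (1 / ?q1) * (exp (- x\<^sup>2 / (2 * \<sigma>\<^sup>2)) * exp (x\<^sup>2 / (4 * \<sigma>\<^sup>2)))"
        by (simp add: normal_density_def)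
      also have "\<dots> = C * (sqrt 2 / ?q2) * exp (- x\<^sup>2 / (4 * \<sigma>\<^sup>2))"
        by (simp only: e q)
      also have "\<dots> = C * (sqrt 2 * normal_density 0 (sqrt 2 * \<sigma>) x)"
        by (simp add: normal_density_def power_mult_distrib)
      finally show ?thesis .
    qed
    finally show ?thesis by (simp add: mult.assoc)
  qed
  have "(\<integral>\<^sup>+\<omega>. ennreal (\<bar>U \<omega>\<bar> powr p) \<partial>M)
      = (\<integral>\<^sup>+x. ennreal (normal_density 0 \<sigma> x) * ennreal (\<bar>x\<bar> powr p) \<partial>lborel)"
    by (rule distributed_nn_integral[OF normal(2), symmetric]) measurable
  also have "\<dots> \<le> (\<integral>\<^sup>+x. ennreal (C * sqrt 2) * ennreal (normal_density 0 (sqrt 2 * \<sigma>) x) \<partial>lborel)"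
    using pw by (intro nn_integral_mono) (simp add: ennreal_mult[symmetric] C_def)
  also have "\<dots> = ennreal (C * sqrt 2)"
    using normal(1) by (subst nn_integral_cmult)
      (auto simp: nn_integral_eq_integral integral_normal_density)
  also have "\<dots> \<le> ennreal ((2 * sqrt p * K) powr p)"
  proof (rule ennreal_leI)
    \<comment> \<open>The factor \<open>sqrt 2\<close> from doubling the variance is absorbed as
      \<open>2 powr (p / 2)\<close>, which turns \<open>2 * p\<close> into \<open>4 * p\<close> and
      yields the constant \<open>2 * sqrt p\<close>.\<close>
    have "sqrt 2 = 2 powr (1 / 2)" by (simp add: powr_half_sqrt)
    also have "\<dots> \<le> 2 powr (p / 2)" using p by (intro powr_mono) auto
    finally have "C * sqrt 2 \<le> C * 2 powr (p / 2)" by (intro mult_left_mono) (auto simp: C_def)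
    also have "\<dots> = (4 * p * \<sigma>\<^sup>2) powr (p / 2)"
      using p by (simp add: C_def powr_mult[symmetric] mult.assoc)
    also have "4 * p * \<sigma>\<^sup>2 = (2 * sqrt p * \<sigma>) powr 2"
      using p normal(1) by (simp add: power_mult_distrib)
    also have "((2 * sqrt p * \<sigma>) powr 2) powr (p / 2) = (2 * sqrt p * \<sigma>) powr p"
      using p by (simp add: powr_powr)
    also have "\<dots> \<le> (2 * sqrt p * K) powr p"
      using p normal(1) \<sigma>K by (intro powr_mono2 mult_left_mono) auto
    finally show "C * sqrt 2 \<le> (2 * sqrt p * K) powr p" .
  qed
  finally show ?thesis .
qed

end

subsection \<open>Function norms and countable norming sets\<close>

lemma measurable_field_section:
  assumes "measurable_field \<mu> P X"
  shows "\<omega> \<in> space P \<Longrightarrow> (\<lambda>t. X t \<omega>) \<in> borel_measurable \<mu>"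
    and "t \<in> space \<mu> \<Longrightarrow> X t \<in> borel_measurable P"
  using measurable_compose[OF measurable_Pair1' assms[unfolded measurable_field_def]]
    measurable_compose[OF measurable_Pair2' assms[unfolded measurable_field_def]] by simp_all

section \<open>Real functions of finite norm as a seminormed space\<close>

context banach_function_norm
begin

lemma fs_norm_mono:
  assumes [measurable]: "f \<in> borel_measurable \<mu>" "h \<in> borel_measurable \<mu>"
    and le: "AE t in \<mu>. \<bar>f t\<bar> \<le> \<bar>h t\<bar>"
  shows "fs_norm N f \<le> fs_norm N h"
  unfolding fs_norm_def using le by (intro norm_mono) (auto elim!: AE_mp intro!: AE_I2 ennreal_leI)

lemma fs_norm_cong_AE:
  assumes "f \<in> borel_measurable \<mu>" "h \<in> borel_measurable \<mu>" and eq: "AE t in \<mu>. f t = h t"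
  shows "fs_norm N f = fs_norm N h"
  using assms by (intro antisym fs_norm_mono) auto

lemma fs_norm_zero [simp]: "fs_norm N (\<lambda>_. 0) = 0"
  unfolding fs_norm_def by (subst norm_zero_iff) auto

lemma fs_norm_triangle:
  assumes [measurable]: "f \<in> borel_measurable \<mu>" "h \<in> borel_measurable \<mu>"
  shows "fs_norm N (\<lambda>t. f t + h t) \<le> fs_norm N f + fs_norm N h"
proof -
  have "fs_norm N (\<lambda>t. f t + h t) \<le> N (\<lambda>t. ennreal \<bar>f t\<bar> + ennreal \<bar>h t\<bar>)"
    unfolding fs_norm_def
    by (intro norm_mono) (auto simp: ennreal_plus[symmetric] simp del: ennreal_plus intro!: AE_I2 ennreal_leI)
  also have "\<dots> \<le> fs_norm N f + fs_norm N h"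
    unfolding fs_norm_def by (intro norm_triangle) auto
  finally show ?thesis .
qed

lemma fs_norm_scale:
  assumes [measurable]: "f \<in> borel_measurable \<mu>"
  shows "fs_norm N (\<lambda>t. c * f t) = ennreal \<bar>c\<bar> * fs_norm N f"
  unfolding fs_norm_def by (simp add: abs_mult ennreal_mult norm_scale)

lemma fs_norm_minus: "fs_norm N (\<lambda>t. f t - h t) = fs_norm N (\<lambda>t. h t - f t)"
  by (simp add: fs_norm_def abs_minus_commute)

lemma fspace_measurable [measurable_dest]: "f \<in> fspace \<mu> N \<Longrightarrow> f \<in> borel_measurable \<mu>"
  by (simp add: fspace_def)

lemma fspace_zero [simp]: "(\<lambda>_. 0) \<in> fspace \<mu> N"
  by (simp add: fspace_def)

lemma fspace_add: "f \<in> fspace \<mu> N \<Longrightarrow> h \<in> fspace \<mu> N \<Longrightarrow> (\<lambda>t. f t + h t) \<in> fspace \<mu> N"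
  using fs_norm_triangle[of f h] by (auto simp: fspace_def intro: le_less_trans)

lemma fspace_scale: "f \<in> fspace \<mu> N \<Longrightarrow> (\<lambda>t. c * f t) \<in> fspace \<mu> N"
  using fs_norm_scale[of f c] by (auto simp: fspace_def ennreal_mult_less_top)

lemma fspace_diff: "f \<in> fspace \<mu> N \<Longrightarrow> h \<in> fspace \<mu> N \<Longrightarrow> (\<lambda>t. f t - h t) \<in> fspace \<mu> N"
  using fspace_add[OF _ fspace_scale[of h "-1"], of f] by simp

lemma fspace_sum:
  "finite I \<Longrightarrow> (\<And>i. i \<in> I \<Longrightarrow> f i \<in> fspace \<mu> N) \<Longrightarrow> (\<lambda>t. \<Sum>i\<in>I. f i t) \<in> fspace \<mu> N"
  by (induction I rule: finite_induct) (auto intro: fspace_add)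

lemma fspace_indicator:
  assumes "E \<in> sets \<mu>" "emeasure \<mu> E < \<infinity>"
  shows "indicator E \<in> fspace \<mu> N"
proof -
  have "(\<lambda>t. ennreal \<bar>indicator E t\<bar>) = indicator E" by (auto split: split_indicator)
  then show ?thesis using assms norm_indicator[of E] by (simp add: fspace_def fs_norm_def)
qed

lemma fspace_solid:
  assumes "h \<in> fspace \<mu> N" "f \<in> borel_measurable \<mu>" "AE t in \<mu>. \<bar>f t\<bar> \<le> \<bar>h t\<bar>"
  shows "f \<in> fspace \<mu> N"
  using fs_norm_mono[of f h] assms by (auto simp: fspace_def intro: le_less_trans)

text \<open>A real version of the norm for use in estimates. Since \<open>enn2real\<close> sends
  infinity to 0, it is meaningful on \<open>fspace \<mu> N\<close> only.\<close>

definition nrm :: "('t \<Rightarrow> real) \<Rightarrow> real" where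
  "nrm f = enn2real (fs_norm N f)"

lemma ennreal_nrm: "f \<in> fspace \<mu> N \<Longrightarrow> ennreal (nrm f) = fs_norm N f"
  by (simp add: nrm_def fspace_def)

lemma nrm_nonneg [simp]: "0 \<le> nrm f"
  by (simp add: nrm_def)

lemma nrm_less_iff: "f \<in> fspace \<mu> N \<Longrightarrow> fs_norm N f < ennreal e \<longleftrightarrow> nrm f < e"
  using ennreal_nrm[of f] by (metis ennreal_less_iff nrm_nonneg)

lemma nrm_minus: "nrm (\<lambda>t. f t - h t) = nrm (\<lambda>t. h t - f t)"
  unfolding nrm_def by (subst fs_norm_minus) (rule refl)

lemma nrm_triangle:
  assumes "f \<in> fspace \<mu> N" "h \<in> fspace \<mu> N"
  shows "nrm (\<lambda>t. f t + h t) \<le> nrm f + nrm h"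
proof -
  have "ennreal (nrm (\<lambda>t. f t + h t)) \<le> ennreal (nrm f + nrm h)"
    using fs_norm_triangle[of f h] fspace_add[OF assms] assms
    by (simp add: ennreal_nrm fspace_measurable)
  then show ?thesis by (subst (asm) ennreal_le_iff) auto
qed

lemma nrm_triangle_diff:
  assumes "f \<in> fspace \<mu> N" "h \<in> fspace \<mu> N" "k \<in> fspace \<mu> N"
  shows "nrm (\<lambda>t. f t - k t) \<le> nrm (\<lambda>t. f t - h t) + nrm (\<lambda>t. h t - k t)"
  using nrm_triangle[OF fspace_diff[OF assms(1,2)] fspace_diff[OF assms(2,3)]] by simp

lemma nrm_sum_le:
  assumes "finite I" "\<And>i. i \<in> I \<Longrightarrow> f i \<in> fspace \<mu> N"
  shows "nrm (\<lambda>t. \<Sum>i\<in>I. f i t) \<le> (\<Sum>i\<in>I. nrm (f i))"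
  using assms
proof (induction I rule: finite_induct)
  case empty
  then show ?case by (simp add: nrm_def)
next
  case (insert i I)
  have "nrm (\<lambda>t. f i t + (\<Sum>i\<in>I. f i t)) \<le> nrm (f i) + nrm (\<lambda>t. \<Sum>i\<in>I. f i t)"
    using insert by (intro nrm_triangle fspace_sum) auto
  then show ?case using insert by fastforce
qed

lemma nrm_scale: "f \<in> fspace \<mu> N \<Longrightarrow> nrm (\<lambda>t. c * f t) = \<bar>c\<bar> * nrm f"
  by (simp add: nrm_def fs_norm_scale fspace_measurable enn2real_mult)

lemma nrm_cong_AE:
  "f \<in> borel_measurable \<mu> \<Longrightarrow> h \<in> borel_measurable \<mu> \<Longrightarrow> AE t in \<mu>. f t = h t \<Longrightarrow> nrm f = nrm h"
  unfolding nrm_def by (rule arg_cong[OF fs_norm_cong_AE])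

section \<open>Truncation of measurable functions\<close>

definition trunc_dom :: "nat \<Rightarrow> 't set" where
  "trunc_dom = (SOME A. range A \<subseteq> sets \<mu> \<and> (\<Union>i. A i) = space \<mu> \<and> (\<forall>i. emeasure \<mu> (A i) \<noteq> \<infinity>) \<and> incseq A)"

lemma trunc_dom:
  "trunc_dom i \<in> sets \<mu>" "(\<Union>i. trunc_dom i) = space \<mu>" "emeasure \<mu> (trunc_dom i) < \<infinity>" "incseq trunc_dom"
proof -
  have "\<exists>A::nat \<Rightarrow> 't set. range A \<subseteq> sets \<mu> \<and> (\<Union>i. A i) = space \<mu> \<and> (\<forall>i. emeasure \<mu> (A i) \<noteq> \<infinity>) \<and> incseq A"
    using sigma_finite_incseq by metis
  from someI_ex[OF this, folded trunc_dom_def]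
  show "trunc_dom i \<in> sets \<mu>" "(\<Union>i. trunc_dom i) = space \<mu>" "emeasure \<mu> (trunc_dom i) < \<infinity>" "incseq trunc_dom"
    by (auto simp: less_top)
qed

text \<open>A bounded function supported on a set of finite measure always lies in the space. By the
  Fatou property the norm of any measurable function, finite or not, is the limit along these
  truncations, so norms of paths can be handled before they are known to be finite.\<close>

definition trunc :: "nat \<Rightarrow> ('t \<Rightarrow> real) \<Rightarrow> 't \<Rightarrow> real" where
  "trunc k f t = min \<bar>f t\<bar> (real k) * indicator (trunc_dom k) t"

lemma trunc_bounds: "0 \<le> trunc k f t" "trunc k f t \<le> \<bar>f t\<bar>"
  by (auto simp: trunc_def split: split_indicator)

lemma measurable_trunc [measurable]:
  assumes [measurable]: "f \<in> borel_measurable \<mu>"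
  shows "trunc k f \<in> borel_measurable \<mu>"
proof -
  have [measurable]: "trunc_dom k \<in> sets \<mu>" by (rule trunc_dom)
  show ?thesis unfolding trunc_def by measurable
qed

lemma trunc_fspace:
  assumes "f \<in> borel_measurable \<mu>"
  shows "trunc k f \<in> fspace \<mu> N"
proof (rule fspace_solid)
  show "(\<lambda>t. real k * indicator (trunc_dom k) t) \<in> fspace \<mu> N"
    using trunc_dom by (intro fspace_scale fspace_indicator) auto
  show "AE t in \<mu>. \<bar>trunc k f t\<bar> \<le> \<bar>real k * indicator (trunc_dom k) t\<bar>"
    by (auto simp: trunc_def split: split_indicator)
qed (use assms in measurable)

lemma fs_norm_trunc_tendsto:
  assumes [measurable]: "f \<in> borel_measurable \<mu>"
  shows "(\<lambda>k. fs_norm N (trunc k f)) \<longlonglongrightarrow> fs_norm N f"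
  unfolding fs_norm_def
proof (rule norm_Fatou)
  show "AE t in \<mu>. incseq (\<lambda>k. ennreal \<bar>trunc k f t\<bar>) \<and> (\<lambda>k. ennreal \<bar>trunc k f t\<bar>) \<longlonglongrightarrow> ennreal \<bar>f t\<bar>"
  proof (rule AE_I2)
    fix t assume "t \<in> space \<mu>"
    then obtain i where i: "t \<in> trunc_dom i" using trunc_dom(2) by auto
    have mem: "t \<in> trunc_dom k" if "k \<ge> i" for k
      using i that trunc_dom(4) by (auto simp: incseq_def)
    have "trunc k f t \<le> trunc l f t" if "k \<le> l" for k l
      using that trunc_dom(4) by (auto simp: trunc_def incseq_def split: split_indicator) 
    then have "incseq (\<lambda>k. ennreal \<bar>trunc k f t\<bar>)"
      by (auto simp: incseq_def trunc_bounds intro!: ennreal_leI)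
    moreover have "\<forall>\<^sub>F k in sequentially. ennreal \<bar>trunc k f t\<bar> = ennreal \<bar>f t\<bar>"
    proof (rule eventually_sequentiallyI)
      fix k assume k: "k \<ge> max i (nat \<lceil>\<bar>f t\<bar>\<rceil>)"
      then have "\<bar>f t\<bar> \<le> real k" by linarith
      then show "ennreal \<bar>trunc k f t\<bar> = ennreal \<bar>f t\<bar>" using mem[of k] k by (simp add: trunc_def)
    qed
    ultimately show "incseq (\<lambda>k. ennreal \<bar>trunc k f t\<bar>) \<and> (\<lambda>k. ennreal \<bar>trunc k f t\<bar>) \<longlonglongrightarrow> ennreal \<bar>f t\<bar>"
      by (auto intro: tendsto_eventually)
  qed
qed measurable

section \<open>Extremal points of the dual ball and sign changes\<close>

abbreviation ext :: "('t \<Rightarrow> real) set" where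
  "ext \<equiv> extremal_points \<mu> N"

lemma ext_assoc: "g \<in> ext \<Longrightarrow> g \<in> assoc_space \<mu> N"
  by (simp add: extremal_points_def assoc_ball_def)

lemma ext_measurable [measurable_dest]: "g \<in> ext \<Longrightarrow> g \<in> borel_measurable \<mu>"
  using ext_assoc by (auto simp: assoc_space_def)

lemma ext_integrable: "g \<in> ext \<Longrightarrow> f \<in> fspace \<mu> N \<Longrightarrow> integrable \<mu> (\<lambda>t. f t * g t)"
  using ext_assoc by (auto simp: assoc_space_def)

lemma pairing_diff:
  "g \<in> ext \<Longrightarrow> f \<in> fspace \<mu> N \<Longrightarrow> h \<in> fspace \<mu> N \<Longrightarrow>
    pairing \<mu> g (\<lambda>t. f t - h t) = pairing \<mu> g f - pairing \<mu> g h"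
  by (simp add: pairing_def left_diff_distrib ext_integrable)

text \<open>The norm sees only absolute values, so the sign \<open>u\<close> can be moved from
  \<open>g\<close> to the test function without changing that function's norm.\<close>

lemma sign_mult_assoc_ball:
  assumes g: "g \<in> assoc_ball \<mu> N" and [measurable]: "u \<in> borel_measurable \<mu>"
    and u: "\<And>t. \<bar>u t\<bar> = (1::real)"
  shows "(\<lambda>t. u t * g t) \<in> assoc_ball \<mu> N"
proof -
  have gm [measurable]: "g \<in> borel_measurable \<mu>"
    using g by (simp add: assoc_ball_def assoc_space_def)
  have uf: "(\<lambda>t. f t * u t) \<in> fspace \<mu> N" and nf: "fs_norm N (\<lambda>t. f t * u t) = fs_norm N f"
    if "f \<in> fspace \<mu> N" for f
    using that by (auto simp: fspace_def fs_norm_def abs_mult u)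
  have pf: "pairing \<mu> (\<lambda>t. u t * g t) f = pairing \<mu> g (\<lambda>t. f t * u t)" for f
    by (simp add: pairing_def mult.assoc)
  have "(\<lambda>t. u t * g t) \<in> assoc_space \<mu> N"
  proof -
    obtain C where C: "C \<ge> 0" "\<And>f. f \<in> fspace \<mu> N \<Longrightarrow> ennreal \<bar>pairing \<mu> g f\<bar> \<le> ennreal C * fs_norm N f"
      and int: "\<And>f. f \<in> fspace \<mu> N \<Longrightarrow> integrable \<mu> (\<lambda>t. f t * g t)"
      using g by (auto simp: assoc_ball_def assoc_space_def)
    have "integrable \<mu> (\<lambda>t. f t * (u t * g t))" if "f \<in> fspace \<mu> N" for f
      using int[OF uf[OF that]] by (simp add: mult.assoc)
    moreover have "ennreal \<bar>pairing \<mu> (\<lambda>t. u t * g t) f\<bar> \<le> ennreal C * fs_norm N f" if "f \<in> fspace \<mu> N" for f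
      using C(2)[OF uf[OF that]] by (simp add: pf nf[OF that])
    ultimately show ?thesis using C(1) by (auto simp: assoc_space_def)
  qed
  moreover have "assoc_norm \<mu> N (\<lambda>t. u t * g t) \<le> assoc_norm \<mu> N g"
    unfolding assoc_norm_def
  proof (rule SUP_least)
    fix f assume "f \<in> {f \<in> fspace \<mu> N. fs_norm N f = 1}"
    then show "ennreal (pairing \<mu> (\<lambda>t. u t * g t) f)
        \<le> (SUP f\<in>{f \<in> fspace \<mu> N. fs_norm N f = 1}. ennreal (pairing \<mu> g f))"
      unfolding pf by (intro SUP_upper) (auto simp: uf nf)
  qed
  ultimately show ?thesis using g by (auto simp: assoc_ball_def)
qed

text \<open>Multiplication by \<open>u\<close> is a linear involution of the dual unit ball, since
  \<open>u t * u t = 1\<close>, and therefore permutes its extremal points.\<close>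

lemma sign_mult_ext:
  assumes g: "g \<in> ext" and u [measurable]: "u \<in> borel_measurable \<mu>" and abs_u: "\<And>t. \<bar>u t\<bar> = (1::real)"
  shows "(\<lambda>t. u t * g t) \<in> ext"
  unfolding extremal_points_def
proof (intro CollectI conjI ballI allI impI)
  have uu: "u t * u t = 1" for t
    using abs_u[of t] by (metis abs_mult_self_eq mult_1)
  show "(\<lambda>t. u t * g t) \<in> assoc_ball \<mu> N"
    using g by (intro sign_mult_assoc_ball u abs_u) (simp add: extremal_points_def)
  fix g1 g2 and w :: real
  assume g12: "g1 \<in> assoc_ball \<mu> N" "g2 \<in> assoc_ball \<mu> N" and w: "0 < w" "w < 1"
    and eq: "AE t in \<mu>. u t * g t = (1 - w) * g1 t + w * g2 t"
  have "AE t in \<mu>. g t = (1 - w) * (u t * g1 t) + w * (u t * g2 t)"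
    using eq
  proof (rule AE_mp, intro AE_I2 impI)
    fix t assume "u t * g t = (1 - w) * g1 t + w * g2 t"
    then have "u t * (u t * g t) = u t * ((1 - w) * g1 t + w * g2 t)" by simp
    then have "(u t * u t) * g t = (1 - w) * (u t * g1 t) + w * (u t * g2 t)"
      by (simp add: algebra_simps)
    then show "g t = (1 - w) * (u t * g1 t) + w * (u t * g2 t)" by (simp add: uu)
  qed
  moreover have "(\<lambda>t. u t * g1 t) \<in> assoc_ball \<mu> N" "(\<lambda>t. u t * g2 t) \<in> assoc_ball \<mu> N"
    using g12 by (auto intro!: sign_mult_assoc_ball u abs_u)
  moreover have "\<And>g1 g2 w. g1 \<in> assoc_ball \<mu> N \<Longrightarrow> g2 \<in> assoc_ball \<mu> N \<Longrightarrow> 0 < w \<Longrightarrow> w < 1 \<Longrightarrow>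
      AE t in \<mu>. g t = (1 - w) * g1 t + w * g2 t \<Longrightarrow> AE t in \<mu>. g1 t = g2 t"
    using g unfolding extremal_points_def by blast
  ultimately have "AE t in \<mu>. u t * g1 t = u t * g2 t"
    using w by blast
  then show "AE t in \<mu>. g1 t = g2 t"
  proof (rule AE_mp, intro AE_I2 impI)
    fix t assume "u t * g1 t = u t * g2 t"
    moreover have "u t \<noteq> 0" using uu[of t] by auto
    ultimately show "g1 t = g2 t" by simp
  qed
qed

lemma uminus_ext: "g \<in> ext \<Longrightarrow> (\<lambda>t. - g t) \<in> ext"
  using sign_mult_ext[of g "\<lambda>_. -1"] by simp

end

section \<open>Countable norming sets and measurability of path functionals\<close>

locale normed_by_ext = banach_function_norm \<mu> N for \<mu> :: "'t measure" and N +
  assumes sep: "separable_fspace \<mu> N"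
    and norming: "f \<in> fspace \<mu> N \<Longrightarrow>
      enn2ereal (fs_norm N f) = (SUP g\<in>extremal_points \<mu> N. ereal (pairing \<mu> g f))"
begin

lemma ereal_nrm: "f \<in> fspace \<mu> N \<Longrightarrow> ereal (nrm f) = (SUP g\<in>ext. ereal (pairing \<mu> g f))"
  using norming[of f] ennreal_nrm[of f] by (metis enn2ereal_ennreal nrm_nonneg)

lemma pairing_le_nrm: "g \<in> ext \<Longrightarrow> f \<in> fspace \<mu> N \<Longrightarrow> pairing \<mu> g f \<le> nrm f"
  using ereal_nrm[of f] by (metis SUP_upper ereal_less_eq(3))

lemma pairing_gt:
  assumes "f \<in> fspace \<mu> N" "0 < e"
  obtains g where "g \<in> ext" "nrm f - e < pairing \<mu> g f"
proof -
  have "ereal (nrm f - e) < (SUP g\<in>ext. ereal (pairing \<mu> g f))"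
    using assms by (simp add: ereal_nrm[symmetric])
  then show ?thesis using that by (auto simp: less_SUP_iff)
qed

lemma ext_nonempty: "ext \<noteq> {}"
  using pairing_gt[OF fspace_zero, of 1] by auto

definition dense_seq :: "nat \<Rightarrow> 't \<Rightarrow> real" where
  "dense_seq = (SOME h. range h \<subseteq> fspace \<mu> N \<and>
    (\<forall>f\<in>fspace \<mu> N. \<forall>\<epsilon>>0. \<exists>i. fs_norm N (\<lambda>t. f t - h i t) < ennreal \<epsilon>))"

lemma dense_seq:
  "dense_seq i \<in> fspace \<mu> N"
  "f \<in> fspace \<mu> N \<Longrightarrow> 0 < e \<Longrightarrow> \<exists>i. fs_norm N (\<lambda>t. f t - dense_seq i t) < ennreal e"
proof -
  obtain H where H: "countable H" "H \<subseteq> fspace \<mu> N"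
    "\<And>f \<epsilon>. f \<in> fspace \<mu> N \<Longrightarrow> \<epsilon> > 0 \<Longrightarrow> \<exists>h\<in>H. fs_norm N (\<lambda>t. f t - h t) < ennreal \<epsilon>"
    using sep unfolding separable_fspace_def by blast
  have "H \<noteq> {}" using H(3)[OF fspace_zero, of 1] by auto
  then have "range (from_nat_into H) = H" using H(1) by (rule range_from_nat_into)
  then have "\<exists>h::nat \<Rightarrow> 't \<Rightarrow> real. range h \<subseteq> fspace \<mu> N \<and>
    (\<forall>f\<in>fspace \<mu> N. \<forall>\<epsilon>>0. \<exists>i. fs_norm N (\<lambda>t. f t - h i t) < ennreal \<epsilon>)"
    using H(2,3) by (intro exI[of _ "from_nat_into H"]) (metis imageE)
  from someI_ex[OF this, folded dense_seq_def]
  show "dense_seq i \<in> fspace \<mu> N"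
    "f \<in> fspace \<mu> N \<Longrightarrow> 0 < e \<Longrightarrow> \<exists>i. fs_norm N (\<lambda>t. f t - dense_seq i t) < ennreal e"
    by auto
qed

text \<open>Near-optimal extremal points for the members of a dense sequence suffice, because
  pairings with extremal points are 1-Lipschitz in \<open>nrm\<close>. The error \<open>e\<close> is
  shared in thirds: two approximations of \<open>f\<close> and one near-optimal choice.\<close>

lemma countable_norming:
  obtains G where "countable G" "G \<subseteq> ext"
    "\<And>f e. f \<in> fspace \<mu> N \<Longrightarrow> 0 < e \<Longrightarrow> \<exists>g\<in>G. nrm f - e < pairing \<mu> g f"
proof -
  have "\<exists>g\<in>ext. nrm (dense_seq i) - 1 / real (Suc n) < pairing \<mu> g (dense_seq i)" for i n
    using pairing_gt[OF dense_seq(1)[of i], of "1 / real (Suc n)"] by auto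
  then obtain g where g: "\<And>i n. g i n \<in> ext"
    "\<And>i n. nrm (dense_seq i) - 1 / real (Suc n) < pairing \<mu> (g i n) (dense_seq i)"
    by metis
  show ?thesis
  proof (rule that[of "range (\<lambda>(i, n). g i n)"])
    show "range (\<lambda>(i, n). g i n) \<subseteq> ext" using g by auto
    fix f and e :: real assume f: "f \<in> fspace \<mu> N" and e: "0 < e"
    obtain i where i: "fs_norm N (\<lambda>t. f t - dense_seq i t) < ennreal (e / 3)"
      using dense_seq(2)[OF f, of "e / 3"] e by auto
    let ?h = "dense_seq i"
    have h: "?h \<in> fspace \<mu> N" by (rule dense_seq)
    have d: "nrm (\<lambda>t. f t - ?h t) < e / 3"
      using i nrm_less_iff[OF fspace_diff[OF f h]] by simp
    obtain n where n: "1 / real (Suc n) < e / 3"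
      using e nat_approx_posE[of "e / 3"] by auto
    have "nrm f \<le> nrm (\<lambda>t. f t - ?h t) + nrm ?h"
      using nrm_triangle[OF fspace_diff[OF f h] h] by simp
    moreover have "pairing \<mu> (g i n) ?h - pairing \<mu> (g i n) f \<le> nrm (\<lambda>t. f t - ?h t)"
      using pairing_le_nrm[OF g(1) fspace_diff[OF h f], of i n] pairing_diff[OF g(1) h f, of i n]
      by (simp only: nrm_minus[of f "dense_seq i"])
    ultimately have "nrm f - e < pairing \<mu> (g i n) f"
      using g(2)[of i n] d n by linarith
    then show "\<exists>g\<in>range (\<lambda>(i, n). g i n). nrm f - e < pairing \<mu> g f" by auto
  qed auto
qed

definition norming_set :: "('t \<Rightarrow> real) set" where
  "norming_set = (SOME G. countable G \<and> G \<subseteq> ext \<and>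
    (\<forall>f e. f \<in> fspace \<mu> N \<longrightarrow> 0 < e \<longrightarrow> (\<exists>g\<in>G. nrm f - e < pairing \<mu> g f)))"

lemma norming_set:
  "countable norming_set" "norming_set \<subseteq> ext"
  "f \<in> fspace \<mu> N \<Longrightarrow> 0 < e \<Longrightarrow> \<exists>g\<in>norming_set. nrm f - e < pairing \<mu> g f"
proof -
  have "\<exists>G. countable G \<and> G \<subseteq> ext \<and>
    (\<forall>f e. f \<in> fspace \<mu> N \<longrightarrow> 0 < e \<longrightarrow> (\<exists>g\<in>G. nrm f - e < pairing \<mu> g f))"
    using countable_norming by metis
  from someI_ex[OF this, folded norming_set_def]
  show "countable norming_set" "norming_set \<subseteq> ext"
    "f \<in> fspace \<mu> N \<Longrightarrow> 0 < e \<Longrightarrow> \<exists>g\<in>norming_set. nrm f - e < pairing \<mu> g f"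
    by auto
qed

lemma fs_norm_eq_SUP:
  assumes f: "f \<in> fspace \<mu> N"
  shows "fs_norm N f = (SUP g\<in>norming_set. ennreal (pairing \<mu> g f))"
proof (rule antisym)
  show "(SUP g\<in>norming_set. ennreal (pairing \<mu> g f)) \<le> fs_norm N f"
    using norming_set(2) pairing_le_nrm[OF _ f]
    by (intro SUP_least) (auto simp: ennreal_nrm[OF f, symmetric] intro!: ennreal_leI)
  have "ennreal (nrm f) \<le> (SUP g\<in>norming_set. ennreal (pairing \<mu> g f)) + ennreal e" if e: "0 < e" for e
  proof -
    obtain g where g: "g \<in> norming_set" "nrm f - e < pairing \<mu> g f" using norming_set(3)[OF f e] by auto
    have "ennreal (nrm f) \<le> ennreal (max 0 (pairing \<mu> g f) + e)"
      using g e by (intro ennreal_leI) auto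
    also have "\<dots> = ennreal (max 0 (pairing \<mu> g f)) + ennreal e" using e by simp
    also have "ennreal (max 0 (pairing \<mu> g f)) = ennreal (pairing \<mu> g f)"
      by (cases "pairing \<mu> g f \<ge> 0") (auto simp: max_def ennreal_neg)
    also have "\<dots> \<le> (SUP g\<in>norming_set. ennreal (pairing \<mu> g f))" using g by (intro SUP_upper)
    finally show ?thesis by (simp add: add_right_mono)
  qed
  then have "ennreal (nrm f) \<le> (SUP g\<in>norming_set. ennreal (pairing \<mu> g f))"
    by (rule ennreal_le_epsilon)
  then show "fs_norm N f \<le> (SUP g\<in>norming_set. ennreal (pairing \<mu> g f))"
    by (simp add: ennreal_nrm[OF f])
qed

text \<open>With absolute values inside a nonnegative integral the bound makes sense for every
  measurable \<open>f\<close>. It holds for the truncations of \<open>f\<close>, which lie in the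
  space, and passes to the limit by the Fatou property.\<close>

lemma fs_norm_le_SUP:
  assumes [measurable]: "f \<in> borel_measurable \<mu>"
  shows "fs_norm N f \<le> (SUP g\<in>norming_set. \<integral>\<^sup>+t. ennreal (\<bar>f t\<bar> * \<bar>g t\<bar>) \<partial>\<mu>)"
proof (rule LIMSEQ_le_const2[OF fs_norm_trunc_tendsto[OF assms]], intro exI allI impI)
  fix k
  have "ennreal (pairing \<mu> g (trunc k f)) \<le> (\<integral>\<^sup>+t. ennreal (\<bar>f t\<bar> * \<bar>g t\<bar>) \<partial>\<mu>)" if g: "g \<in> norming_set" for g
  proof -
    have "ennreal (pairing \<mu> g (trunc k f)) \<le> ennreal (norm (\<integral>t. trunc k f t * g t \<partial>\<mu>))"
      unfolding pairing_def by (intro ennreal_leI) simp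
    also have "\<dots> \<le> (\<integral>\<^sup>+t. ennreal (norm (trunc k f t * g t)) \<partial>\<mu>)"
      using g norming_set(2) ext_integrable[OF _ trunc_fspace[OF assms]]
      by (intro integral_norm_bound_ennreal) auto
    also have "\<dots> \<le> (\<integral>\<^sup>+t. ennreal (\<bar>f t\<bar> * \<bar>g t\<bar>) \<partial>\<mu>)"
      using trunc_bounds by (intro nn_integral_mono ennreal_leI) (auto simp: abs_mult intro!: mult_right_mono)
    finally show ?thesis .
  qed
  then show "fs_norm N (trunc k f) \<le> (SUP g\<in>norming_set. \<integral>\<^sup>+t. ennreal (\<bar>f t\<bar> * \<bar>g t\<bar>) \<partial>\<mu>)"
    unfolding fs_norm_eq_SUP[OF trunc_fspace[OF assms]] by (intro SUP_mono) auto
qed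

text \<open>The norm of a truncated path is a countable supremum of integrals of a jointly
  measurable function, hence measurable in \<open>\<omega>\<close>; the norm of the path is the
  limit of these.\<close>

lemma measurable_fs_norm_field:
  assumes X: "measurable_field \<mu> P X"
  shows "(\<lambda>\<omega>. fs_norm N (\<lambda>t. X t \<omega>)) \<in> borel_measurable P"
proof (rule borel_measurable_LIMSEQ_order)
  show "(\<lambda>k. fs_norm N (trunc k (\<lambda>t. X t \<omega>))) \<longlonglongrightarrow> fs_norm N (\<lambda>t. X t \<omega>)" if "\<omega> \<in> space P" for \<omega>
    by (rule fs_norm_trunc_tendsto[OF measurable_field_section(1)[OF X that]])
  fix k
  have "(\<lambda>\<omega>. SUP g\<in>norming_set. ennreal (pairing \<mu> g (trunc k (\<lambda>t. X t \<omega>)))) \<in> borel_measurable P"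
  proof (rule borel_measurable_SUP[OF norming_set(1)])
    fix g assume "g \<in> norming_set"
    then have [measurable]: "g \<in> borel_measurable \<mu>" using norming_set(2) ext_measurable by auto
    have [measurable]: "(\<lambda>z. X (snd z) (fst z)) \<in> borel_measurable (P \<Otimes>\<^sub>M \<mu>)"
      using measurable_compose[OF measurable_pair_swap' X[unfolded measurable_field_def]]
      by (simp add: split_beta')
    have [measurable]: "trunc_dom k \<in> sets \<mu>" by (rule trunc_dom)
    have "(\<lambda>(\<omega>, t). trunc k (\<lambda>t. X t \<omega>) t * g t) \<in> borel_measurable (P \<Otimes>\<^sub>M \<mu>)"
      unfolding trunc_def split_beta' by measurable
    then show "(\<lambda>\<omega>. ennreal (pairing \<mu> g (trunc k (\<lambda>t. X t \<omega>)))) \<in> borel_measurable P"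
      unfolding pairing_def by (intro measurable_compose[OF borel_measurable_lebesgue_integral measurable_ennreal])
  qed
  then show "(\<lambda>\<omega>. fs_norm N (trunc k (\<lambda>t. X t \<omega>))) \<in> borel_measurable P"
    by (rule measurable_cong[THEN iffD1, rotated])
      (simp add: fs_norm_eq_SUP trunc_fspace measurable_field_section(1)[OF X])
qed

lemma path_event_eq:
  "measurable_field \<mu> P X \<Longrightarrow> path_event \<mu> N P X = {\<omega> \<in> space P. fs_norm N (\<lambda>t. X t \<omega>) < \<infinity>}"
  by (auto simp: path_event_def fspace_def measurable_field_section)

lemma sets_path_event [measurable]:
  "measurable_field \<mu> P X \<Longrightarrow> path_event \<mu> N P X \<in> sets P"
  using measurable_fs_norm_field[of P X] by (simp add: path_event_eq)

text \<open>The path is replaced by the first member of the dense sequence within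
  \<open>1 / Suc k\<close>. Its index is a measurable natural number, so \<open>F\<close> of the
  approximant is measurable whatever \<open>F\<close> is; continuity of \<open>F\<close> gives
  convergence.\<close>

lemma random_elementI:
  assumes X: "measurable_field \<mu> P X" and AE: "AE \<omega> in P. (\<lambda>t. X t \<omega>) \<in> fspace \<mu> N"
  shows "random_element \<mu> N P X"
  unfolding random_element_def
proof (intro conjI AE allI impI)
  fix F assume F: "bdd_cont_functional \<mu> N F"
  have meas: "(\<lambda>\<omega>. fs_norm N (\<lambda>t. X t \<omega> - dense_seq i t)) \<in> borel_measurable P" for i
  proof (rule measurable_fs_norm_field)
    have [measurable]: "dense_seq i \<in> borel_measurable \<mu>" using dense_seq(1) by (rule fspace_measurable)
    have [measurable]: "(\<lambda>z. X (fst z) (snd z)) \<in> borel_measurable (\<mu> \<Otimes>\<^sub>M P)"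
      using X by (simp add: measurable_field_def split_beta')
    show "measurable_field \<mu> P (\<lambda>t \<omega>. X t \<omega> - dense_seq i t)"
      unfolding measurable_field_def split_beta' by measurable
  qed
  \<comment> \<open>Outside \<open>path_event\<close> no index need satisfy the condition and the
    value of \<open>LEAST\<close> is arbitrary; the indicator below annihilates these
    points.\<close>
  define j where "j k \<omega> = (LEAST i. fs_norm N (\<lambda>t. X t \<omega> - dense_seq i t) < ennreal (1 / real (Suc k)))" for k \<omega>
  have [measurable]: "j k \<in> measurable P (count_space UNIV)" for k
    unfolding j_def[abs_def] using meas by measurable
  have [measurable]: "path_event \<mu> N P X \<in> sets P" using X by (rule sets_path_event)
  show "set_borel_measurable P (path_event \<mu> N P X) (\<lambda>\<omega>. F (\<lambda>t. X t \<omega>))"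
    unfolding set_borel_measurable_def
  proof (rule borel_measurable_LIMSEQ_real)
    show "(\<lambda>\<omega>. indicator (path_event \<mu> N P X) \<omega> *\<^sub>R F (dense_seq (j k \<omega>))) \<in> borel_measurable P" for k
      by measurable
    fix \<omega>
    show "(\<lambda>k. indicator (path_event \<mu> N P X) \<omega> *\<^sub>R F (dense_seq (j k \<omega>)))
        \<longlonglongrightarrow> indicator (path_event \<mu> N P X) \<omega> *\<^sub>R F (\<lambda>t. X t \<omega>)"
    proof (cases "\<omega> \<in> path_event \<mu> N P X")
      case True
      then have x: "(\<lambda>t. X t \<omega>) \<in> fspace \<mu> N" by (simp add: path_event_def)
      have near: "fs_norm N (\<lambda>t. X t \<omega> - dense_seq (j k \<omega>) t) < ennreal (1 / real (Suc k))" for k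
        unfolding j_def by (rule LeastI_ex) (intro dense_seq(2)[OF x], simp)
      have "(\<lambda>k. F (dense_seq (j k \<omega>))) \<longlonglongrightarrow> F (\<lambda>t. X t \<omega>)"
      proof (rule LIMSEQ_I)
        fix e :: real assume "0 < e"
        with F[unfolded bdd_cont_functional_def, THEN conjunct2, THEN bspec, OF x]
        obtain d where d: "d > 0" "\<And>h. h \<in> fspace \<mu> N \<Longrightarrow> fs_norm N (\<lambda>t. h t - X t \<omega>) < ennreal d
            \<Longrightarrow> \<bar>F h - F (\<lambda>t. X t \<omega>)\<bar> < e"
          by meson
        obtain n where n: "1 / real (Suc n) < d" using nat_approx_posE[OF d(1)] by auto
        have "norm (F (dense_seq (j k \<omega>)) - F (\<lambda>t. X t \<omega>)) < e" if "k \<ge> n" for k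
          unfolding real_norm_def
        proof (rule d(2)[OF dense_seq(1)])
          have "1 / real (Suc k) \<le> 1 / real (Suc n)" using that by (intro divide_left_mono) auto
          then have "ennreal (1 / real (Suc k)) \<le> ennreal d" using n by (intro ennreal_leI) simp
          with near[of k] show "fs_norm N (\<lambda>t. dense_seq (j k \<omega>) t - X t \<omega>) < ennreal d"
            by (subst fs_norm_minus) (rule less_le_trans)
        qed
        then show "\<exists>no. \<forall>k\<ge>no. norm (F (dense_seq (j k \<omega>)) - F (\<lambda>t. X t \<omega>)) < e" by blast
      qed
      then show ?thesis using True by simp
    qed simp
  qed
qed

end

subsection \<open>Chaining\<close>

text \<open>
  Young's inequality with the weight \<open>A = card F powr (1 / p) * m\<close> replaces both Minkowski's
  integral inequality and the union bound.
\<close>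

lemma maximal_inequality:
  fixes X :: "'t \<Rightarrow> 'w \<Rightarrow> real" and h :: "'i \<Rightarrow> 't \<Rightarrow> real"
  assumes \<mu>: "sigma_finite_measure \<mu>" and P: "sigma_finite_measure P" "emeasure P (space P) = 1"
    and X: "measurable_field \<mu> P X"
    and F: "finite F" "F \<noteq> {}" and h: "\<And>i. i \<in> F \<Longrightarrow> h i \<in> borel_measurable \<mu>"
    and d: "\<And>i. i \<in> F \<Longrightarrow> (\<integral>\<^sup>+t. ennreal \<bar>h i t\<bar> \<partial>\<mu>) \<le> d"
    and p: "1 \<le> p" and m: "0 < m"
    and mom: "\<And>t. t \<in> space \<mu> \<Longrightarrow> (\<integral>\<^sup>+\<omega>. ennreal (\<bar>X t \<omega>\<bar> powr p) \<partial>P) \<le> ennreal (m powr p)"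
  shows "(\<integral>\<^sup>+\<omega>. (SUP i\<in>F. \<integral>\<^sup>+t. ennreal (\<bar>X t \<omega>\<bar> * \<bar>h i t\<bar>) \<partial>\<mu>) \<partial>P)
    \<le> ennreal (real (card F) powr (1 / p) * m) * d"
proof -
  interpret \<mu>: sigma_finite_measure \<mu> by fact
  interpret P: sigma_finite_measure P by fact
  interpret mp: pair_sigma_finite \<mu> P ..
  have Xm [measurable]: "(\<lambda>z. X (fst z) (snd z)) \<in> borel_measurable (\<mu> \<Otimes>\<^sub>M P)"
    using X by (simp add: measurable_field_def split_beta')
  have Xm' [measurable]: "(\<lambda>z. X (snd z) (fst z)) \<in> borel_measurable (P \<Otimes>\<^sub>M \<mu>)"
    using measurable_compose[OF measurable_pair_swap' X[unfolded measurable_field_def]]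
    by (simp add: split_beta')
  have Xt [measurable]: "X t \<in> borel_measurable P" if "t \<in> space \<mu>" for t
    using measurable_compose[OF measurable_Pair1'[OF that] Xm] by simp
  have Xw [measurable]: "(\<lambda>t. X t \<omega>) \<in> borel_measurable \<mu>" if "\<omega> \<in> space P" for \<omega>
    using measurable_compose[OF measurable_Pair2'[OF that] Xm] by simp
  define n where "n = real (card F)"
  have n: "n > 0" using F by (simp add: n_def card_gt_0_iff)
  define A where "A = n powr (1 / p) * m"
  have A: "A > 0" using n m by (simp add: A_def)
  \<comment> \<open>The two coefficients of \<open>Young_scaled\<close>. The maximum is bounded by
    the sum over \<open>F\<close> only in the term with \<open>a\<close>, which contributes
    \<open>A / p\<close>; the term with \<open>b\<close> is common to all members and contributes
    the remaining \<open>(1 - 1 / p) * A\<close>.\<close>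
  define a where "a = A powr (1 - p) / p"
  define b where "b = (1 - 1 / p) * A"
  have ab: "a \<ge> 0" "b \<ge> 0" using p A by (auto simp: a_def b_def)
  have "A powr p = n * m powr p"
    using n m p by (simp add: A_def powr_mult powr_powr)
  moreover have "A powr (1 - p) * A powr p = A"
    using A by (simp add: powr_add[symmetric])
  ultimately have "a * (n * m powr p) = A / p" by (simp add: a_def)
  then have total: "a * (n * m powr p) + b = A"
    using p by (simp add: b_def left_diff_distrib)
  define W where "W i \<omega> = (\<integral>\<^sup>+t. ennreal (\<bar>X t \<omega>\<bar> powr p * \<bar>h i t\<bar>) \<partial>\<mu>)" for i \<omega>
  have W_meas [measurable]: "W i \<in> borel_measurable P" if "i \<in> F" for i
  proof -
    note h[OF that, measurable]
    have "(\<lambda>(\<omega>, t). ennreal (\<bar>X t \<omega>\<bar> powr p * \<bar>h i t\<bar>)) \<in> borel_measurable (P \<Otimes>\<^sub>M \<mu>)"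
      unfolding split_beta' by measurable
    then show ?thesis unfolding W_def by (rule \<mu>.borel_measurable_nn_integral)
  qed
  have W_le: "(\<integral>\<^sup>+\<omega>. W i \<omega> \<partial>P) \<le> ennreal (m powr p) * d" if i: "i \<in> F" for i
  proof -
    note h[OF i, measurable]
    have "(\<integral>\<^sup>+\<omega>. W i \<omega> \<partial>P) = (\<integral>\<^sup>+\<omega>. \<integral>\<^sup>+t. (\<lambda>z. ennreal (\<bar>X (fst z) (snd z)\<bar> powr p * \<bar>h i (fst z)\<bar>)) (t, \<omega>) \<partial>\<mu> \<partial>P)"
      by (simp add: W_def)
    also have "\<dots> = (\<integral>\<^sup>+t. \<integral>\<^sup>+\<omega>. (\<lambda>z. ennreal (\<bar>X (fst z) (snd z)\<bar> powr p * \<bar>h i (fst z)\<bar>)) (t, \<omega>) \<partial>P \<partial>\<mu>)"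
      by (rule mp.Fubini) measurable
    also have "\<dots> = (\<integral>\<^sup>+t. (\<integral>\<^sup>+\<omega>. ennreal (\<bar>X t \<omega>\<bar> powr p) \<partial>P) * ennreal \<bar>h i t\<bar> \<partial>\<mu>)"
      by (intro nn_integral_cong) (simp add: ennreal_mult nn_integral_multc)
    also have "\<dots> \<le> (\<integral>\<^sup>+t. ennreal (m powr p) * ennreal \<bar>h i t\<bar> \<partial>\<mu>)"
      using mom by (intro nn_integral_mono mult_right_mono) auto
    also have "\<dots> \<le> ennreal (m powr p) * d"
      using d[OF i] by (simp add: nn_integral_cmult mult_left_mono)
    finally show ?thesis .
  qed
  have pw: "(SUP i\<in>F. \<integral>\<^sup>+t. ennreal (\<bar>X t \<omega>\<bar> * \<bar>h i t\<bar>) \<partial>\<mu>) \<le> ennreal a * (\<Sum>j\<in>F. W j \<omega>) + ennreal b * d"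
    if \<omega>: "\<omega> \<in> space P" for \<omega>
  proof (rule SUP_least)
    fix i assume i: "i \<in> F"
    note h[OF i, measurable]
    note Xw[OF \<omega>, measurable]
    have "(\<integral>\<^sup>+t. ennreal (\<bar>X t \<omega>\<bar> * \<bar>h i t\<bar>) \<partial>\<mu>)
        \<le> (\<integral>\<^sup>+t. ennreal a * ennreal (\<bar>X t \<omega>\<bar> powr p * \<bar>h i t\<bar>) + ennreal b * ennreal \<bar>h i t\<bar> \<partial>\<mu>)"
    proof (rule nn_integral_mono)
      fix t
      have "\<bar>X t \<omega>\<bar> * \<bar>h i t\<bar> \<le> (A powr (1 - p) * \<bar>X t \<omega>\<bar> powr p / p + (1 - 1 / p) * A) * \<bar>h i t\<bar>"
        using A p by (intro mult_right_mono Young_scaled) auto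
      also have "\<dots> = a * (\<bar>X t \<omega>\<bar> powr p * \<bar>h i t\<bar>) + b * \<bar>h i t\<bar>"
        by (simp add: a_def b_def distrib_right)
      finally show "ennreal (\<bar>X t \<omega>\<bar> * \<bar>h i t\<bar>)
          \<le> ennreal a * ennreal (\<bar>X t \<omega>\<bar> powr p * \<bar>h i t\<bar>) + ennreal b * ennreal \<bar>h i t\<bar>"
        using ab by (simp add: ennreal_mult[symmetric] ennreal_plus[symmetric] ennreal_leI del: ennreal_plus)
    qed
    also have "\<dots> = ennreal a * W i \<omega> + ennreal b * (\<integral>\<^sup>+t. ennreal \<bar>h i t\<bar> \<partial>\<mu>)"
      unfolding W_def by (subst nn_integral_add) (auto simp: nn_integral_cmult)
    also have "\<dots> \<le> ennreal a * (\<Sum>j\<in>F. W j \<omega>) + ennreal b * d"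
      using F i d[OF i] by (intro add_mono mult_left_mono member_le_sum) auto
    finally show "(\<integral>\<^sup>+t. ennreal (\<bar>X t \<omega>\<bar> * \<bar>h i t\<bar>) \<partial>\<mu>) \<le> ennreal a * (\<Sum>j\<in>F. W j \<omega>) + ennreal b * d" .
  qed
  have "(\<integral>\<^sup>+\<omega>. (SUP i\<in>F. \<integral>\<^sup>+t. ennreal (\<bar>X t \<omega>\<bar> * \<bar>h i t\<bar>) \<partial>\<mu>) \<partial>P)
      \<le> (\<integral>\<^sup>+\<omega>. ennreal a * (\<Sum>j\<in>F. W j \<omega>) + ennreal b * d \<partial>P)"
    using pw by (intro nn_integral_mono) auto
  also have "\<dots> = ennreal a * (\<Sum>j\<in>F. \<integral>\<^sup>+\<omega>. W j \<omega> \<partial>P) + ennreal b * d"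
    using P(2) by (subst nn_integral_add) (auto simp: nn_integral_cmult nn_integral_sum)
  also have "\<dots> \<le> ennreal a * (\<Sum>j\<in>F. ennreal (m powr p) * d) + ennreal b * d"
    using W_le by (intro add_right_mono mult_left_mono sum_mono) auto
  also have "\<dots> = (ennreal a * (ennreal n * ennreal (m powr p)) + ennreal b) * d"
    by (simp add: n_def ennreal_of_nat_eq_real_of_nat distrib_right mult.assoc)
  also have "ennreal a * (ennreal n * ennreal (m powr p)) + ennreal b = ennreal A"
    using ab n total by (simp add: ennreal_mult[symmetric] ennreal_plus[symmetric] del: ennreal_plus)
  finally show ?thesis by (simp add: A_def n_def)
qed

text \<open>The exponent \<open>q k\<close> is chosen for each level separately, and
  \<open>\<Psi>\<close> stands for the growth of the moments in \<open>p\<close>. A link from level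
  \<open>Suc k\<close> to level \<open>k\<close> has length \<open>\<delta> k\<close> but is indexed
  by the finer net, hence the shift of indices in the series, which is the discrete form of the
  entropy integral.\<close>

locale chaining = normed_by_ext \<mu> N for \<mu> :: "'t measure" and N +
  fixes net :: "nat \<Rightarrow> ('t \<Rightarrow> real) set" and \<delta> q :: "nat \<Rightarrow> real" and \<Psi> :: "real \<Rightarrow> real"
  assumes finite_net: "finite (net k)" and net_ext: "net k \<subseteq> extremal_points \<mu> N"
    and net: "g \<in> extremal_points \<mu> N \<Longrightarrow> \<exists>c\<in>net k. L1_dist \<mu> c g \<le> ennreal (\<delta> k)"
    and \<delta>_nonneg: "0 \<le> \<delta> k" and \<delta>_tendsto: "\<delta> \<longlonglongrightarrow> 0"
    and q: "2 < q k" and \<Psi>_pos: "2 < p \<Longrightarrow> 0 < \<Psi> p"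
    and summable: "summable (\<lambda>k. \<delta> k * (real (card (net (Suc k))) powr (1 / q (Suc k)) * \<Psi> (q (Suc k))))"
begin

lemma net_nonempty: "net k \<noteq> {}"
  using ext_nonempty net by blast

definition C :: "nat \<Rightarrow> real" where
  "C k = real (card (net k)) powr (1 / q k) * \<Psi> (q k)"

lemma C_nonneg: "0 \<le> C k"
  using \<Psi>_pos[OF q[of k]] by (simp add: C_def)

lemma C_summable: "summable (\<lambda>k. \<delta> k * C (Suc k))"
  using summable by (simp add: C_def)

definition proj :: "nat \<Rightarrow> ('t \<Rightarrow> real) \<Rightarrow> 't \<Rightarrow> real" where
  "proj k g = (SOME c. c \<in> net k \<and> L1_dist \<mu> c g \<le> ennreal (\<delta> k))"

lemma proj: "g \<in> ext \<Longrightarrow> proj k g \<in> net k" "g \<in> ext \<Longrightarrow> L1_dist \<mu> (proj k g) g \<le> ennreal (\<delta> k)"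
proof -
  assume "g \<in> ext"
  then have "\<exists>c. c \<in> net k \<and> L1_dist \<mu> c g \<le> ennreal (\<delta> k)" using net by blast
  from someI_ex[OF this, folded proj_def]
  show "proj k g \<in> net k" "L1_dist \<mu> (proj k g) g \<le> ennreal (\<delta> k)" by auto
qed

text \<open>The input to chaining: moments at single points, controlled by one constant
  \<open>K\<close> for all exponents. The normed sums and the Gaussian limit share this property
  with \<open>K = 8\<close>, so all estimates below are uniform in them.\<close>

definition moment_bounded :: "'w measure \<Rightarrow> ('t \<Rightarrow> 'w \<Rightarrow> real) \<Rightarrow> real \<Rightarrow> bool" where
  "moment_bounded P X K \<longleftrightarrow> prob_space P \<and> measurable_field \<mu> P X \<and> 0 < K \<and>
    (\<forall>t\<in>space \<mu>. \<forall>p>2. (\<integral>\<^sup>+\<omega>. ennreal (\<bar>X t \<omega>\<bar> powr p) \<partial>P) \<le> ennreal ((K * \<Psi> p) powr p))"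

text \<open>The cost of the starting net \<open>m\<close>, restricted to \<open>B\<close>, plus the
  cost of all later links. The second part is small for large \<open>m\<close> uniformly in
  \<open>B\<close>; the first is then small for small \<open>B\<close>, because a net is
  finite.\<close>

definition tail_bound :: "'t set \<Rightarrow> nat \<Rightarrow> ennreal" where
  "tail_bound B m = ennreal (C m) * (SUP g\<in>net m. \<integral>\<^sup>+t. ennreal (\<bar>g t\<bar> * indicator B t) \<partial>\<mu>)
    + (\<Sum>k. ennreal (\<delta> (k + m) * C (Suc (k + m))))"

text \<open>The maximum over \<open>net (Suc k)\<close> exceeds the one over \<open>net k\<close> by
  at most the maximum over the links \<open>g - proj k g\<close>. The maximal inequality prices
  every level with its own exponent, and summation gives \<open>tail_bound\<close>. Norming
  functions outside the nets are reached by one final link.\<close>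

lemma nn_integral_fs_norm_le:
  assumes mb: "moment_bounded P X K" and B [measurable]: "B \<in> sets \<mu>"
  shows "(\<integral>\<^sup>+\<omega>. fs_norm N (\<lambda>t. X t \<omega> * indicator B t) \<partial>P) \<le> ennreal K * tail_bound B m"
proof -
  interpret P: prob_space P using mb by (simp add: moment_bounded_def)
  have X: "measurable_field \<mu> P X" and K: "K > 0"
    and mom: "\<And>t p. t \<in> space \<mu> \<Longrightarrow> p > 2 \<Longrightarrow> (\<integral>\<^sup>+\<omega>. ennreal (\<bar>X t \<omega>\<bar> powr p) \<partial>P) \<le> ennreal ((K * \<Psi> p) powr p)"
    using mb by (auto simp: moment_bounded_def)
  have Xm' [measurable]: "(\<lambda>z. X (snd z) (fst z)) \<in> borel_measurable (P \<Otimes>\<^sub>M \<mu>)"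
    using measurable_compose[OF measurable_pair_swap' X[unfolded measurable_field_def]]
    by (simp add: split_beta')
  define Z where "Z h \<omega> = (\<integral>\<^sup>+t. ennreal (\<bar>X t \<omega>\<bar> * \<bar>h t * indicator B t\<bar>) \<partial>\<mu>)" for h \<omega>
  have Z_meas [measurable]: "Z h \<in> borel_measurable P" if [measurable]: "h \<in> borel_measurable \<mu>" for h
  proof -
    have "(\<lambda>(\<omega>, t). ennreal (\<bar>X t \<omega>\<bar> * \<bar>h t * indicator B t\<bar>)) \<in> borel_measurable (P \<Otimes>\<^sub>M \<mu>)"
      unfolding split_beta' by measurable
    then show ?thesis unfolding Z_def by (rule borel_measurable_nn_integral)
  qed
  have Z_le: "Z g \<omega> \<le> Z c \<omega> + Z (\<lambda>t. g t - c t) \<omega>"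
    if \<omega>: "\<omega> \<in> space P" and [measurable]: "g \<in> borel_measurable \<mu>" "c \<in> borel_measurable \<mu>" for g c \<omega>
  proof -
    note measurable_field_section(1)[OF X \<omega>, measurable]
    have "Z g \<omega> \<le> (\<integral>\<^sup>+t. ennreal (\<bar>X t \<omega>\<bar> * \<bar>c t * indicator B t\<bar>)
        + ennreal (\<bar>X t \<omega>\<bar> * \<bar>(g t - c t) * indicator B t\<bar>) \<partial>\<mu>)"
      unfolding Z_def
    proof (rule nn_integral_mono)
      fix t
      have "\<bar>X t \<omega>\<bar> * \<bar>g t * indicator B t\<bar> \<le> \<bar>X t \<omega>\<bar> * (\<bar>c t * indicator B t\<bar> + \<bar>(g t - c t) * indicator B t\<bar>)"
        by (intro mult_left_mono) (auto split: split_indicator)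
      then show "ennreal (\<bar>X t \<omega>\<bar> * \<bar>g t * indicator B t\<bar>) \<le> ennreal (\<bar>X t \<omega>\<bar> * \<bar>c t * indicator B t\<bar>)
        + ennreal (\<bar>X t \<omega>\<bar> * \<bar>(g t - c t) * indicator B t\<bar>)"
        by (simp add: ennreal_plus[symmetric] distrib_left ennreal_leI del: ennreal_plus)
    qed
    also have "\<dots> = Z c \<omega> + Z (\<lambda>t. g t - c t) \<omega>"
      unfolding Z_def by (rule nn_integral_add) measurable
    finally show ?thesis .
  qed
  have max: "(\<integral>\<^sup>+\<omega>. (SUP i\<in>F. Z (h i) \<omega>) \<partial>P) \<le> ennreal (real (card F) powr (1 / p) * (K * \<Psi> p)) * d"
    if "finite F" "F \<noteq> {}" "\<And>i. i \<in> F \<Longrightarrow> h i \<in> borel_measurable \<mu>"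
      "\<And>i. i \<in> F \<Longrightarrow> (\<integral>\<^sup>+t. ennreal \<bar>h i t * indicator B t\<bar> \<partial>\<mu>) \<le> d" "2 < p"
    for F and h :: "('t \<Rightarrow> real) \<Rightarrow> 't \<Rightarrow> real" and d p
    unfolding Z_def using that K \<Psi>_pos[of p]
    by (intro maximal_inequality[OF sigma_finite_measure_axioms P.sigma_finite_measure_axioms P.emeasure_space_1 X _ _ _ _ _ _ mom])
      (auto intro!: borel_measurable_times)
  have ext_m: "g \<in> borel_measurable \<mu>" if "g \<in> ext" for g using that by (rule ext_measurable)
  have net_m: "g \<in> borel_measurable \<mu>" if "g \<in> net k" for g k using that net_ext ext_m by blast
  have dist: "(\<integral>\<^sup>+t. ennreal \<bar>(g t - proj k g t) * indicator B t\<bar> \<partial>\<mu>) \<le> ennreal (\<delta> k)" if "g \<in> ext" for g k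
  proof -
    have "(\<integral>\<^sup>+t. ennreal \<bar>(g t - proj k g t) * indicator B t\<bar> \<partial>\<mu>) \<le> L1_dist \<mu> (proj k g) g"
      unfolding L1_dist_def by (intro nn_integral_mono ennreal_leI) (auto split: split_indicator)
    also have "\<dots> \<le> ennreal (\<delta> k)" using proj(2)[OF that] .
    finally show ?thesis .
  qed
  define V where "V k \<omega> = (SUP g\<in>net (Suc k). Z (\<lambda>t. g t - proj k g t) \<omega>)" for k \<omega>
  define Y where "Y k \<omega> = (SUP g\<in>net k. Z g \<omega>)" for k \<omega>
  have V_meas [measurable]: "V k \<in> borel_measurable P" for k
    unfolding V_def[abs_def] using finite_net net_m proj(1) net_ext
    by (intro borel_measurable_SUP Z_meas borel_measurable_diff countable_finite) blast+
  have Y_meas [measurable]: "Y k \<in> borel_measurable P" for k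
    unfolding Y_def[abs_def] using finite_net net_m
    by (intro borel_measurable_SUP Z_meas countable_finite)
  have EV: "(\<integral>\<^sup>+\<omega>. V k \<omega> \<partial>P) \<le> ennreal K * ennreal (\<delta> k * C (Suc k))" for k
  proof -
    have "(\<integral>\<^sup>+\<omega>. V k \<omega> \<partial>P) \<le> ennreal (real (card (net (Suc k))) powr (1 / q (Suc k)) * (K * \<Psi> (q (Suc k)))) * ennreal (\<delta> k)"
      unfolding V_def using finite_net net_nonempty net_m proj(1) net_ext dist q
      by (intro max borel_measurable_diff) blast+
    also have "\<dots> = ennreal (K * (\<delta> k * C (Suc k)))"
      using K \<delta>_nonneg \<Psi>_pos[OF q[of "Suc k"]] by (simp add: C_def ennreal_mult[symmetric] ac_simps)
    finally show ?thesis using K \<delta>_nonneg C_nonneg by (simp add: ennreal_mult)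
  qed
  have EY: "(\<integral>\<^sup>+\<omega>. Y m \<omega> \<partial>P) \<le> ennreal K * (ennreal (C m) * (SUP g\<in>net m. \<integral>\<^sup>+t. ennreal (\<bar>g t\<bar> * indicator B t) \<partial>\<mu>))"
  proof -
    let ?d = "SUP g\<in>net m. \<integral>\<^sup>+t. ennreal (\<bar>g t\<bar> * indicator B t) \<partial>\<mu>"
    have "(\<integral>\<^sup>+\<omega>. Y m \<omega> \<partial>P) \<le> ennreal (real (card (net m)) powr (1 / q m) * (K * \<Psi> (q m))) * ?d"
      unfolding Y_def
    proof (rule max[of _ "\<lambda>g. g"])
      show "(\<integral>\<^sup>+t. ennreal \<bar>g t * indicator B t\<bar> \<partial>\<mu>) \<le> ?d" if "g \<in> net m" for g
        using that by (intro SUP_upper2[of g]) (auto simp: abs_mult intro!: nn_integral_mono)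
    qed (use finite_net net_nonempty net_m q in auto)
    also have "real (card (net m)) powr (1 / q m) * (K * \<Psi> (q m)) = K * C m"
      by (simp add: C_def)
    finally show ?thesis using K C_nonneg by (simp add: ennreal_mult mult.assoc)
  qed
  have step: "Y (Suc k) \<omega> \<le> Y k \<omega> + V k \<omega>" if \<omega>: "\<omega> \<in> space P" for k \<omega>
    unfolding Y_def[of "Suc k"]
  proof (rule SUP_least)
    fix g assume g: "g \<in> net (Suc k)"
    have p: "proj k g \<in> net k" using g net_ext proj(1) by blast
    have "Z g \<omega> \<le> Z (proj k g) \<omega> + Z (\<lambda>t. g t - proj k g t) \<omega>"
      using net_m[OF g] net_m[OF p] by (intro Z_le \<omega>)
    also have "\<dots> \<le> Y k \<omega> + V k \<omega>"
      unfolding Y_def V_def using g p by (intro add_mono SUP_upper)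
    finally show "Z g \<omega> \<le> Y k \<omega> + V k \<omega>" .
  qed
  have chain: "Y (n + m) \<omega> \<le> Y m \<omega> + (\<Sum>k<n. V (k + m) \<omega>)" if \<omega>: "\<omega> \<in> space P" for n \<omega>
  proof (induction n)
    case (Suc n)
    have "Y (Suc n + m) \<omega> \<le> Y (n + m) \<omega> + V (n + m) \<omega>" using step[OF \<omega>, of "n + m"] by simp
    also have "\<dots> \<le> (Y m \<omega> + (\<Sum>k<n. V (k + m) \<omega>)) + V (n + m) \<omega>"
      using Suc by (intro add_right_mono)
    finally show ?case by (simp add: add.assoc)
  qed simp
  have fin: "(\<integral>\<^sup>+\<omega>. (SUP g\<in>F. Z g \<omega>) \<partial>P) \<le> ennreal K * tail_bound B m" if F: "finite F" "F \<subseteq> ext" for F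
  proof (cases "F = {}")
    case True
    then show ?thesis by (simp add: bot_ennreal)
  next
    case False
    \<comment> \<open>The exponent 3 is an arbitrary admissible choice for the final link from
      \<open>F\<close> to \<open>net (n + m)\<close>: \<open>card F\<close> is fixed while
      \<open>\<delta> (n + m)\<close> tends to 0, so this cost disappears in the limit.\<close>
    let ?c = "real (card F) powr (1 / 3) * (K * \<Psi> 3)"
    have "(\<integral>\<^sup>+\<omega>. (SUP g\<in>F. Z g \<omega>) \<partial>P) \<le> ennreal K * tail_bound B m + ennreal (?c * \<delta> (n + m))" for n
    proof -
      define U where "U \<omega> = (SUP g\<in>F. Z (\<lambda>t. g t - proj (n + m) g t) \<omega>)" for \<omega>
      have [measurable]: "U \<in> borel_measurable P"
        unfolding U_def[abs_def] using F ext_m net_m proj(1)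
        by (intro borel_measurable_SUP Z_meas borel_measurable_diff countable_finite) blast+
      have pw: "(SUP g\<in>F. Z g \<omega>) \<le> Y m \<omega> + (\<Sum>k<n. V (k + m) \<omega>) + U \<omega>" if \<omega>: "\<omega> \<in> space P" for \<omega>
      proof (rule SUP_least)
        fix g assume g: "g \<in> F"
        then have ge: "g \<in> ext" using F by auto
        have p: "proj (n + m) g \<in> net (n + m)" using ge by (rule proj)
        have "Z g \<omega> \<le> Z (proj (n + m) g) \<omega> + Z (\<lambda>t. g t - proj (n + m) g t) \<omega>"
          using ext_m[OF ge] net_m[OF p] by (intro Z_le \<omega>)
        also have "\<dots> \<le> Y (n + m) \<omega> + U \<omega>"
          unfolding Y_def U_def using g p by (intro add_mono SUP_upper)
        also have "\<dots> \<le> Y m \<omega> + (\<Sum>k<n. V (k + m) \<omega>) + U \<omega>"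
          by (intro add_right_mono chain \<omega>)
        finally show "Z g \<omega> \<le> Y m \<omega> + (\<Sum>k<n. V (k + m) \<omega>) + U \<omega>" .
      qed
      have "(\<integral>\<^sup>+\<omega>. (SUP g\<in>F. Z g \<omega>) \<partial>P) \<le> (\<integral>\<^sup>+\<omega>. Y m \<omega> + (\<Sum>k<n. V (k + m) \<omega>) + U \<omega> \<partial>P)"
        using pw by (intro nn_integral_mono)
      also have "\<dots> = (\<integral>\<^sup>+\<omega>. Y m \<omega> \<partial>P) + (\<Sum>k<n. \<integral>\<^sup>+\<omega>. V (k + m) \<omega> \<partial>P) + (\<integral>\<^sup>+\<omega>. U \<omega> \<partial>P)"
        by (simp add: nn_integral_add nn_integral_sum)
      also have "\<dots> \<le> ennreal K * (ennreal (C m) * (SUP g\<in>net m. \<integral>\<^sup>+t. ennreal (\<bar>g t\<bar> * indicator B t) \<partial>\<mu>))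
          + ennreal K * (\<Sum>k. ennreal (\<delta> (k + m) * C (Suc (k + m)))) + ennreal (?c * \<delta> (n + m))"
      proof (intro add_mono EY)
        have "(\<Sum>k<n. \<integral>\<^sup>+\<omega>. V (k + m) \<omega> \<partial>P) \<le> (\<Sum>k<n. ennreal K * ennreal (\<delta> (k + m) * C (Suc (k + m))))"
          by (intro sum_mono EV)
        also have "\<dots> = ennreal K * (\<Sum>k<n. ennreal (\<delta> (k + m) * C (Suc (k + m))))"
          by (simp only: sum_distrib_left)
        also have "\<dots> \<le> ennreal K * (\<Sum>k. ennreal (\<delta> (k + m) * C (Suc (k + m))))"
          by (intro mult_left_mono sum_le_suminf) auto
        finally show "(\<Sum>k<n. \<integral>\<^sup>+\<omega>. V (k + m) \<omega> \<partial>P) \<le> ennreal K * (\<Sum>k. ennreal (\<delta> (k + m) * C (Suc (k + m))))" .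
        have "(\<integral>\<^sup>+\<omega>. U \<omega> \<partial>P) \<le> ennreal ?c * ennreal (\<delta> (n + m))"
          unfolding U_def
        proof (rule max[OF F(1) False])
          fix g assume "g \<in> F"
          then have g: "g \<in> ext" using F by auto
          show "(\<lambda>t. g t - proj (n + m) g t) \<in> borel_measurable \<mu>"
            using ext_m[OF g] net_m[OF proj(1)[OF g]] by (rule borel_measurable_diff)
          show "(\<integral>\<^sup>+t. ennreal \<bar>(g t - proj (n + m) g t) * indicator B t\<bar> \<partial>\<mu>) \<le> ennreal (\<delta> (n + m))"
            using g by (rule dist)
        qed simp
        then show "(\<integral>\<^sup>+\<omega>. U \<omega> \<partial>P) \<le> ennreal (?c * \<delta> (n + m))"
          using K \<delta>_nonneg \<Psi>_pos[of 3] by (simp add: ennreal_mult)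
      qed
      finally show ?thesis by (simp add: tail_bound_def distrib_left)
    qed
    moreover have "(\<lambda>n. ennreal K * tail_bound B m + ennreal (?c * \<delta> (n + m))) \<longlonglongrightarrow> ennreal K * tail_bound B m + ennreal (?c * 0)"
      using LIMSEQ_ignore_initial_segment[OF \<delta>_tendsto, of m]
      by (intro tendsto_add tendsto_const tendsto_ennrealI tendsto_mult)
    ultimately show ?thesis
      by (intro LIMSEQ_le_const[where X="\<lambda>n. ennreal K * tail_bound B m + ennreal (?c * \<delta> (n + m))"]) auto
  qed
  have ne: "norming_set \<noteq> {}" using norming_set(3)[OF fspace_zero, of 1] by auto
  \<comment> \<open>The bound for finite subsets does not depend on their size, so monotone
    convergence along an enumeration carries it to the whole norming set.\<close>
  define e where "e = from_nat_into norming_set"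
  have e: "range e = norming_set" unfolding e_def using ne norming_set(1) by (rule range_from_nat_into)
  have e_ext: "e i \<in> ext" for i using e norming_set(2) by blast
  have "(\<integral>\<^sup>+\<omega>. fs_norm N (\<lambda>t. X t \<omega> * indicator B t) \<partial>P) \<le> (\<integral>\<^sup>+\<omega>. (SUP n. SUP g\<in>e ` {..n}. Z g \<omega>) \<partial>P)"
  proof (rule nn_integral_mono)
    fix \<omega> assume \<omega>: "\<omega> \<in> space P"
    note measurable_field_section(1)[OF X \<omega>, measurable]
    have "fs_norm N (\<lambda>t. X t \<omega> * indicator B t)
        \<le> (SUP g\<in>norming_set. \<integral>\<^sup>+t. ennreal (\<bar>X t \<omega> * indicator B t\<bar> * \<bar>g t\<bar>) \<partial>\<mu>)"
      by (rule fs_norm_le_SUP) measurable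
    also have "\<dots> = (SUP g\<in>norming_set. Z g \<omega>)"
      by (simp add: Z_def abs_mult ac_simps)
    also have "\<dots> \<le> (SUP n. SUP g\<in>e ` {..n}. Z g \<omega>)"
    proof (rule SUP_least)
      fix g assume "g \<in> norming_set"
      then obtain n where "g = e n" using e by auto
      then show "Z g \<omega> \<le> (SUP n. SUP g\<in>e ` {..n}. Z g \<omega>)"
        by (intro SUP_upper2[of n] SUP_upper) auto
    qed
    finally show "fs_norm N (\<lambda>t. X t \<omega> * indicator B t) \<le> (SUP n. SUP g\<in>e ` {..n}. Z g \<omega>)" .
  qed
  also have "\<dots> = (SUP n. \<integral>\<^sup>+\<omega>. (SUP g\<in>e ` {..n}. Z g \<omega>) \<partial>P)"
  proof (rule nn_integral_monotone_convergence_SUP)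
    show "incseq (\<lambda>n \<omega>. SUP g\<in>e ` {..n}. Z g \<omega>)"
      by (auto simp: incseq_def le_fun_def intro!: SUP_subset_mono)
    show "(\<lambda>\<omega>. SUP g\<in>e ` {..n}. Z g \<omega>) \<in> borel_measurable P" for n
      using e_ext ext_m by (intro borel_measurable_SUP Z_meas countable_finite) auto
  qed
  also have "\<dots> \<le> ennreal K * tail_bound B m"
    using e_ext by (intro SUP_least fin) auto
  finally show ?thesis .
qed

end

subsection \<open>Total boundedness and atoms\<close>

text \<open>An atom of finite measure or a null set. Admitting null sets makes the notion stable
  under measurable subsets, so that a countable cover can be made disjoint.\<close>

definition indecomposable :: "'t measure \<Rightarrow> 't set \<Rightarrow> bool" where
  "indecomposable M A \<longleftrightarrow> A \<in> sets M \<and> emeasure M A < \<infinity> \<and>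
    (\<forall>E\<in>sets M. E \<subseteq> A \<longrightarrow> emeasure M E = 0 \<or> emeasure M (A - E) = 0)"

lemma indecomposable_empty: "indecomposable M {}"
  by (auto simp: indecomposable_def)

lemma indecomposable_subset:
  assumes A: "indecomposable M A" and B: "B \<in> sets M" "B \<subseteq> A"
  shows "indecomposable M B"
  unfolding indecomposable_def
proof (intro conjI ballI impI)
  have As: "A \<in> sets M" using A by (simp add: indecomposable_def)
  show "emeasure M B < \<infinity>"
    using A B As by (auto simp: indecomposable_def intro: le_less_trans[OF emeasure_mono])
  fix E assume E: "E \<in> sets M" "E \<subseteq> B"
  then have "emeasure M E = 0 \<or> emeasure M (A - E) = 0"
    using A B unfolding indecomposable_def by blast
  moreover have "emeasure M (B - E) \<le> emeasure M (A - E)"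
    using B E As by (intro emeasure_mono) auto
  ultimately show "emeasure M E = 0 \<or> emeasure M (B - E) = 0" by auto
qed (use B in auto)

context finite_measure
begin

lemma indecomposable_iff_measure:
  "indecomposable M A \<longleftrightarrow> A \<in> sets M \<and>
    (\<forall>E\<in>sets M. E \<subseteq> A \<longrightarrow> measure M E = 0 \<or> measure M (A - E) = 0)"
  by (auto simp: indecomposable_def emeasure_eq_measure less_top[symmetric])

text \<open>
  If every subset of \<open>D\<close> is small or has a small complement, the sets with small complement
  are closed under countable intersections, and one of minimal measure is indecomposable.
\<close>

lemma indecomposable_core:
  assumes D: "D \<in> sets M"
    and dich: "\<And>E. E \<in> sets M \<Longrightarrow> E \<subseteq> D \<Longrightarrow> measure M E \<le> s \<or> measure M (D - E) \<le> s"
  obtains A where "indecomposable M A" "A \<subseteq> D" "measure M (D - A) \<le> 3 * s"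
proof (cases "measure M D \<le> 3 * s")
  case True
  then show ?thesis using that[of "{}"] by (simp add: indecomposable_empty)
next
  case False
  define big where "big = {E \<in> sets M. E \<subseteq> D \<and> measure M (D - E) \<le> s}"
  have "measure M {} \<le> s \<or> measure M (D - {}) \<le> s" by (rule dich) auto
  then have s0: "0 \<le> s" using False measure_nonneg[of M D] by auto
  have compl: "measure M (D - E) = measure M D - measure M E" if "E \<in> sets M" "E \<subseteq> D" for E
    using D that by (intro finite_measure_Diff) auto
  \<comment> \<open>A self-improvement: if the complement has measure at most \<open>2 * s\<close>,
    then \<open>E\<close> has measure above \<open>s\<close> because \<open>D\<close> exceeds
    \<open>3 * s\<close>, and the dichotomy lowers the complement to \<open>s\<close>. This makes
    \<open>big\<close> stable under intersection.\<close>
  have bigI: "E \<in> big" if E: "E \<in> sets M" "E \<subseteq> D" and m: "measure M (D - E) \<le> 2 * s" for E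
    using dich[OF E] compl[OF E] m False E by (auto simp: big_def)
  have D_big: "D \<in> big" using D s0 by (simp add: big_def)
  have Int_big: "E1 \<inter> E2 \<in> big" if "E1 \<in> big" "E2 \<in> big" for E1 E2
  proof (rule bigI)
    have "D - E1 \<inter> E2 = (D - E1) \<union> (D - E2)" by auto
    then have "measure M (D - E1 \<inter> E2) \<le> measure M (D - E1) + measure M (D - E2)"
      using that D by (auto simp: big_def intro!: measure_subadditive)
    then show "measure M (D - E1 \<inter> E2) \<le> 2 * s" using that by (auto simp: big_def)
  qed (use that in \<open>auto simp: big_def\<close>)
  define m where "m = Inf (measure M ` big)"
  have bdd: "bdd_below (measure M ` big)" by (intro bdd_belowI[of _ 0]) auto
  have m_le: "m \<le> measure M E" if "E \<in> big" for E
    unfolding m_def using that bdd by (intro cInf_lower) auto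
  have "\<exists>E\<in>big. measure M E < m + 1 / real (Suc n)" for n
    using cInf_lessD[of "measure M ` big" "m + 1 / real (Suc n)"] D_big by (auto simp: m_def)
  then obtain E where E: "\<And>n. E n \<in> big" "\<And>n. measure M (E n) < m + 1 / real (Suc n)"
    by metis
  define F where "F n = (\<Inter>i\<le>n. E i)" for n
  have F_big: "F n \<in> big" for n
  proof (induction n)
    case (Suc n)
    have "F (Suc n) = F n \<inter> E (Suc n)" by (auto simp: F_def atMost_Suc)
    then show ?case using Suc E by (simp add: Int_big)
  qed (use E in \<open>simp add: F_def\<close>)
  define A where "A = (\<Inter>n. F n)"
  have F_sets: "F n \<in> sets M" "F n \<subseteq> D" for n using F_big[of n] by (auto simp: big_def)
  have A: "A \<in> sets M" "A \<subseteq> D" using F_sets(1) F_sets(2)[of 0] by (auto simp: A_def)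
  have "decseq F" by (force simp: decseq_def F_def)
  then have lim: "(\<lambda>n. measure M (F n)) \<longlonglongrightarrow> measure M A"
    unfolding A_def using F_sets by (intro finite_Lim_measure_decseq) auto
  have "measure M (F n) \<le> m + 1 / real (Suc n)" for n
  proof -
    have "measure M (F n) \<le> measure M (E n)"
      using E(1)[of n] by (intro finite_measure_mono) (auto simp: F_def big_def)
    with E(2)[of n] show ?thesis by simp
  qed
  moreover have "(\<lambda>n. m + 1 / real (Suc n)) \<longlonglongrightarrow> m + 0"
    by (intro tendsto_add tendsto_const LIMSEQ_Suc lim_1_over_n)
  ultimately have A_m: "measure M A \<le> m" using LIMSEQ_le[OF lim] by auto
  have "measure M D - measure M (F n) \<le> s" for n
    using F_big[of n] compl[OF F_sets] by (auto simp: big_def)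
  then have "measure M D - measure M A \<le> s"
    by (intro LIMSEQ_le_const2[OF tendsto_diff[OF tendsto_const lim]]) auto
  then have A_big: "A \<in> big" using A compl[OF A] by (simp add: big_def)
  have "indecomposable M A"
    unfolding indecomposable_iff_measure
  proof (intro conjI A ballI impI)
    fix H assume H: "H \<in> sets M" "H \<subseteq> A"
    have HD: "H \<subseteq> D" using H A by auto
    have AH: "measure M (A - H) = measure M A - measure M H"
      using A H by (intro finite_measure_Diff) auto
    from dich[OF H(1) HD] show "measure M H = 0 \<or> measure M (A - H) = 0"
    proof
      assume "measure M (D - H) \<le> s"
      then have "m \<le> measure M H" using H HD by (intro m_le) (simp add: big_def)
      then have "measure M (A - H) \<le> 0" using AH A_m by simp
      then show ?thesis using measure_nonneg[of M "A - H"] by linarith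
    next
      \<comment> \<open>Removing the small set \<open>H\<close> from \<open>A\<close> leaves a
        complement of at most \<open>2 * s\<close> in \<open>D\<close>, so \<open>A - H\<close> is
        again big, and minimality of \<open>A\<close> forces \<open>H\<close> to be null.\<close>
      assume hs: "measure M H \<le> s"
      have "D - (A - H) = (D - A) \<union> H" using HD by auto
      then have "measure M (D - (A - H)) \<le> measure M (D - A) + measure M H"
        using D A H by (auto intro!: measure_subadditive)
      then have "A - H \<in> big"
        using hs A_big A H by (intro bigI) (auto simp: big_def)
      then have "m \<le> measure M (A - H)" by (rule m_le)
      then have "measure M H \<le> 0" using AH A_m by simp
      then show ?thesis using measure_nonneg[of M H] by linarith
    qed
  qed
  then show ?thesis using that[of A] A_big s0 by (auto simp: big_def)
qed

text \<open>
  The sets in \<open>\<C>\<close> generate finitely many cells. A set splitting every cell \<open>D K\<close> as evenly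
  as possible is far from each \<open>C \<in> \<C>\<close> unless the cells are almost indecomposable.
\<close>

lemma indecomposable_cover:
  assumes \<C>: "finite \<C>" "\<C> \<subseteq> sets M"
    and net: "\<And>E. E \<in> sets M \<Longrightarrow> \<exists>C\<in>\<C>. measure M ((E - C) \<union> (C - E)) \<le> e"
  obtains \<A> where "finite \<A>" "\<And>A. A \<in> \<A> \<Longrightarrow> indecomposable M A"
    "measure M (space M - \<Union>\<A>) \<le> 6 * e"
proof -
  define D where "D K = {t \<in> space M. \<forall>C\<in>\<C>. t \<in> C \<longleftrightarrow> C \<in> K}" for K
  let ?I = "Pow \<C>"
  have fI: "finite ?I" using \<C> by simp
  have D [measurable]: "D K \<in> sets M" for K
  proof -
    have "D K = (\<Inter>C\<in>\<C>. if C \<in> K then C else space M - C) \<inter> space M"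
      by (auto simp: D_def split: if_splits)
    moreover have "\<dots> \<in> sets M"
    proof (cases "\<C> = {}")
      case False
      then show ?thesis using \<C> by (intro sets.Int sets.finite_INT) auto
    qed simp
    ultimately show ?thesis by simp
  qed
  have D_disj: "disjoint_family_on D ?I"
    unfolding disjoint_family_on_def
  proof (intro ballI impI)
    fix K L assume "K \<in> ?I" "L \<in> ?I" "K \<noteq> L"
    then obtain C where "C \<in> \<C>" "(C \<in> K) \<noteq> (C \<in> L)" by blast
    then show "D K \<inter> D L = {}" by (auto simp: D_def)
  qed
  have D_Un: "(\<Union>K\<in>?I. D K) = space M"
  proof (intro set_eqI iffI)
    fix t assume "t \<in> space M"
    then have "t \<in> D {C \<in> \<C>. t \<in> C}" by (auto simp: D_def)
    then show "t \<in> (\<Union>K\<in>?I. D K)" by (intro UN_I[of "{C \<in> \<C>. t \<in> C}"]) auto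
  qed (auto simp: D_def)
  define r where "r K E = min (measure M E) (measure M (D K - E))" for K E
  define s where "s K = Sup (r K ` {E \<in> sets M. E \<subseteq> D K})" for K
  have bdd: "bdd_above (r K ` {E \<in> sets M. E \<subseteq> D K})" for K
    by (intro bdd_aboveI[of _ "measure M (space M)"]) (auto simp: r_def min.coboundedI1 bounded_measure)
  have r_le: "r K E \<le> s K" if "E \<in> sets M" "E \<subseteq> D K" for K E
    unfolding s_def using that bdd by (intro cSup_upper) auto
  \<comment> \<open>The supremum \<open>s K\<close> need not be attained, so half of it is taken.
    This factor 2 and the factor 3 of \<open>indecomposable_core\<close> give the 6 of the
    conclusion.\<close>
  have "\<exists>E. E \<in> sets M \<and> E \<subseteq> D K \<and> s K \<le> 2 * r K E" for K
  proof (cases "s K \<le> 0")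
    case True
    then show ?thesis by (intro exI[of _ "{}"]) (simp add: r_def)
  next
    case False
    then have "s K / 2 < s K" by simp
    then obtain x where "x \<in> r K ` {E \<in> sets M. E \<subseteq> D K}" "s K / 2 < x"
      unfolding s_def using less_cSupD[of "r K ` {E \<in> sets M. E \<subseteq> D K}"] by blast
    then show ?thesis by force
  qed
  then obtain E where E: "\<And>K. E K \<in> sets M" "\<And>K. E K \<subseteq> D K" "\<And>K. s K \<le> 2 * r K (E K)"
    by metis
  note E(1)[measurable]
  define U where "U = (\<Union>K\<in>?I. E K)"
  have U: "U \<in> sets M" unfolding U_def using fI by (intro sets.finite_UN) auto
  obtain C where C: "C \<in> \<C>" "measure M ((U - C) \<union> (C - U)) \<le> e" using net[OF U] by auto
  have Cs: "C \<in> sets M" using C \<C> by auto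
  let ?S = "(U - C) \<union> (C - U)"
  have S: "?S \<in> sets M" using U Cs by auto
  have UD: "U \<inter> D K = E K" if "K \<in> ?I" for K
  proof -
    have "t \<in> E K" if "t \<in> E L" "t \<in> D K" "L \<in> ?I" for t L
      using that E(2)[of L] D_disj \<open>K \<in> ?I\<close> unfolding disjoint_family_on_def by (cases "L = K") blast+
    then show ?thesis using that E(2)[of K] by (auto simp: U_def)
  qed
  \<comment> \<open>Within a cell the set \<open>C\<close> is everything or nothing, whereas
    \<open>U\<close> is \<open>E K\<close> there. The symmetric difference thus contains either
    \<open>E K\<close> or its complement in the cell, and both have measure at least
    \<open>r K (E K)\<close>.\<close>
  have r_S: "r K (E K) \<le> measure M (?S \<inter> D K)" if K: "K \<in> ?I" for K
  proof (cases "C \<in> K")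
    case True
    then have "D K - E K \<subseteq> ?S \<inter> D K" using C UD[OF K] by (auto simp: D_def)
    then have "measure M (D K - E K) \<le> measure M (?S \<inter> D K)" using S by (intro finite_measure_mono) auto
    then show ?thesis by (simp add: r_def)
  next
    case False
    then have "E K \<subseteq> ?S \<inter> D K" using C UD[OF K] E(2)[of K] by (auto simp: D_def)
    then have "measure M (E K) \<le> measure M (?S \<inter> D K)" using S by (intro finite_measure_mono) auto
    then show ?thesis by (simp add: r_def)
  qed
  have "(\<Sum>K\<in>?I. r K (E K)) \<le> (\<Sum>K\<in>?I. measure M (?S \<inter> D K))"
    using r_S by (rule sum_mono)
  also have "\<dots> = measure M (\<Union>K\<in>?I. ?S \<inter> D K)"
    using fI S D_disj
    by (intro finite_measure_finite_Union[symmetric]) (auto simp: disjoint_family_on_def)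
  also have "\<dots> \<le> measure M ?S"
    using S by (intro finite_measure_mono) auto
  finally have sum_r: "(\<Sum>K\<in>?I. r K (E K)) \<le> e" using C by simp
  have "\<exists>A. indecomposable M A \<and> A \<subseteq> D K \<and> measure M (D K - A) \<le> 3 * s K" for K
  proof -
    have "measure M H \<le> s K \<or> measure M (D K - H) \<le> s K" if "H \<in> sets M" "H \<subseteq> D K" for H
      using r_le[OF that] by (auto simp: r_def min_def split: if_splits)
    then show ?thesis using indecomposable_core[OF D[of K], of "s K"] by blast
  qed
  then obtain A where A: "\<And>K. indecomposable M (A K)" "\<And>K. A K \<subseteq> D K"
    "\<And>K. measure M (D K - A K) \<le> 3 * s K"
    by metis
  have As: "A K \<in> sets M" for K using A(1) by (simp add: indecomposable_def)
  show ?thesis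
  proof (rule that[of "A ` ?I"])
    have "measure M (space M - \<Union>(A ` ?I)) \<le> measure M (\<Union>K\<in>?I. D K - A K)"
    proof (intro finite_measure_mono sets.finite_UN fI)
      show "space M - \<Union>(A ` ?I) \<subseteq> (\<Union>K\<in>?I. D K - A K)"
        unfolding D_Un[symmetric] by blast
    qed (use As in auto)
    also have "\<dots> \<le> (\<Sum>K\<in>?I. measure M (D K - A K))"
      using fI As by (intro finite_measure_subadditive_finite) auto
    also have "\<dots> \<le> (\<Sum>K\<in>?I. 6 * r K (E K))"
    proof (rule sum_mono)
      show "measure M (D K - A K) \<le> 6 * r K (E K)" for K using A(3)[of K] E(3)[of K] by linarith
    qed
    also have "\<dots> = 6 * (\<Sum>K\<in>?I. r K (E K))" by (simp add: sum_distrib_left)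
    finally show "measure M (space M - \<Union>(A ` ?I)) \<le> 6 * e" using sum_r by simp
  qed (use fI A(1) in auto)
qed

end

text \<open>With \<open>c\<close> the mean of \<open>f\<close> over \<open>A\<close>, one of the
  sets \<open>f > c\<close> and \<open>f \<le> c\<close> is null in \<open>A\<close>. So
  \<open>f - c\<close> has a constant sign on \<open>A\<close> and integral 0, and vanishes almost
  everywhere.\<close>

lemma AE_const_on_indecomposable:
  fixes f :: "'t \<Rightarrow> real"
  assumes A: "indecomposable M A" and [measurable]: "f \<in> borel_measurable M"
    and pos: "measure M A > 0" and bd: "\<And>t. \<bar>f t\<bar> \<le> b"
  shows "AE t in M. t \<in> A \<longrightarrow> f t = (\<integral>t. f t * indicator A t \<partial>M) / measure M A"
proof -
  define c where "c = (\<integral>t. f t * indicator A t \<partial>M) / measure M A"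
  have As [measurable]: "A \<in> sets M" and Af: "emeasure M A < \<infinity>" using A by (auto simp: indecomposable_def)
  have i1: "integrable M (\<lambda>t. c * indicator A t)" for c :: real using As Af by simp
  have i2: "integrable M (\<lambda>t. f t * indicator A t)"
  proof (rule Bochner_Integration.integrable_bound[OF i1[of b]])
    show "AE t in M. norm (f t * indicator A t) \<le> norm (b * indicator A t)"
      by (intro AE_I2) (auto intro: order_trans[OF bd abs_ge_self] split: split_indicator)
  qed measurable
  have z: "(\<integral>t. f t * indicator A t - c * indicator A t \<partial>M) = 0"
    using i1 i2 pos As by (simp add: c_def)
  define E where "E = {t \<in> space M. t \<in> A \<and> f t > c}"
  have E [measurable]: "E \<in> sets M" "E \<subseteq> A" unfolding E_def by auto
  have "emeasure M E = 0 \<or> emeasure M (A - E) = 0"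
    using A E unfolding indecomposable_def by blast
  then have "AE t in M. f t * indicator A t - c * indicator A t = 0"
  proof
    assume "emeasure M E = 0"
    then have "AE t in M. t \<notin> E" using E by (intro AE_not_in) auto
    then have "AE t in M. 0 \<le> c * indicator A t - f t * indicator A t"
      by (rule AE_mp) (auto simp: E_def split: split_indicator intro!: AE_I2)
    moreover have "(\<integral>t. c * indicator A t - f t * indicator A t \<partial>M) = 0"
      using z i1 i2 by simp
    ultimately have "AE t in M. c * indicator A t - f t * indicator A t = 0"
      using integral_nonneg_eq_0_iff_AE[of M "\<lambda>t. c * indicator A t - f t * indicator A t"] i1 i2 by auto
    then show ?thesis by (rule AE_mp) (auto intro!: AE_I2)
  next
    assume "emeasure M (A - E) = 0"
    then have "AE t in M. t \<notin> A - E" using E by (intro AE_not_in) auto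
    then have "AE t in M. 0 \<le> f t * indicator A t - c * indicator A t"
      by (rule AE_mp) (auto simp: E_def split: split_indicator intro!: AE_I2)
    then show ?thesis
      using integral_nonneg_eq_0_iff_AE[of M "\<lambda>t. f t * indicator A t - c * indicator A t"] i1 i2 z by auto
  qed
  then show ?thesis unfolding c_def[symmetric]
    by (rule AE_mp) (auto intro!: AE_I2 split: split_indicator)
qed

text \<open>Each path is almost everywhere constant on \<open>A\<close>, but with an exceptional set
  that depends on \<open>\<omega>\<close>. The constant is measurable in \<open>\<omega>\<close>, so
  Fubini exchanges the quantifiers, and almost every fixed \<open>s\<close> in \<open>A\<close>
  carries it for almost all \<open>\<omega>\<close>. The injective function \<open>arctan\<close>
  makes the paths bounded, hence the mean over \<open>A\<close> available.\<close>

lemma AE_section_const_on_indecomposable: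
  assumes \<mu>: "sigma_finite_measure \<mu>" and P: "sigma_finite_measure P"
    and A: "indecomposable \<mu> A" and X: "measurable_field \<mu> P X"
  shows "AE s in \<mu>. s \<in> A \<longrightarrow> (AE \<omega> in P. AE t in \<mu>. t \<in> A \<longrightarrow> X t \<omega> = X s \<omega>)"
proof (cases "measure \<mu> A > 0")
  case False
  then have "emeasure \<mu> A = 0"
  proof -
    have "emeasure \<mu> A = ennreal (measure \<mu> A)"
      using A by (intro emeasure_eq_ennreal_measure) (auto simp: indecomposable_def)
    moreover have "measure \<mu> A = 0" using False measure_nonneg[of \<mu> A] by linarith
    ultimately show ?thesis by simp
  qed
  then have "AE s in \<mu>. s \<notin> A" using A by (intro AE_not_in) (auto simp: indecomposable_def)
  then show ?thesis by (rule AE_mp) (auto intro!: AE_I2)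
next
  case True
  interpret \<mu>: sigma_finite_measure \<mu> by fact
  interpret P: sigma_finite_measure P by fact
  interpret mp: pair_sigma_finite \<mu> P ..
  have [measurable]: "A \<in> sets \<mu>" using A by (simp add: indecomposable_def)
  have Xm [measurable]: "(\<lambda>z. X (fst z) (snd z)) \<in> borel_measurable (\<mu> \<Otimes>\<^sub>M P)"
    using X by (simp add: measurable_field_def split_beta')
  have Xm' [measurable]: "(\<lambda>z. X (snd z) (fst z)) \<in> borel_measurable (P \<Otimes>\<^sub>M \<mu>)"
    using measurable_compose[OF measurable_pair_swap' X[unfolded measurable_field_def]]
    by (simp add: split_beta')
  define c where "c \<omega> = (\<integral>t. arctan (X t \<omega>) * indicator A t \<partial>\<mu>) / measure \<mu> A" for \<omega>
  have arctan_m [measurable]: "arctan \<in> borel_measurable borel"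
    by (intro borel_measurable_continuous_onI continuous_intros)
  have c [measurable]: "c \<in> borel_measurable P"
  proof -
    have "(\<lambda>(\<omega>, t). arctan (X t \<omega>) * indicator A t) \<in> borel_measurable (P \<Otimes>\<^sub>M \<mu>)"
      unfolding split_beta' by measurable
    then show ?thesis
      unfolding c_def by (intro borel_measurable_divide \<mu>.borel_measurable_lebesgue_integral) auto
  qed
  have sec: "AE t in \<mu>. t \<in> A \<longrightarrow> arctan (X t \<omega>) = c \<omega>" if \<omega>: "\<omega> \<in> space P" for \<omega>
    unfolding c_def
  proof (rule AE_const_on_indecomposable[OF A _ True])
    show "(\<lambda>t. arctan (X t \<omega>)) \<in> borel_measurable \<mu>"
      using measurable_compose[OF measurable_Pair2'[OF \<omega>] Xm] by simp
    show "\<bar>arctan (X t \<omega>)\<bar> \<le> pi / 2" for t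
      using arctan_bounded[of "X t \<omega>"] by auto
  qed
  have "AE t in \<mu>. AE \<omega> in P. t \<in> A \<longrightarrow> arctan (X t \<omega>) = c \<omega>"
  proof (subst mp.AE_commute)
    show "{x \<in> space (\<mu> \<Otimes>\<^sub>M P). fst x \<in> A \<longrightarrow> arctan (X (fst x) (snd x)) = c (snd x)} \<in> sets (\<mu> \<Otimes>\<^sub>M P)"
      by measurable
    show "AE y in P. AE x in \<mu>. x \<in> A \<longrightarrow> arctan (X x y) = c y"
      by (rule AE_I2) (rule sec)
  qed
  then show ?thesis
  proof eventually_elim
    case (elim s)
    show ?case
    proof
      assume s: "s \<in> A"
      from elim AE_space[of P] show "AE \<omega> in P. AE t in \<mu>. t \<in> A \<longrightarrow> X t \<omega> = X s \<omega>"
      proof eventually_elim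
        case (elim \<omega>)
        from sec[OF elim(2)] show ?case
        proof eventually_elim
          case (elim t)
          show ?case
          proof
            assume "t \<in> A"
            then have "arctan (X t \<omega>) = arctan (X s \<omega>)"
              using elim s \<open>s \<in> A \<longrightarrow> arctan (X s \<omega>) = c \<omega>\<close> by simp
            then show "X t \<omega> = X s \<omega>" by (simp only: arctan_eq_iff)
          qed
        qed
      qed
    qed
  qed
qed

context normed_by_ext
begin

text \<open>Each \<open>E\<close> is encoded by the extremal point \<open>u * g\<close> with
  \<open>u = 1\<close> on \<open>E\<close> and \<open>-1\<close> off it. If \<open>c\<close> lies
  close to it, then \<open>E\<close> is close to the set where \<open>c t * g t > 0\<close>: at
  points of \<open>B\<close> in the symmetric difference, \<open>c\<close> differs from
  \<open>u * g\<close> by at least \<open>\<bar>g\<bar> \<ge> d\<close>. A finite net of extremal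
  points thus gives a finite net of sets.\<close>

lemma indecomposable_cover_level_set:
  fixes j :: nat
  assumes tb: "\<And>e. 0 < e \<Longrightarrow> \<exists>T. finite T \<and> T \<subseteq> ext \<and> (\<forall>g\<in>ext. \<exists>c\<in>T. L1_dist \<mu> c g \<le> ennreal e)"
    and g: "g \<in> ext" and d: "0 < d" and e: "0 < e"
  defines "B \<equiv> {t \<in> space \<mu>. t \<in> trunc_dom j \<and> d \<le> \<bar>g t\<bar>}"
  obtains \<A> where "finite \<A>" "\<And>A. A \<in> \<A> \<Longrightarrow> indecomposable \<mu> A"
    "emeasure \<mu> (B - \<Union>\<A>) \<le> ennreal e"
proof -
  have g_m [measurable]: "g \<in> borel_measurable \<mu>" using g by (rule ext_measurable)
  have td [measurable]: "trunc_dom j \<in> sets \<mu>" by (rule trunc_dom)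
  have B [measurable]: "B \<in> sets \<mu>" unfolding B_def by measurable
  have B_fin: "emeasure \<mu> B < \<infinity>"
    using trunc_dom(3)[of j] by (rule le_less_trans[rotated]) (intro emeasure_mono, auto simp: B_def)
  \<comment> \<open>Restricting \<open>\<mu>\<close> to \<open>B\<close> by a density keeps the
    space and its measurable sets and makes the measure finite. The value \<open>e / 6\<close> below
    compensates the factor 6 of \<open>indecomposable_cover\<close>.\<close>
  define \<nu> where "\<nu> = density \<mu> (indicator B)"
  have \<nu>: "emeasure \<nu> E = emeasure \<mu> (B \<inter> E)" if "E \<in> sets \<mu>" for E
    using that unfolding \<nu>_def by (subst emeasure_density) (auto simp: indicator_inter_arith[symmetric] nn_integral_indicator)
  have sets_\<nu> [simp, measurable_cong]: "sets \<nu> = sets \<mu>" "space \<nu> = space \<mu>" by (auto simp: \<nu>_def)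
  interpret \<nu>: finite_measure \<nu>
    using B_fin by (intro finite_measureI) (simp add: \<nu> less_top)
  define e' where "e' = e / 6"
  have e': "e' > 0" using e by (simp add: e'_def)
  obtain T where T: "finite T" "T \<subseteq> ext" "\<And>g. g \<in> ext \<Longrightarrow> \<exists>c\<in>T. L1_dist \<mu> c g \<le> ennreal (d * e')"
    using tb[of "d * e'"] d e' by auto
  define C where "C c = {t \<in> space \<mu>. t \<in> B \<and> 0 < c t * g t}" for c
  have C_m [measurable]: "C c \<in> sets \<mu>" if "c \<in> T" for c
  proof -
    have [measurable]: "c \<in> borel_measurable \<mu>" using that T(2) ext_measurable by blast
    show ?thesis unfolding C_def by measurable
  qed
  obtain \<A> where \<A>: "finite \<A>" "\<And>A. A \<in> \<A> \<Longrightarrow> indecomposable \<nu> A" "measure \<nu> (space \<nu> - \<Union>\<A>) \<le> 6 * e'"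
  proof (rule \<nu>.indecomposable_cover[of "C ` T" e'])
    fix E assume "E \<in> sets \<nu>"
    then have E [measurable]: "E \<in> sets \<mu>" by simp
    define u where "u t = (if t \<in> E then 1 else -1 :: real)" for t
    have u: "(\<lambda>t. u t * g t) \<in> ext"
      using g by (rule sign_mult_ext) (auto simp: u_def[abs_def])
    obtain c where c: "c \<in> T" "L1_dist \<mu> c (\<lambda>t. u t * g t) \<le> ennreal (d * e')" using T(3)[OF u] by auto
    have [measurable]: "c \<in> borel_measurable \<mu>" using c T(2) ext_measurable by blast
    note C_m[OF c(1), measurable]
    let ?S = "(E - C c) \<union> (C c - E)"
    have "ennreal d * emeasure \<mu> (B \<inter> ?S) = (\<integral>\<^sup>+t. ennreal d * indicator (B \<inter> ?S) t \<partial>\<mu>)"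
      by (simp add: nn_integral_cmult_indicator)
    also have "\<dots> \<le> L1_dist \<mu> c (\<lambda>t. u t * g t)"
      unfolding L1_dist_def
    proof (rule nn_integral_mono)
      fix t assume t: "t \<in> space \<mu>"
      have "d \<le> \<bar>c t - u t * g t\<bar>" if "t \<in> B \<inter> ?S"
      proof -
        have gt: "d \<le> \<bar>g t\<bar>" using that by (auto simp: B_def)
        show ?thesis
        proof (cases "t \<in> E")
          case True
          then have "c t * g t \<le> 0" using that t by (auto simp: C_def)
          then have "c t \<le> 0 \<and> 0 \<le> g t \<or> 0 \<le> c t \<and> g t \<le> 0" by (auto simp: mult_le_0_iff)
          then show ?thesis using gt True by (auto simp: u_def)
        next
          case False
          then have "0 < c t * g t" using that by (auto simp: C_def)
          then have "0 < c t \<and> 0 < g t \<or> c t < 0 \<and> g t < 0" by (auto simp: zero_less_mult_iff)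
          then show ?thesis using gt False by (auto simp: u_def)
        qed
      qed
      then show "ennreal d * indicator (B \<inter> ?S) t \<le> ennreal \<bar>c t - u t * g t\<bar>"
        by (auto split: split_indicator intro!: ennreal_leI)
    qed
    also have "\<dots> \<le> ennreal d * ennreal e'" using c(2) d e' by (simp add: ennreal_mult)
    finally have "ennreal d * emeasure \<nu> ?S \<le> ennreal d * ennreal e'" by (simp add: \<nu>)
    then have "emeasure \<nu> ?S \<le> ennreal e'"
      using d by (subst (asm) ennreal_mult_le_mult_iff) auto
    then have "measure \<nu> ?S \<le> e'"
      using e' by (simp add: \<nu>.emeasure_eq_measure)
    then show "\<exists>C\<in>C ` T. measure \<nu> ((E - C) \<union> (C - E)) \<le> e'" using c(1) by auto
  qed (use T C_m in auto)
  \<comment> \<open>The sets found are indecomposable for \<open>\<nu>\<close>, which ignores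
    everything outside \<open>B\<close>; intersected with \<open>B\<close> they are so for
    \<open>\<mu>\<close>.\<close>
  show ?thesis
  proof (rule that[of "(\<lambda>A. A \<inter> B) ` \<A>"])
    show "indecomposable \<mu> A" if A: "A \<in> (\<lambda>A. A \<inter> B) ` \<A>" for A
    proof -
      obtain A' where A': "A' \<in> \<A>" "A = A' \<inter> B" using A by auto
      have A's: "A' \<in> sets \<mu>" using \<A>(2)[OF A'(1)] by (simp add: indecomposable_def)
      show ?thesis unfolding indecomposable_def
      proof (intro conjI ballI impI)
        show "A \<in> sets \<mu>" using A's A' by simp
        show "emeasure \<mu> A < \<infinity>"
          using B_fin by (rule le_less_trans[rotated]) (intro emeasure_mono, auto simp: A')
        fix E assume E: "E \<in> sets \<mu>" "E \<subseteq> A"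
        then have "emeasure \<nu> E = 0 \<or> emeasure \<nu> (A' - E) = 0"
          using \<A>(2)[OF A'(1)] A'(2) by (auto simp: indecomposable_def)
        moreover have "B \<inter> E = E" "B \<inter> (A' - E) = A - E" using E A'(2) by auto
        ultimately show "emeasure \<mu> E = 0 \<or> emeasure \<mu> (A - E) = 0"
          using E A's by (simp add: \<nu>)
      qed
    qed
    have As: "\<Union>\<A> \<in> sets \<mu>"
      using \<A> by (intro sets.finite_Union) (auto simp: indecomposable_def)
    have "B - \<Union>((\<lambda>A. A \<inter> B) ` \<A>) = B \<inter> (space \<nu> - \<Union>\<A>)"
      using sets.sets_into_space[OF B] by auto
    then have "emeasure \<mu> (B - \<Union>((\<lambda>A. A \<inter> B) ` \<A>)) = emeasure \<nu> (space \<nu> - \<Union>\<A>)"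
      using As by (simp add: \<nu>)
    also have "\<dots> \<le> ennreal e"
      using \<A>(3) by (simp add: \<nu>.emeasure_eq_measure e'_def ennreal_leI)
    finally show "emeasure \<mu> (B - \<Union>((\<lambda>A. A \<inter> B) ` \<A>)) \<le> ennreal e" .
  qed (use \<A> in auto)
qed

text \<open>The level sets \<open>B g j n\<close> for \<open>g\<close> in the countable norming set
  exhaust the space up to the common zeros of the norming functions, and those form a null set.
  Letting the precision \<open>1 / Suc l\<close> vary covers each level set up to a null set by
  countably many indecomposable sets.\<close>

lemma purely_atomic:
  assumes tb: "\<And>e. 0 < e \<Longrightarrow> \<exists>T. finite T \<and> T \<subseteq> ext \<and> (\<forall>g\<in>ext. \<exists>c\<in>T. L1_dist \<mu> c g \<le> ennreal e)"
  obtains A :: "nat \<Rightarrow> 't set" where "disjoint_family A" "\<And>i. indecomposable \<mu> (A i)"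
    "AE t in \<mu>. t \<in> (\<Union>i. A i)"
proof -
  define B where "B g j n = {t \<in> space \<mu>. t \<in> trunc_dom j \<and> 1 / real (Suc n) \<le> \<bar>g t\<bar>}" for g :: "'t \<Rightarrow> real" and j n
  have "\<exists>\<A>. finite \<A> \<and> (\<forall>A\<in>\<A>. indecomposable \<mu> A) \<and> emeasure \<mu> (B g j n - \<Union>\<A>) \<le> ennreal (1 / real (Suc l))"
    if g: "g \<in> ext" for g j n l
  proof -
    obtain \<A> where "finite \<A>" "\<And>A. A \<in> \<A> \<Longrightarrow> indecomposable \<mu> A"
      "emeasure \<mu> ({t \<in> space \<mu>. t \<in> trunc_dom j \<and> 1 / real (Suc n) \<le> \<bar>g t\<bar>} - \<Union>\<A>) \<le> ennreal (1 / real (Suc l))"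
      by (rule indecomposable_cover_level_set[OF tb g, of "1 / real (Suc n)" "1 / real (Suc l)" j]) auto
    then show ?thesis unfolding B_def by blast
  qed
  then obtain \<A> where \<A>: "\<And>g j n l. g \<in> ext \<Longrightarrow> finite (\<A> g j n l)"
    "\<And>g j n l A. g \<in> ext \<Longrightarrow> A \<in> \<A> g j n l \<Longrightarrow> indecomposable \<mu> A"
    "\<And>g j n l. g \<in> ext \<Longrightarrow> emeasure \<mu> (B g j n - \<Union>(\<A> g j n l)) \<le> ennreal (1 / real (Suc l))"
    by metis
  define \<F> where "\<F> = insert {} (\<Union>g\<in>norming_set. \<Union>j. \<Union>n. \<Union>l. \<A> g j n l)"
  have \<F>_ind: "indecomposable \<mu> A" if "A \<in> \<F>" for A
    using that \<A>(2) norming_set(2) by (auto simp: \<F>_def indecomposable_empty)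
  have \<F>_countable: "countable \<F>"
    unfolding \<F>_def
  proof (intro countable_insert countable_UN norming_set(1))
    show "countable (\<A> g j n l)" if "g \<in> norming_set" for g j n l
      using that norming_set(2) by (intro countable_finite \<A>(1)) auto
  qed auto
  have \<F>_sets: "\<F> \<subseteq> sets \<mu>" using \<F>_ind by (auto simp: indecomposable_def)
  have UF [measurable]: "\<Union>\<F> \<in> sets \<mu>" using \<F>_countable \<F>_sets by (rule sets.countable_Union)
  have Bm [measurable]: "B g j n \<in> sets \<mu>" if "g \<in> ext" for g j n
  proof -
    have [measurable]: "g \<in> borel_measurable \<mu>" "trunc_dom j \<in> sets \<mu>"
      using that ext_measurable trunc_dom by auto
    show ?thesis unfolding B_def by measurable
  qed
  have B_AE: "AE t in \<mu>. t \<notin> B g j n - \<Union>\<F>" if g: "g \<in> norming_set" for g j n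
  proof (rule AE_not_in)
    have ge: "g \<in> ext" using g norming_set by auto
    have "emeasure \<mu> (B g j n - \<Union>\<F>) \<le> 0"
    proof (rule LIMSEQ_le_const)
      show "(\<lambda>l. ennreal (1 / real (Suc l))) \<longlonglongrightarrow> 0"
        using tendsto_ennrealI[OF LIMSEQ_Suc[OF lim_1_over_n]] by simp
      have "emeasure \<mu> (B g j n - \<Union>\<F>) \<le> ennreal (1 / real (Suc l))" for l
      proof -
        have "\<Union>(\<A> g j n l) \<in> sets \<mu>"
          using \<A>(1,2)[OF ge] by (intro sets.finite_Union) (auto simp: indecomposable_def)
        then have "emeasure \<mu> (B g j n - \<Union>\<F>) \<le> emeasure \<mu> (B g j n - \<Union>(\<A> g j n l))"
          using g Bm[OF ge] by (intro emeasure_mono) (auto simp: \<F>_def)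
        also have "\<dots> \<le> ennreal (1 / real (Suc l))" by (rule \<A>(3)[OF ge])
        finally show ?thesis .
      qed
      then show "\<exists>M. \<forall>l\<ge>M. emeasure \<mu> (B g j n - \<Union>\<F>) \<le> ennreal (1 / real (Suc l))" by blast
    qed
    then show "B g j n - \<Union>\<F> \<in> null_sets \<mu>" using Bm[OF ge] UF by (auto simp: null_sets_def)
  qed
  \<comment> \<open>All norming functions vanish on \<open>Z j\<close>, so its indicator has norm 0;
    by the norm axiom for zero functions, \<open>Z j\<close> is null.\<close>
  define Z where "Z j = {t \<in> space \<mu>. t \<in> trunc_dom j \<and> (\<forall>g\<in>norming_set. g t = 0)}" for j
  have Z_AE: "AE t in \<mu>. t \<notin> Z j" for j
  proof -
    have [measurable]: "trunc_dom j \<in> sets \<mu>" by (rule trunc_dom)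
    have Zm [measurable]: "Z j \<in> sets \<mu>"
      unfolding Z_def
    proof (intro sets.sets_Collect_conj sets.sets_Collect_countable_All' norming_set(1))
      show "{t \<in> space \<mu>. g t = 0} \<in> sets \<mu>" if "g \<in> norming_set" for g
      proof -
        have [measurable]: "g \<in> borel_measurable \<mu>" using that norming_set(2) ext_measurable by auto
        show ?thesis by measurable
      qed
    qed measurable
    have Zf: "emeasure \<mu> (Z j) < \<infinity>"
      using trunc_dom(3)[of j] by (rule le_less_trans[rotated]) (intro emeasure_mono, auto simp: Z_def)
    have iz: "indicator (Z j) \<in> fspace \<mu> N" using Zm Zf by (rule fspace_indicator)
    have "pairing \<mu> g (indicator (Z j)) = 0" if "g \<in> norming_set" for g
    proof -
      have "indicator (Z j) t * g t = 0" for t using that by (auto simp: Z_def split: split_indicator)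
      then show ?thesis unfolding pairing_def by (simp only:) simp
    qed
    then have "fs_norm N (indicator (Z j)) = (SUP g\<in>norming_set. ennreal 0)"
      unfolding fs_norm_eq_SUP[OF iz] by simp
    also have "\<dots> = 0" by (cases "norming_set = {}") (auto simp: bot_ennreal)
    finally have "N (\<lambda>t. ennreal \<bar>indicator (Z j) t\<bar>) = 0" by (simp add: fs_norm_def)
    then have "AE t in \<mu>. ennreal \<bar>indicator (Z j) t\<bar> = 0"
      by (subst (asm) norm_zero_iff) measurable
    then show ?thesis by (rule AE_mp) (auto split: split_indicator intro!: AE_I2)
  qed
  have "AE t in \<mu>. \<forall>j. t \<notin> Z j" using Z_AE by (simp add: AE_all_countable)
  moreover have "AE t in \<mu>. \<forall>g\<in>norming_set. \<forall>j n. t \<notin> B g j n - \<Union>\<F>"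
    unfolding AE_ball_countable[OF norming_set(1)] AE_all_countable using B_AE by blast
  moreover have "AE t in \<mu>. t \<in> space \<mu>" by (rule AE_space)
  ultimately have cover: "AE t in \<mu>. t \<in> \<Union>\<F>"
  proof eventually_elim
    case (elim t)
    then have Z: "\<forall>j. t \<notin> Z j" and Bn: "\<forall>g\<in>norming_set. \<forall>j n. t \<notin> B g j n - \<Union>\<F>"
      and True: "t \<in> space \<mu>" by auto
    show ?case
    proof (rule ccontr)
      assume n: "t \<notin> \<Union>\<F>"
      obtain j where j: "t \<in> trunc_dom j" using True trunc_dom(2) by auto
      then obtain g where g: "g \<in> norming_set" "g t \<noteq> 0" using Z True by (auto simp: Z_def)
      then obtain m where "1 / real (Suc m) < \<bar>g t\<bar>" using nat_approx_posE[of "\<bar>g t\<bar>"] by auto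
      then have "t \<in> B g j m" using True j by (simp add: B_def)
      then show False using Bn g n by auto
    qed
  qed
  have ne: "\<F> \<noteq> {}" by (simp add: \<F>_def)
  \<comment> \<open>The pieces stay indecomposable when made disjoint, as subsets of the original
    ones; the member \<open>{}\<close> of \<open>\<F>\<close> makes the enumeration possible in
    every case.\<close>
  define A where "A = disjointed (from_nat_into \<F>)"
  have r: "range (from_nat_into \<F>) = \<F>" using ne \<F>_countable by (rule range_from_nat_into)
  then have fs: "from_nat_into \<F> i \<in> \<F>" for i by blast
  have "A i \<in> sets \<mu>" for i
    unfolding A_def using sets.range_disjointed_sets[of "from_nat_into \<F>" \<mu>] r \<F>_sets by auto
  then have "indecomposable \<mu> (A i)" for i
    using disjointed_subset[of "from_nat_into \<F>" i] unfolding A_def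
    by (intro indecomposable_subset[OF \<F>_ind[OF fs[of i]]])
  moreover have "(\<Union>i. A i) = \<Union>\<F>" unfolding A_def UN_disjointed_eq r ..
  ultimately show ?thesis
    using that[of A] cover by (simp add: A_def disjoint_family_disjointed)
qed

end

subsection \<open>Nets obtained from the entropy integral\<close>

lemma Inf_enat_attained: "A \<noteq> {} \<Longrightarrow> Inf A \<in> (A :: enat set)"
  unfolding Inf_enat_def by (auto intro: LeastI)

lemma covering_number_antimono: "\<epsilon> \<le> \<epsilon>' \<Longrightarrow> covering_number X d \<epsilon>' \<le> covering_number X d \<epsilon>"
  unfolding covering_number_def
  by (intro INF_superset_mono) (auto, meson ennreal_leI order_trans)

lemma ln_enat_mono: "0 < m \<Longrightarrow> m \<le> n \<Longrightarrow> ln_enat m \<le> ln_enat n"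
  by (cases m; cases n) (auto simp: ln_enat_def zero_enat_def)

lemma v_R_star_mono: "x \<le> y \<Longrightarrow> v_R_star \<psi> x \<le> v_R_star \<psi> y"
  unfolding v_R_star_def
  by (intro INF_superset_mono add_right_mono ereal_mult_right_mono) auto

lemma exp_ereal_mono: "x \<le> y \<Longrightarrow> exp_ereal x \<le> exp_ereal y"
  by (cases x; cases y) (auto simp: exp_ereal_def intro!: ennreal_leI)

lemma covering_number_pos: "S \<noteq> {} \<Longrightarrow> 0 < covering_number S d \<epsilon>"
proof -
  assume S: "S \<noteq> {}"
  have "1 \<le> covering_number S d \<epsilon>"
    unfolding covering_number_def
  proof (rule INF_greatest)
    fix C assume C: "C \<in> {C. finite C \<and> C \<subseteq> S \<and> (\<forall>x\<in>S. \<exists>c\<in>C. d c x \<le> ennreal \<epsilon>)}"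
    then have "C \<noteq> {}" using S by auto
    then have "0 < card C" using C by (auto simp: card_gt_0_iff)
    then show "1 \<le> enat (card C)" by (simp add: one_enat_def)
  qed
  then show ?thesis by (rule less_le_trans[rotated]) simp
qed

text \<open>For \<open>y > 0\<close> the product is infinite; at \<open>y = 0\<close> the product is
  0 but \<open>v_R \<psi> 0\<close> is infinite. Hence a finite integrand forces a finite covering
  number.\<close>

lemma v_R_star_infinity: "v_R_star \<psi> \<infinity> = \<infinity>"
proof -
  have "(\<infinity>::ereal) * ereal y + v_R \<psi> y = \<infinity>" if "0 \<le> y" for y
    using that by (cases "y = 0") (auto simp: v_R_def)
  then have "v_R_star \<psi> \<infinity> = (INF y\<in>{0::real..}. \<infinity>)"
    unfolding v_R_star_def by (intro INF_cong) auto
  then show ?thesis by simp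
qed

lemma psi_R_pos: "2 < p \<Longrightarrow> 0 < \<psi> p \<Longrightarrow> 0 < psi_R \<psi> p"
  by (simp add: psi_R_def Rosenthal_const_def)

text \<open>With \<open>y = 1 / q\<close> the expression under the infimum exponentiates to
  \<open>exp (2 / q) * real (card C) powr (1 / q) * psi_R \<psi> q\<close>, where \<open>C\<close>
  is a minimal net. A nearly optimal \<open>y\<close> therefore supplies the exponent for the
  maximal inequality over \<open>C\<close>.\<close>

lemma net_of_entropy:
  assumes S: "S \<noteq> {}" and \<psi>: "\<And>p. 2 < p \<Longrightarrow> 0 < \<psi> p"
    and fin: "exp_ereal (v_R_star \<psi> (2 + ln_enat (covering_number S d \<epsilon>))) = ennreal r" and r: "0 \<le> r"
  obtains C q where "finite C" "C \<subseteq> S" "\<And>x. x \<in> S \<Longrightarrow> \<exists>c\<in>C. d c x \<le> ennreal \<epsilon>" "2 < q"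
    "real (card C) powr (1 / q) * psi_R \<psi> q \<le> r + 1"
proof -
  define \<C> where "\<C> = {C. finite C \<and> C \<subseteq> S \<and> (\<forall>x\<in>S. \<exists>c\<in>C. d c x \<le> ennreal \<epsilon>)}"
  have cov: "covering_number S d \<epsilon> = Inf ((\<lambda>C. enat (card C)) ` \<C>)"
    by (simp add: covering_number_def \<C>_def)
  have "covering_number S d \<epsilon> \<noteq> \<infinity>"
  proof
    assume "covering_number S d \<epsilon> = \<infinity>"
    then have "exp_ereal (v_R_star \<psi> (2 + ln_enat (covering_number S d \<epsilon>))) = \<infinity>"
      by (simp add: ln_enat_def v_R_star_infinity exp_ereal_def)
    then show False using fin by simp
  qed
  then have "\<C> \<noteq> {}" unfolding cov by (auto simp: Inf_enat_def)
  then have "covering_number S d \<epsilon> \<in> (\<lambda>C. enat (card C)) ` \<C>"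
    unfolding cov by (intro Inf_enat_attained) auto
  then obtain C where C: "C \<in> \<C>" "covering_number S d \<epsilon> = enat (card C)" by auto
  have n: "card C > 0" using covering_number_pos[OF S, of d \<epsilon>] C(2) by (simp add: zero_enat_def)
  let ?x = "2 + ln (real (card C))"
  have x: "2 + ln_enat (covering_number S d \<epsilon>) = ereal ?x"
    by (simp add: C(2) ln_enat_def)
  \<comment> \<open>The infimum need not be attained; the slack from \<open>r\<close> to
    \<open>r + 1\<close> allows a concrete \<open>y\<close> and keeps the logarithm meaningful for
    \<open>r = 0\<close>.\<close>
  have "v_R_star \<psi> (ereal ?x) < ereal (ln (r + 1))"
  proof (cases "v_R_star \<psi> (ereal ?x)")
    case (real v)
    then have "ennreal (exp v) = ennreal r" using fin by (simp only: x) (simp add: exp_ereal_def)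
    then have "exp v = r" using r by (simp add: ennreal_inj)
    then have "v < ln (r + 1)"
      by (metis exp_gt_zero less_add_one ln_exp ln_less_cancel_iff add_pos_pos zero_less_one)
    then show ?thesis using real by simp
  next
    case PInf
    then show ?thesis using fin by (simp only: x) (simp add: exp_ereal_def)
  qed simp
  then obtain y where y: "0 \<le> y" "ereal ?x * ereal y + v_R \<psi> y < ereal (ln (r + 1))"
    unfolding v_R_star_def by (auto simp: INF_less_iff)
  then have y2: "0 < y" "2 < 1 / y" and v: "?x * y + ln (psi_R \<psi> (1 / y)) < ln (r + 1)"
    by (auto simp: v_R_def split: if_splits)
  define q where "q = 1 / y"
  have pos: "0 < psi_R \<psi> q" using y2 \<psi> by (intro psi_R_pos) (auto simp: q_def)
  have "real (card C) powr (1 / q) * psi_R \<psi> q = exp (ln (real (card C)) * y + ln (psi_R \<psi> q))"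
    using n pos by (simp add: powr_def exp_add q_def mult.commute)
  also have "\<dots> \<le> exp (?x * y + ln (psi_R \<psi> q))"
    using y2 by (simp add: distrib_right)
  also have "\<dots> \<le> exp (ln (r + 1))" using v by (simp add: q_def)
  also have "\<dots> = r + 1" using r by simp
  finally show ?thesis using that[of C q] C y2 by (auto simp: \<C>_def q_def)
qed

text \<open>The integrand decreases in the radius, so its value at \<open>\<delta> k\<close> times
  \<open>\<delta> k / 2\<close> is at most the integral over the shell between
  \<open>\<delta> (Suc k)\<close> and \<open>\<delta> k\<close>. The dyadic shells are disjoint,
  hence the sum of these products is bounded by the entropy integral.\<close>

lemma entropy_nets:
  fixes S :: "'a set" and d :: "'a \<Rightarrow> 'a \<Rightarrow> ennreal"
  assumes S: "S \<noteq> {}" and \<psi>: "\<And>p. 2 < p \<Longrightarrow> 0 < \<psi> p"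
    and diam: "diam S d < \<infinity>" and ent: "entropy_integral \<psi> S d < \<infinity>"
  obtains net :: "nat \<Rightarrow> 'a set" and \<delta> q :: "nat \<Rightarrow> real" where
    "\<And>k. finite (net k)" "\<And>k. net k \<subseteq> S" "\<And>k x. x \<in> S \<Longrightarrow> \<exists>c\<in>net k. d c x \<le> ennreal (\<delta> k)"
    "\<And>k. 0 \<le> \<delta> k" "\<delta> \<longlonglongrightarrow> 0" "\<And>k. 2 < q k"
    "summable (\<lambda>k. \<delta> k * (real (card (net (Suc k))) powr (1 / q (Suc k)) * psi_R \<psi> (q (Suc k))))"
proof -
  define D where "D = enn2real (diam S d)"
  have D: "diam S d = ennreal D" using diam by (simp add: D_def)
  show ?thesis
  proof (cases "D = 0")
    case True
    obtain s where s: "s \<in> S" using S by auto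
    have "d s x \<le> ennreal 0" if "x \<in> S" for x
    proof -
      have "d s x \<le> diam S d" unfolding diam_def using s that by (intro SUP_upper2[of s] SUP_upper)
      then show ?thesis by (simp add: D True)
    qed
    then show ?thesis using s by (intro that[of "\<lambda>_. {s}" "\<lambda>_. 0" "\<lambda>_. 3"]) auto
  next
    case False
    then have D0: "D > 0" by (simp add: D_def less_le)
    define \<phi> where "\<phi> \<epsilon> = exp_ereal (v_R_star \<psi> (2 + ln_enat (covering_number S d \<epsilon>)))" for \<epsilon>
    define \<delta> where "\<delta> k = D / 2 ^ k" for k :: nat
    have \<delta>: "\<delta> k > 0" "\<delta> (Suc k) = \<delta> k / 2" "\<delta> k \<le> D" for k
    proof -
      show "\<delta> k > 0" "\<delta> (Suc k) = \<delta> k / 2" using D0 by (auto simp: \<delta>_def)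
      have "(1::real) \<le> 2 ^ k" by simp
      then have "D * 1 \<le> D * 2 ^ k" using D0 by (intro mult_left_mono) auto
      then show "\<delta> k \<le> D" by (simp add: \<delta>_def field_simps)
    qed
    have anti: "\<phi> y \<le> \<phi> x" if "x \<le> y" for x y
      unfolding \<phi>_def using that covering_number_pos[OF S]
      by (intro exp_ereal_mono v_R_star_mono add_left_mono ln_enat_mono covering_number_antimono)
    have J: "(\<integral>\<^sup>+\<epsilon>. \<phi> \<epsilon> * indicator {0..D} \<epsilon> \<partial>lborel) < \<infinity>"
      using ent by (simp add: entropy_integral_def \<phi>_def D_def)
    have pw: "(\<Sum>k<n. \<phi> (\<delta> k) * indicator {\<delta> (Suc k)<..\<delta> k} x) \<le> \<phi> x * indicator {\<delta> n<..D} x" for n x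
    proof (induction n)
      case (Suc n)
      show ?case
      proof (cases "x \<in> {\<delta> (Suc n)<..\<delta> n}")
        case True
        then have "\<phi> x * indicator {\<delta> n<..D} x = 0" "x \<in> {\<delta> (Suc n)<..D}" using \<delta>(3)[of n] by auto
        then show ?thesis using Suc True anti[of x "\<delta> n"] by simp
      next
        case False
        have "indicator {\<delta> n<..D} x \<le> (indicator {\<delta> (Suc n)<..D} x :: ennreal)"
          using \<delta>(1)[of n] by (auto simp: \<delta>(2) split: split_indicator)
        then have "\<phi> x * indicator {\<delta> n<..D} x \<le> \<phi> x * indicator {\<delta> (Suc n)<..D} x"
          by (intro mult_left_mono) auto
        with Suc have "(\<Sum>k<n. \<phi> (\<delta> k) * indicator {\<delta> (Suc k)<..\<delta> k} x) \<le> \<phi> x * indicator {\<delta> (Suc n)<..D} x"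
          by (rule order_trans)
        then show ?thesis using False by simp
      qed
    qed simp
    have part: "(\<Sum>k<n. \<phi> (\<delta> k) * ennreal (\<delta> k / 2)) \<le> (\<integral>\<^sup>+\<epsilon>. \<phi> \<epsilon> * indicator {0..D} \<epsilon> \<partial>lborel)" for n
    proof -
      have "(\<Sum>k<n. \<phi> (\<delta> k) * ennreal (\<delta> k / 2)) = (\<integral>\<^sup>+x. (\<Sum>k<n. \<phi> (\<delta> k) * indicator {\<delta> (Suc k)<..\<delta> k} x) \<partial>lborel)"
      proof -
        have "emeasure lborel {\<delta> (Suc k)<..\<delta> k} = ennreal (\<delta> k / 2)" for k
          using \<delta>(1)[of k] by (subst emeasure_lborel_Ioc) (simp_all only: \<delta>(2), simp_all)
        then show ?thesis by (subst nn_integral_sum) (auto simp: nn_integral_cmult_indicator)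
      qed
      also have "\<dots> \<le> (\<integral>\<^sup>+\<epsilon>. \<phi> \<epsilon> * indicator {0..D} \<epsilon> \<partial>lborel)"
      proof (rule nn_integral_mono)
        fix x
        have "\<phi> x * indicator {\<delta> n<..D} x \<le> \<phi> x * indicator {0..D} x"
          using \<delta>(1)[of n] by (intro mult_left_mono) (auto split: split_indicator)
        with pw show "(\<Sum>k<n. \<phi> (\<delta> k) * indicator {\<delta> (Suc k)<..\<delta> k} x) \<le> \<phi> x * indicator {0..D} x"
          by (rule order_trans)
      qed
      finally show ?thesis .
    qed
    have fin: "\<phi> (\<delta> k) < \<infinity>" for k
    proof -
      have "\<phi> (\<delta> k) * ennreal (\<delta> k / 2) \<le> (\<Sum>k<Suc k. \<phi> (\<delta> k) * ennreal (\<delta> k / 2))" by simp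
      also have "\<dots> < \<infinity>" using part[of "Suc k"] J by (rule le_less_trans)
      finally show ?thesis using \<delta>(1)[of k] by (auto simp: ennreal_mult_less_top)
    qed
    define r where "r k = enn2real (\<phi> (\<delta> k))" for k
    have r: "\<phi> (\<delta> k) = ennreal (r k)" "0 \<le> r k" for k using fin[of k] by (auto simp: r_def)
    have "\<exists>C q. finite C \<and> C \<subseteq> S \<and> (\<forall>x\<in>S. \<exists>c\<in>C. d c x \<le> ennreal (\<delta> k)) \<and> 2 < q \<and>
        real (card C) powr (1 / q) * psi_R \<psi> q \<le> r k + 1" for k
      using net_of_entropy[OF S \<psi> r(1)[unfolded \<phi>_def] r(2), of k] by metis
    then obtain net q where nq: "\<And>k. finite (net k)" "\<And>k. net k \<subseteq> S"
      "\<And>k x. x \<in> S \<Longrightarrow> \<exists>c\<in>net k. d c x \<le> ennreal (\<delta> k)" "\<And>k. 2 < q k"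
      "\<And>k. real (card (net k)) powr (1 / q k) * psi_R \<psi> (q k) \<le> r k + 1"
      by metis
    have "summable (\<lambda>k. r k * (\<delta> k / 2))"
    proof (rule summableI_nonneg_bounded)
      show "0 \<le> r k * (\<delta> k / 2)" for k using r(2) \<delta>(1)[of k] by simp
      fix n
      have "ennreal (\<Sum>k<n. r k * (\<delta> k / 2)) = (\<Sum>k<n. \<phi> (\<delta> k) * ennreal (\<delta> k / 2))"
      proof -
        have "\<phi> (\<delta> k) * ennreal (\<delta> k / 2) = ennreal (r k * (\<delta> k / 2))" for k
          unfolding r(1) using r(2)[of k] \<delta>(1)[of k] by (intro ennreal_mult[symmetric]) auto
        moreover have "(\<Sum>k<n. ennreal (r k * (\<delta> k / 2))) = ennreal (\<Sum>k<n. r k * (\<delta> k / 2))"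
          using r(2) \<delta>(1) by (intro sum_ennreal mult_nonneg_nonneg) (auto simp: less_imp_le)
        ultimately show ?thesis by simp
      qed
      also have "\<dots> \<le> ennreal (enn2real (\<integral>\<^sup>+\<epsilon>. \<phi> \<epsilon> * indicator {0..D} \<epsilon> \<partial>lborel))"
        using part[of n] J by simp
      finally show "(\<Sum>k<n. r k * (\<delta> k / 2)) \<le> enn2real (\<integral>\<^sup>+\<epsilon>. \<phi> \<epsilon> * indicator {0..D} \<epsilon> \<partial>lborel)"
        by (subst (asm) ennreal_le_iff) auto
    qed
    moreover have "summable (\<lambda>k. D * (1 / 2) ^ k)"
      by (intro summable_mult summable_geometric) simp
    \<comment> \<open>The factors 4 and 2 undo the index shift
      \<open>\<delta> k = 2 * \<delta> (Suc k)\<close>; the geometric series pays for the slack 1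
      granted in \<open>net_of_entropy\<close>.\<close>
    ultimately have "summable (\<lambda>k. 4 * (r k * (\<delta> k / 2)) + 2 * (D * (1 / 2) ^ k))"
      by (rule summable_add[OF summable_mult summable_mult])
    then have sm: "summable (\<lambda>k. 4 * (r (Suc k) * (\<delta> (Suc k) / 2)) + 2 * (D * (1 / 2) ^ Suc k))"
      by (rule summable_Suc_iff[THEN iffD2])
    have "\<delta> \<longlonglongrightarrow> 0"
    proof -
      have "(\<lambda>k. D * (1 / 2) ^ k) \<longlonglongrightarrow> D * 0" by (intro tendsto_mult tendsto_const LIMSEQ_power_zero) simp
      then show ?thesis by (simp add: \<delta>_def[abs_def] power_divide)
    qed
    moreover have "summable (\<lambda>k. \<delta> k * (real (card (net (Suc k))) powr (1 / q (Suc k)) * psi_R \<psi> (q (Suc k))))"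
    proof (rule summable_comparison_test'[OF sm])
      fix k :: nat
      let ?c = "real (card (net (Suc k))) powr (1 / q (Suc k)) * psi_R \<psi> (q (Suc k))"
      have c0: "0 \<le> ?c" using psi_R_pos[OF nq(4)[of "Suc k"], of \<psi>] \<psi>[OF nq(4)[of "Suc k"]] by simp
      have "\<delta> k * ?c \<le> \<delta> k * (r (Suc k) + 1)"
        using nq(5)[of "Suc k"] \<delta>(1)[of k] by (intro mult_left_mono) auto
      also have "\<dots> = 4 * (r (Suc k) * (\<delta> (Suc k) / 2)) + 2 * (D * (1 / 2) ^ Suc k)"
        by (simp add: \<delta>(2)) (simp add: \<delta>_def power_divide distrib_left)
      finally show "norm (\<delta> k * ?c) \<le> 4 * (r (Suc k) * (\<delta> (Suc k) / 2)) + 2 * (D * (1 / 2) ^ Suc k)"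
        using c0 \<delta>(1)[of k] by simp
    qed
    ultimately show ?thesis
      using \<delta>(1) nq by (intro that[of net \<delta> q]) (auto simp: less_imp_le)
  qed
qed

subsection \<open>Weak convergence from Lipschitz functionals\<close>

context banach_function_norm
begin

definition bdd_Lipschitz :: "(('t \<Rightarrow> real) \<Rightarrow> real) \<Rightarrow> bool" where
  "bdd_Lipschitz F \<longleftrightarrow> (\<exists>B. \<forall>f\<in>fspace \<mu> N. \<bar>F f\<bar> \<le> B) \<and>
    (\<exists>L\<ge>0. \<forall>f\<in>fspace \<mu> N. \<forall>h\<in>fspace \<mu> N. \<bar>F f - F h\<bar> \<le> L * nrm (\<lambda>t. f t - h t))"

lemma bdd_Lipschitz_imp_bdd_cont:
  assumes "bdd_Lipschitz F"
  shows "bdd_cont_functional \<mu> N F"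
proof -
  obtain B L where B: "\<And>f. f \<in> fspace \<mu> N \<Longrightarrow> \<bar>F f\<bar> \<le> B" and L: "0 \<le> L"
    "\<And>f h. f \<in> fspace \<mu> N \<Longrightarrow> h \<in> fspace \<mu> N \<Longrightarrow> \<bar>F f - F h\<bar> \<le> L * nrm (\<lambda>t. f t - h t)"
    using assms unfolding bdd_Lipschitz_def by blast
  show ?thesis unfolding bdd_cont_functional_def
  proof (intro conjI ballI allI impI)
    show "\<exists>B. \<forall>f\<in>fspace \<mu> N. \<bar>F f\<bar> \<le> B" using B by blast
    fix f and e :: real assume f: "f \<in> fspace \<mu> N" and e: "0 < e"
    have "\<bar>F h - F f\<bar> < e"
      if h: "h \<in> fspace \<mu> N" and lt: "fs_norm N (\<lambda>t. h t - f t) < ennreal (e / (L + 1))" for h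
    proof -
      have "nrm (\<lambda>t. h t - f t) < e / (L + 1)"
        using lt nrm_less_iff[OF fspace_diff[OF h f]] by simp
      then have "(L + 1) * nrm (\<lambda>t. h t - f t) < e" using L(1) by (simp add: field_simps)
      moreover have "L * nrm (\<lambda>t. h t - f t) \<le> (L + 1) * nrm (\<lambda>t. h t - f t)"
        by (intro mult_right_mono) auto
      ultimately show ?thesis using L(2)[OF h f] by linarith
    qed
    then show "\<exists>\<delta>>0. \<forall>h\<in>fspace \<mu> N. fs_norm N (\<lambda>t. h t - f t) < ennreal \<delta> \<longrightarrow> \<bar>F h - F f\<bar> < e"
      using e L(1) by (intro exI[of _ "e / (L + 1)"]) auto
  qed
qed

text \<open>The Pasch-Hausdorff envelope: for bounded \<open>F\<close>, the largest minorant of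
  \<open>F\<close> with Lipschitz constant \<open>k\<close>.\<close>

definition inf_conv :: "(('t \<Rightarrow> real) \<Rightarrow> real) \<Rightarrow> nat \<Rightarrow> ('t \<Rightarrow> real) \<Rightarrow> real" where
  "inf_conv F k f = (INF h\<in>fspace \<mu> N. F h + real k * nrm (\<lambda>t. f t - h t))"

lemma inf_conv:
  assumes F: "bdd_cont_functional \<mu> N F"
  shows "bdd_Lipschitz (inf_conv F k)"
    and "f \<in> fspace \<mu> N \<Longrightarrow> inf_conv F k f \<le> F f"
    and "f \<in> fspace \<mu> N \<Longrightarrow> (\<lambda>k. inf_conv F k f) \<longlonglongrightarrow> F f"
    and "\<exists>B. \<forall>k. \<forall>f\<in>fspace \<mu> N. \<bar>inf_conv F k f\<bar> \<le> B"
proof -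
  obtain B where B: "\<And>f. f \<in> fspace \<mu> N \<Longrightarrow> \<bar>F f\<bar> \<le> B"
    using F unfolding bdd_cont_functional_def by blast
  have n0: "nrm (\<lambda>t. 0) = 0" by (simp add: nrm_def)
  have lower: "- B \<le> F h + real k * nrm (\<lambda>t. f t - h t)" if "h \<in> fspace \<mu> N" for k h f
    using B[OF that] by (simp add: add_increasing2 abs_le_iff)
  have bdd: "bdd_below ((\<lambda>h. F h + real k * nrm (\<lambda>t. f t - h t)) ` fspace \<mu> N)" for k f
    using lower by (intro bdd_belowI[of _ "- B"]) auto
  have ne: "fspace \<mu> N \<noteq> {}" using fspace_zero by blast
  have le: "inf_conv F k f \<le> F h + real k * nrm (\<lambda>t. f t - h t)" if "h \<in> fspace \<mu> N" for k f h
    unfolding inf_conv_def using that by (intro cINF_lower bdd)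
  show upper: "inf_conv F k f \<le> F f" if "f \<in> fspace \<mu> N" for f k
    using le[OF that, of k f] by (simp add: n0)
  have low: "- B \<le> inf_conv F k f" for k f
    unfolding inf_conv_def using lower by (intro cINF_greatest ne)
  have bound: "\<bar>inf_conv F k f\<bar> \<le> B" if "f \<in> fspace \<mu> N" for k f
    using low[of k f] upper[OF that, of k] B[OF that] by (simp add: abs_le_iff)
  then show "\<exists>B. \<forall>k. \<forall>f\<in>fspace \<mu> N. \<bar>inf_conv F k f\<bar> \<le> B" by blast
  have half: "inf_conv F k f \<le> inf_conv F k g + real k * nrm (\<lambda>t. f t - g t)"
    if f: "f \<in> fspace \<mu> N" and g: "g \<in> fspace \<mu> N" for f g k
  proof -
    have "inf_conv F k f - real k * nrm (\<lambda>t. f t - g t) \<le> inf_conv F k g"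
      unfolding inf_conv_def[of F k g]
    proof (rule cINF_greatest[OF ne])
      fix h assume h: "h \<in> fspace \<mu> N"
      have "real k * nrm (\<lambda>t. f t - h t) \<le> real k * (nrm (\<lambda>t. f t - g t) + nrm (\<lambda>t. g t - h t))"
        by (intro mult_left_mono nrm_triangle_diff f g h) auto
      with le[OF h, of k f] show "inf_conv F k f - real k * nrm (\<lambda>t. f t - g t) \<le> F h + real k * nrm (\<lambda>t. g t - h t)"
        by (simp add: distrib_left)
    qed
    then show ?thesis by simp
  qed
  have "\<bar>inf_conv F k f - inf_conv F k g\<bar> \<le> real k * nrm (\<lambda>t. f t - g t)"
    if "f \<in> fspace \<mu> N" "g \<in> fspace \<mu> N" for f g k
    using half[OF that, of k] half[OF that(2,1), of k] nrm_minus[of f g] by (simp add: abs_le_iff)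
  then show "bdd_Lipschitz (inf_conv F k)"
    unfolding bdd_Lipschitz_def using bound by (metis of_nat_0_le_iff)
  show "(\<lambda>k. inf_conv F k f) \<longlonglongrightarrow> F f" if f: "f \<in> fspace \<mu> N"
  proof (rule LIMSEQ_I)
    fix e :: real assume e: "0 < e"
    with F[unfolded bdd_cont_functional_def, THEN conjunct2, THEN bspec, OF f] obtain d
      where d: "d > 0" "\<And>h. h \<in> fspace \<mu> N \<Longrightarrow> fs_norm N (\<lambda>t. h t - f t) < ennreal d \<Longrightarrow> \<bar>F h - F f\<bar> < e / 2"
      by (metis half_gt_zero)
    \<comment> \<open>From this index on, a point at distance at least \<open>d\<close> from
      \<open>f\<close> pays a penalty above \<open>2 * B\<close> and cannot compete with
      \<open>F f\<close>; nearer points are controlled by continuity.\<close>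
    obtain n where n: "2 * B / d < real n" using reals_Archimedean2 by blast
    have "norm (inf_conv F k f - F f) < e" if k: "k \<ge> n" for k
    proof -
      have "F f - e / 2 \<le> inf_conv F k f"
        unfolding inf_conv_def
      proof (rule cINF_greatest[OF ne])
        fix h assume h: "h \<in> fspace \<mu> N"
        show "F f - e / 2 \<le> F h + real k * nrm (\<lambda>t. f t - h t)"
        proof (cases "nrm (\<lambda>t. h t - f t) < d")
          case True
          then have "\<bar>F h - F f\<bar> < e / 2"
            using d(2)[OF h] nrm_less_iff[OF fspace_diff[OF h f]] by simp
          moreover have "0 \<le> real k * nrm (\<lambda>t. f t - h t)" by simp
          ultimately show ?thesis by linarith
        next
          case False
          then have "d \<le> nrm (\<lambda>t. f t - h t)" using nrm_minus[of f h] by simp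
          then have "real n * d \<le> real k * nrm (\<lambda>t. f t - h t)"
            using k d(1) by (intro mult_mono) auto
          moreover have "2 * B < real n * d" using n d(1) by (simp add: field_simps)
          ultimately show ?thesis using B[OF f] B[OF h] e by linarith
        qed
      qed
      then show ?thesis using upper[OF f, of k] e by simp
    qed
    then show "\<exists>no. \<forall>k\<ge>no. norm (inf_conv F k f - F f) < e" by blast
  qed
qed

lemma integrable_functional_on_path_event:
  assumes P: "prob_space P" and X: "random_element \<mu> N P X" and F: "bdd_cont_functional \<mu> N F"
  shows "integrable P (\<lambda>\<omega>. indicator (path_event \<mu> N P X) \<omega> *\<^sub>R F (\<lambda>t. X t \<omega>))"
proof -
  interpret prob_space P by fact
  obtain B where B: "\<And>f. f \<in> fspace \<mu> N \<Longrightarrow> \<bar>F f\<bar> \<le> B"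
    using F unfolding bdd_cont_functional_def by blast
  show ?thesis
  proof (rule integrable_const_bound[of _ "\<bar>B\<bar>"])
    show "AE \<omega> in P. norm (indicator (path_event \<mu> N P X) \<omega> *\<^sub>R F (\<lambda>t. X t \<omega>)) \<le> \<bar>B\<bar>"
      by (intro AE_I2) (auto simp: path_event_def split: split_indicator intro: order_trans[OF B abs_ge_self])
    show "(\<lambda>\<omega>. indicator (path_event \<mu> N P X) \<omega> *\<^sub>R F (\<lambda>t. X t \<omega>)) \<in> borel_measurable P"
      using X F unfolding random_element_def set_borel_measurable_def by blast
  qed
qed

text \<open>The envelopes lie below \<open>F\<close> and converge to it pointwise, so the Lipschitz
  case bounds the limit inferior from below. The same bound for \<open>- F\<close> gives the limit
  superior.\<close>

lemma weak_convergence_of_Lipschitz: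
  assumes Q: "prob_space Q" and R: "prob_space R"
    and X: "\<And>n. 1 \<le> n \<Longrightarrow> random_element \<mu> N Q (X n)" and Z: "random_element \<mu> N R Z"
    and lip: "\<And>F. bdd_Lipschitz F \<Longrightarrow>
      (\<lambda>n. functional_expectation \<mu> N Q (X n) F) \<longlonglongrightarrow> functional_expectation \<mu> N R Z F"
  shows "weakly_convergent_to \<mu> N Q X R Z"
proof -
  have half: "\<forall>\<^sub>F n in sequentially. functional_expectation \<mu> N R Z F - e < functional_expectation \<mu> N Q (X n) F"
    if F: "bdd_cont_functional \<mu> N F" and e: "0 < e" for F and e :: real
  proof -
    note ic = inf_conv[OF F]
    obtain B where B: "\<And>k f. f \<in> fspace \<mu> N \<Longrightarrow> \<bar>inf_conv F k f\<bar> \<le> B" using ic(4) by blast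
    have Fk: "bdd_cont_functional \<mu> N (inf_conv F k)" for k by (rule bdd_Lipschitz_imp_bdd_cont[OF ic(1)])
    interpret R: prob_space R by fact
    have "(\<lambda>k. functional_expectation \<mu> N R Z (inf_conv F k)) \<longlonglongrightarrow> functional_expectation \<mu> N R Z F"
      unfolding functional_expectation_def set_lebesgue_integral_def
    proof (rule integral_dominated_convergence[where w="\<lambda>_. \<bar>B\<bar>"])
      show "AE \<omega> in R. (\<lambda>k. indicator (path_event \<mu> N R Z) \<omega> *\<^sub>R inf_conv F k (\<lambda>t. Z t \<omega>))
          \<longlonglongrightarrow> indicator (path_event \<mu> N R Z) \<omega> *\<^sub>R F (\<lambda>t. Z t \<omega>)"
        using ic(3) by (intro AE_I2) (auto simp: path_event_def split: split_indicator)
      show "AE \<omega> in R. norm (indicator (path_event \<mu> N R Z) \<omega> *\<^sub>R inf_conv F k (\<lambda>t. Z t \<omega>)) \<le> \<bar>B\<bar>" for k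
        by (intro AE_I2) (auto simp: path_event_def split: split_indicator intro: order_trans[OF B abs_ge_self])
    qed (use integrable_functional_on_path_event[OF R Z] F Fk in auto)
    from LIMSEQ_D[OF this half_gt_zero[OF e]] obtain k
      where "\<bar>functional_expectation \<mu> N R Z (inf_conv F k) - functional_expectation \<mu> N R Z F\<bar> < e / 2"
      by (metis order_refl real_norm_def)
    then have k: "functional_expectation \<mu> N R Z F - e / 2 < functional_expectation \<mu> N R Z (inf_conv F k)"
      by linarith
    from LIMSEQ_D[OF lip[OF ic(1)[of k]] half_gt_zero[OF e]] obtain n0
      where n0: "\<And>n. n \<ge> n0 \<Longrightarrow> \<bar>functional_expectation \<mu> N Q (X n) (inf_conv F k) - functional_expectation \<mu> N R Z (inf_conv F k)\<bar> < e / 2"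
      by auto
    show ?thesis
    proof (rule eventually_sequentiallyI[of "max n0 1"])
      fix n assume n: "max n0 1 \<le> n"
      have "functional_expectation \<mu> N Q (X n) (inf_conv F k) \<le> functional_expectation \<mu> N Q (X n) F"
        unfolding functional_expectation_def set_lebesgue_integral_def
        using integrable_functional_on_path_event[OF Q X] F Fk n ic(2)
        by (intro integral_mono) (auto simp: path_event_def split: split_indicator)
      then show "functional_expectation \<mu> N R Z F - e < functional_expectation \<mu> N Q (X n) F"
        using k n0[of n] n by linarith
    qed
  qed
  show ?thesis
    unfolding weakly_convergent_to_def
  proof (intro conjI allI impI X Z)
    fix F assume F: "bdd_cont_functional \<mu> N F"
    have mF: "bdd_cont_functional \<mu> N (\<lambda>f. - F f)"
    proof -
      have "\<bar>- F h - - F f\<bar> = \<bar>F h - F f\<bar>" for h f by linarith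
      then show ?thesis using F unfolding bdd_cont_functional_def by simp
    qed
    show "(\<lambda>n. functional_expectation \<mu> N Q (X n) F) \<longlonglongrightarrow> functional_expectation \<mu> N R Z F"
    proof (rule tendstoI)
      fix e :: real assume e: "0 < e"
      show "\<forall>\<^sub>F n in sequentially. dist (functional_expectation \<mu> N Q (X n) F) (functional_expectation \<mu> N R Z F) < e"
        using half[OF F e] half[OF mF e]
      proof eventually_elim
        case (elim n)
        have "functional_expectation \<mu> N Q (X n) (\<lambda>f. - F f) = - functional_expectation \<mu> N Q (X n) F"
          "functional_expectation \<mu> N R Z (\<lambda>f. - F f) = - functional_expectation \<mu> N R Z F"
          unfolding functional_expectation_def set_lebesgue_integral_def by simp_all
        then show ?case using elim by (simp add: dist_real_def abs_less_iff)
      qed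
    qed
  qed
qed

end

subsection \<open>Approximation by finitely many atoms\<close>

text \<open>From \<open>ln p = 2 * ln (sqrt p) \<le> 2 * sqrt p\<close>. It brings the factor
  \<open>4 * sqrt p\<close> of \<open>moment_sum_le\<close> under the Rosenthal transform and is the
  source of the constant 8.\<close>

lemma sqrt_le_ratio_ln:
  fixes p :: real
  assumes "2 < p"
  shows "4 * sqrt p \<le> 8 * (Rosenthal_const * p / ln p)"
proof -
  have l: "0 < ln p" using assms by simp
  have s: "0 < sqrt p" using assms by simp
  have "ln p = 2 * ln (sqrt p)" using assms by (simp add: ln_sqrt)
  also have "\<dots> \<le> 2 * sqrt p" using ln_less_self[OF s] by simp
  finally have "sqrt p * ln p \<le> sqrt p * (2 * sqrt p)" using s by (intro mult_left_mono) auto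
  also have "\<dots> = 2 * p" using assms by simp
  finally have "sqrt p \<le> 2 * p / ln p" using l by (simp add: pos_le_divide_eq)
  also have "\<dots> \<le> 2 * (Rosenthal_const * p) / ln p"
    using l assms by (intro divide_right_mono mult_left_mono) (auto simp: Rosenthal_const_def)
  finally show ?thesis by simp
qed

context chaining
begin

lemma totally_bounded_ext:
  assumes "0 < e"
  shows "\<exists>T. finite T \<and> T \<subseteq> ext \<and> (\<forall>g\<in>ext. \<exists>c\<in>T. L1_dist \<mu> c g \<le> ennreal e)"
proof -
  obtain k where "\<bar>\<delta> k - 0\<bar> < e" using LIMSEQ_D[OF \<delta>_tendsto assms] by auto
  then have "ennreal (\<delta> k) \<le> ennreal e" by (intro ennreal_leI) simp
  then have "\<forall>g\<in>ext. \<exists>c\<in>net k. L1_dist \<mu> c g \<le> ennreal e" using net order_trans by blast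
  then show ?thesis using finite_net net_ext by blast
qed

lemma tail_bound_space_finite:
  assumes L1: "\<And>g. g \<in> ext \<Longrightarrow> (\<integral>\<^sup>+t. ennreal \<bar>g t\<bar> \<partial>\<mu>) < \<infinity>"
  shows "tail_bound (space \<mu>) m < \<infinity>"
proof -
  have "(\<integral>\<^sup>+t. ennreal (\<bar>g t\<bar> * indicator (space \<mu>) t) \<partial>\<mu>) < \<infinity>" if "g \<in> net m" for g
  proof -
    have "(\<integral>\<^sup>+t. ennreal (\<bar>g t\<bar> * indicator (space \<mu>) t) \<partial>\<mu>) = (\<integral>\<^sup>+t. ennreal \<bar>g t\<bar> \<partial>\<mu>)"
      by (intro nn_integral_cong) simp
    then show ?thesis using L1 that net_ext by auto
  qed
  then have "(SUP g\<in>net m. \<integral>\<^sup>+t. ennreal (\<bar>g t\<bar> * indicator (space \<mu>) t) \<partial>\<mu>) < \<infinity>"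
    using finite_net[of m] net_nonempty[of m] by (subst finite_Sup_less_iff) auto
  moreover have "(\<Sum>k. ennreal (\<delta> (k + m) * C (Suc (k + m)))) < \<infinity>"
  proof -
    have "summable (\<lambda>k. \<delta> (k + m) * C (Suc (k + m)))"
      using summable_ignore_initial_segment[OF C_summable, of m] by simp
    then show ?thesis
      using \<delta>_nonneg C_nonneg by (subst suminf_ennreal2) auto
  qed
  ultimately show ?thesis by (simp add: tail_bound_def ennreal_mult_less_top)
qed

text \<open>The order of choices matters: \<open>m\<close> comes first and makes the remainder of
  the chain small for every set, then \<open>j\<close> makes the integrals of the finitely many
  members of \<open>net m\<close> over \<open>B j\<close> small by dominated convergence.\<close>

lemma tail_bound_small:
  assumes L1: "\<And>g. g \<in> ext \<Longrightarrow> (\<integral>\<^sup>+t. ennreal \<bar>g t\<bar> \<partial>\<mu>) < \<infinity>"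
    and B: "\<And>j. B j \<in> sets \<mu>" and null: "AE t in \<mu>. \<forall>\<^sub>F j in sequentially. t \<notin> B j" and e: "0 < e"
  shows "\<exists>j m. tail_bound (B j) m \<le> ennreal e"
proof -
  note B [measurable]
  let ?s = "\<lambda>m. \<Sum>k. \<delta> (k + m) * C (Suc (k + m))"
  have "?s \<longlonglongrightarrow> 0" using suminf_exist_split2[OF C_summable] by simp
  from LIMSEQ_D[OF this half_gt_zero[OF e]] obtain m where m: "\<bar>?s m\<bar> < e / 2" by auto
  have "summable (\<lambda>k. \<delta> (k + m) * C (Suc (k + m)))"
    using summable_ignore_initial_segment[OF C_summable, of m] by simp
  then have "(\<Sum>k. ennreal (\<delta> (k + m) * C (Suc (k + m)))) = ennreal (?s m)"
    using \<delta>_nonneg C_nonneg by (subst suminf_ennreal2) auto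
  also have "\<dots> < ennreal (e / 2)" using m e by (intro ennreal_lessI) auto
  finally have 1: "(\<Sum>k. ennreal (\<delta> (k + m) * C (Suc (k + m)))) < ennreal (e / 2)" .
  define e' where "e' = e / (2 * (C m + 1))"
  have Cm: "0 \<le> C m" by (rule C_nonneg)
  have e': "0 < e'" using e Cm by (simp add: e'_def)
  have "\<forall>\<^sub>F j in sequentially. (\<integral>\<^sup>+t. ennreal (\<bar>g t\<bar> * indicator (B j) t) \<partial>\<mu>) < ennreal e'" if g: "g \<in> net m" for g
  proof -
    have ge: "g \<in> ext" using g net_ext by auto
    have [measurable]: "g \<in> borel_measurable \<mu>" using ge by (rule ext_measurable)
    have "(\<lambda>j. \<integral>\<^sup>+t. ennreal (\<bar>g t\<bar> * indicator (B j) t) \<partial>\<mu>) \<longlonglongrightarrow> (\<integral>\<^sup>+t. 0 \<partial>\<mu>)"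
    proof (rule nn_integral_dominated_convergence[where w="\<lambda>t. ennreal \<bar>g t\<bar>"])
      show "AE t in \<mu>. ennreal (\<bar>g t\<bar> * indicator (B j) t) \<le> ennreal \<bar>g t\<bar>" for j
        by (intro AE_I2 ennreal_leI) (auto split: split_indicator)
      show "AE t in \<mu>. (\<lambda>j. ennreal (\<bar>g t\<bar> * indicator (B j) t)) \<longlonglongrightarrow> 0"
        using null
      proof eventually_elim
        case (elim t)
        then have "\<forall>\<^sub>F j in sequentially. ennreal (\<bar>g t\<bar> * indicator (B j) t) = 0"
          by (rule eventually_mono) simp
        then show ?case by (rule tendsto_eventually)
      qed
    qed (use L1[OF ge] in auto)
    then show ?thesis using e' by (intro order_tendstoD(2)) auto
  qed
  then have "\<forall>\<^sub>F j in sequentially. \<forall>g\<in>net m. (\<integral>\<^sup>+t. ennreal (\<bar>g t\<bar> * indicator (B j) t) \<partial>\<mu>) < ennreal e'"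
    using finite_net by (simp add: eventually_ball_finite)
  then obtain j where j: "\<forall>g\<in>net m. (\<integral>\<^sup>+t. ennreal (\<bar>g t\<bar> * indicator (B j) t) \<partial>\<mu>) < ennreal e'"
    by (auto simp: eventually_sequentially)
  have "(SUP g\<in>net m. \<integral>\<^sup>+t. ennreal (\<bar>g t\<bar> * indicator (B j) t) \<partial>\<mu>) \<le> ennreal e'"
    using j by (intro SUP_least) (auto intro: less_imp_le)
  then have "ennreal (C m) * (SUP g\<in>net m. \<integral>\<^sup>+t. ennreal (\<bar>g t\<bar> * indicator (B j) t) \<partial>\<mu>) \<le> ennreal (C m) * ennreal e'"
    by (intro mult_left_mono) auto
  also have "\<dots> = ennreal (C m * e')" using Cm e' by (simp add: ennreal_mult)
  also have "\<dots> \<le> ennreal (e / 2)"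
  proof (intro ennreal_leI)
    have "C m * e' \<le> (C m + 1) * e'" using e' by (intro mult_right_mono) auto
    also have "\<dots> = e / 2" using Cm by (simp add: e'_def field_simps)
    finally show "C m * e' \<le> e / 2" .
  qed
  finally have 2: "ennreal (C m) * (SUP g\<in>net m. \<integral>\<^sup>+t. ennreal (\<bar>g t\<bar> * indicator (B j) t) \<partial>\<mu>) \<le> ennreal (e / 2)" .
  have "tail_bound (B j) m \<le> ennreal (e / 2) + ennreal (e / 2)"
    unfolding tail_bound_def using 1 2 by (intro add_mono) auto
  also have "\<dots> = ennreal e" using e by (simp add: ennreal_plus[symmetric] del: ennreal_plus)
  finally show ?thesis by blast
qed

text \<open>That paths belong to the space is derived from the moments: chaining over all of
  \<open>space \<mu>\<close>, from level 0 on, gives a finite expected norm.\<close>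

lemma random_element_of_moment_bounded:
  assumes L1: "\<And>g. g \<in> ext \<Longrightarrow> (\<integral>\<^sup>+t. ennreal \<bar>g t\<bar> \<partial>\<mu>) < \<infinity>" and mb: "moment_bounded P X K"
  shows "AE \<omega> in P. (\<lambda>t. X t \<omega>) \<in> fspace \<mu> N" and "random_element \<mu> N P X"
proof -
  have X: "measurable_field \<mu> P X" using mb by (simp add: moment_bounded_def)
  have "(\<integral>\<^sup>+\<omega>. fs_norm N (\<lambda>t. X t \<omega>) \<partial>P) = (\<integral>\<^sup>+\<omega>. fs_norm N (\<lambda>t. X t \<omega> * indicator (space \<mu>) t) \<partial>P)"
  proof (rule nn_integral_cong)
    fix \<omega> assume "\<omega> \<in> space P"
    from measurable_field_section(1)[OF X this] show "fs_norm N (\<lambda>t. X t \<omega>) = fs_norm N (\<lambda>t. X t \<omega> * indicator (space \<mu>) t)"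
      by (intro fs_norm_cong_AE) auto
  qed
  also have "\<dots> \<le> ennreal K * tail_bound (space \<mu>) 0"
    by (intro nn_integral_fs_norm_le mb) auto
  also have "\<dots> < \<infinity>" using tail_bound_space_finite[OF L1] by (simp add: ennreal_mult_less_top)
  finally have "AE \<omega> in P. fs_norm N (\<lambda>t. X t \<omega>) \<noteq> \<infinity>"
    by (intro nn_integral_PInf_AE measurable_fs_norm_field X) auto
  then show AE: "AE \<omega> in P. (\<lambda>t. X t \<omega>) \<in> fspace \<mu> N"
    using AE_space
    by eventually_elim (use measurable_field_section(1)[OF X] in \<open>auto simp: fspace_def less_top\<close>)
  show "random_element \<mu> N P X" using X AE by (rule random_elementI)
qed

definition step_fun :: "(nat \<Rightarrow> 't set) \<Rightarrow> nat \<Rightarrow> (nat \<Rightarrow> real) \<Rightarrow> 't \<Rightarrow> real" where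
  "step_fun A m x t = (\<Sum>i<m. x i * indicator (A i) t)"

lemma step_fun_fspace:
  assumes "\<And>i. indecomposable \<mu> (A i)"
  shows "step_fun A m x \<in> fspace \<mu> N"
  unfolding step_fun_def[abs_def] using assms
  by (intro fspace_sum fspace_scale fspace_indicator) (auto simp: indecomposable_def)

lemma step_fun_Lipschitz:
  assumes A: "\<And>i. indecomposable \<mu> (A i)"
    and L: "0 \<le> L" "\<And>f h. f \<in> fspace \<mu> N \<Longrightarrow> h \<in> fspace \<mu> N \<Longrightarrow> \<bar>F f - F h\<bar> \<le> L * nrm (\<lambda>t. f t - h t)"
  shows "\<bar>F (step_fun A m x) - F (step_fun A m y)\<bar> \<le> (\<Sum>i<m. L * nrm (indicator (A i)) * \<bar>x i - y i\<bar>)"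
proof -
  have i: "indicator (A i) \<in> fspace \<mu> N" for i
    using A by (intro fspace_indicator) (auto simp: indecomposable_def)
  have "\<bar>F (step_fun A m x) - F (step_fun A m y)\<bar> \<le> L * nrm (\<lambda>t. step_fun A m x t - step_fun A m y t)"
    by (intro L step_fun_fspace A)
  also have "(\<lambda>t. step_fun A m x t - step_fun A m y t) = (\<lambda>t. \<Sum>i<m. (x i - y i) * indicator (A i) t)"
    by (simp add: step_fun_def sum_subtractf left_diff_distrib)
  also have "L * nrm (\<lambda>t. \<Sum>i<m. (x i - y i) * indicator (A i) t) \<le> L * (\<Sum>i<m. nrm (\<lambda>t. (x i - y i) * indicator (A i) t))"
    by (intro mult_left_mono nrm_sum_le fspace_scale i L) auto
  also have "\<dots> = (\<Sum>i<m. L * nrm (indicator (A i)) * \<bar>x i - y i\<bar>)"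
  proof -
    have "nrm (\<lambda>t. (x k - y k) * indicator (A k) t) = \<bar>x k - y k\<bar> * nrm (indicator (A k))" for k
      by (rule nrm_scale[OF i])
    then show ?thesis by (simp only: sum_distrib_left) (simp only: ac_simps)
  qed
  finally show ?thesis .
qed

text \<open>On the first \<open>j\<close> atoms a path agrees almost everywhere with the step
  function through its values at \<open>\<tau> i\<close>. The difference is thus the path outside
  these atoms, and its expected norm is at most \<open>e\<close> by
  \<open>nn_integral_fs_norm_le\<close>.\<close>

lemma approximation_by_atoms:
  assumes A: "\<And>i. indecomposable \<mu> (A i)" "disjoint_family A"
    and L1: "\<And>g. g \<in> ext \<Longrightarrow> (\<integral>\<^sup>+t. ennreal \<bar>g t\<bar> \<partial>\<mu>) < \<infinity>" and mb: "moment_bounded P X K"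
    and \<tau>: "\<And>i. \<tau> i \<in> space \<mu>"
    and const: "\<And>i. AE \<omega> in P. AE t in \<mu>. t \<in> A i \<longrightarrow> X t \<omega> = X (\<tau> i) \<omega>"
    and bd: "\<And>f. f \<in> fspace \<mu> N \<Longrightarrow> \<bar>F f\<bar> \<le> B"
    and L: "0 \<le> L" "\<And>f h. f \<in> fspace \<mu> N \<Longrightarrow> h \<in> fspace \<mu> N \<Longrightarrow> \<bar>F f - F h\<bar> \<le> L * nrm (\<lambda>t. f t - h t)"
    and tb: "ennreal K * tail_bound (space \<mu> - (\<Union>i<j. A i)) m \<le> ennreal e" and e: "0 \<le> e"
  shows "\<bar>functional_expectation \<mu> N P X F - (\<integral>\<omega>. F (step_fun A j (\<lambda>i. X (\<tau> i) \<omega>)) \<partial>P)\<bar> \<le> L * e"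
proof -
  interpret P: prob_space P using mb by (simp add: moment_bounded_def)
  have X: "measurable_field \<mu> P X" using mb by (simp add: moment_bounded_def)
  have F: "bdd_cont_functional \<mu> N F"
    by (rule bdd_Lipschitz_imp_bdd_cont) (use bd L in \<open>auto simp: bdd_Lipschitz_def\<close>)
  have As [measurable]: "A i \<in> sets \<mu>" for i using A by (simp add: indecomposable_def)
  define U where "U = space \<mu> - (\<Union>i<j. A i)"
  have U [measurable]: "U \<in> sets \<mu>" unfolding U_def by measurable
  have re: "AE \<omega> in P. (\<lambda>t. X t \<omega>) \<in> fspace \<mu> N" "random_element \<mu> N P X"
    using random_element_of_moment_bounded[OF _ mb] L1 by blast+
  have X\<tau> [measurable]: "X (\<tau> i) \<in> borel_measurable P" for i
    by (rule measurable_field_section(2)[OF X \<tau>])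
  have XU: "measurable_field \<mu> P (\<lambda>t \<omega>. X t \<omega> * indicator U t)"
  proof -
    have [measurable]: "(\<lambda>z. X (fst z) (snd z)) \<in> borel_measurable (\<mu> \<Otimes>\<^sub>M P)"
      using X by (simp add: measurable_field_def split_beta')
    show ?thesis unfolding measurable_field_def split_beta' by measurable
  qed
  have nU: "(\<integral>\<^sup>+\<omega>. fs_norm N (\<lambda>t. X t \<omega> * indicator U t) \<partial>P) \<le> ennreal e"
    using nn_integral_fs_norm_le[OF mb U] tb unfolding U_def by (rule order_trans)
  let ?n = "\<lambda>\<omega>. nrm (\<lambda>t. X t \<omega> * indicator U t)"
  have n_meas [measurable]: "?n \<in> borel_measurable P"
    unfolding nrm_def by (intro measurable_compose[OF measurable_fs_norm_field[OF XU]]) simp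
  have n_le: "(\<integral>\<^sup>+\<omega>. ennreal (?n \<omega>) \<partial>P) \<le> ennreal e"
  proof -
    have "(\<integral>\<^sup>+\<omega>. ennreal (?n \<omega>) \<partial>P) \<le> (\<integral>\<^sup>+\<omega>. fs_norm N (\<lambda>t. X t \<omega> * indicator U t) \<partial>P)"
      unfolding nrm_def by (intro nn_integral_mono) (simp add: ennreal_enn2real_if)
    then show ?thesis using nU by (rule order_trans)
  qed
  have n_int: "integrable P ?n"
    by (rule integrableI_nonneg) (use le_less_trans[OF n_le ennreal_less_top] in auto)
  have n_exp: "(\<integral>\<omega>. ?n \<omega> \<partial>P) \<le> e"
    using n_le e n_int by (subst (asm) nn_integral_eq_integral) auto
  have F_meas [measurable]: "(\<lambda>\<omega>. F (step_fun A j (\<lambda>i. X (\<tau> i) \<omega>))) \<in> borel_measurable P"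
    by (rule borel_measurable_Lipschitz_coordinates[OF step_fun_Lipschitz[OF A(1) L]]) measurable
  have i1: "integrable P (\<lambda>\<omega>. F (step_fun A j (\<lambda>i. X (\<tau> i) \<omega>)))"
    by (rule P.integrable_const_bound[of _ B]) (auto intro!: AE_I2 bd step_fun_fspace A)
  have i2: "integrable P (\<lambda>\<omega>. indicator (path_event \<mu> N P X) \<omega> *\<^sub>R F (\<lambda>t. X t \<omega>))"
    by (rule integrable_functional_on_path_event[OF P.prob_space_axioms re(2) F])
  have all_const: "AE \<omega> in P. \<forall>i. AE t in \<mu>. t \<in> A i \<longrightarrow> X t \<omega> = X (\<tau> i) \<omega>"
    using const by (simp add: AE_all_countable)
  have pw: "AE \<omega> in P. \<bar>indicator (path_event \<mu> N P X) \<omega> *\<^sub>R F (\<lambda>t. X t \<omega>) - F (step_fun A j (\<lambda>i. X (\<tau> i) \<omega>))\<bar> \<le> L * ?n \<omega>"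
    using re(1) all_const AE_space
  proof eventually_elim
    case (elim \<omega>)
    have Xw [measurable]: "(\<lambda>t. X t \<omega>) \<in> borel_measurable \<mu>"
      by (rule measurable_field_section(1)[OF X elim(3)])
    have sf: "step_fun A j (\<lambda>i. X (\<tau> i) \<omega>) \<in> fspace \<mu> N" by (rule step_fun_fspace[OF A(1)])
    have "AE t in \<mu>. \<forall>i. t \<in> A i \<longrightarrow> X t \<omega> = X (\<tau> i) \<omega>"
      using elim(2) by (simp add: AE_all_countable)
    then have "AE t in \<mu>. X t \<omega> - step_fun A j (\<lambda>i. X (\<tau> i) \<omega>) t = X t \<omega> * indicator U t"
      using AE_space
    proof eventually_elim
      case (elim t)
      show ?case
      proof (cases "\<exists>i<j. t \<in> A i")
        case True
        then obtain i where i: "i < j" "t \<in> A i" by auto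
        have "t \<notin> A k" if "k \<noteq> i" for k
          using A(2) i that unfolding disjoint_family_on_def by blast
        then have "X (\<tau> k) \<omega> * indicator (A k) t = (if k = i then X (\<tau> k) \<omega> else 0)" for k
          using i by (auto simp: indicator_def)
        then have "step_fun A j (\<lambda>i. X (\<tau> i) \<omega>) t = (\<Sum>k<j. if k = i then X (\<tau> k) \<omega> else 0)"
          unfolding step_fun_def by (rule sum.cong[OF refl])
        also have "\<dots> = X (\<tau> i) \<omega>" using i by simp
        finally have "step_fun A j (\<lambda>i. X (\<tau> i) \<omega>) t = X (\<tau> i) \<omega>" .
        moreover have "t \<notin> U" using i by (auto simp: U_def)
        ultimately show ?thesis using elim i by simp
      next
        case False
        then have "step_fun A j (\<lambda>i. X (\<tau> i) \<omega>) t = 0" by (auto simp: step_fun_def intro!: sum.neutral)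
        moreover have "t \<in> U" using False elim by (auto simp: U_def)
        ultimately show ?thesis by simp
      qed
    qed
    then have "nrm (\<lambda>t. X t \<omega> - step_fun A j (\<lambda>i. X (\<tau> i) \<omega>) t) = ?n \<omega>"
    proof (rule nrm_cong_AE[rotated 2])
      show "(\<lambda>t. X t \<omega> * indicator U t) \<in> borel_measurable \<mu>"
        by (intro borel_measurable_times Xw borel_measurable_indicator U)
      show "(\<lambda>t. X t \<omega> - step_fun A j (\<lambda>i. X (\<tau> i) \<omega>) t) \<in> borel_measurable \<mu>"
        by (intro borel_measurable_diff Xw fspace_measurable[OF sf])
    qed
    moreover have "\<bar>F (\<lambda>t. X t \<omega>) - F (step_fun A j (\<lambda>i. X (\<tau> i) \<omega>))\<bar>
        \<le> L * nrm (\<lambda>t. X t \<omega> - step_fun A j (\<lambda>i. X (\<tau> i) \<omega>) t)"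
      using elim(1) sf by (rule L)
    moreover have "\<omega> \<in> path_event \<mu> N P X" using elim by (simp add: path_event_def)
    ultimately show ?case by simp
  qed
  have "functional_expectation \<mu> N P X F - (\<integral>\<omega>. F (step_fun A j (\<lambda>i. X (\<tau> i) \<omega>)) \<partial>P)
      = (\<integral>\<omega>. indicator (path_event \<mu> N P X) \<omega> *\<^sub>R F (\<lambda>t. X t \<omega>) - F (step_fun A j (\<lambda>i. X (\<tau> i) \<omega>)) \<partial>P)"
    unfolding functional_expectation_def set_lebesgue_integral_def
    using i1 i2 by (rule Bochner_Integration.integral_diff[symmetric, rotated])
  also have "\<bar>\<dots>\<bar> \<le> (\<integral>\<omega>. L * ?n \<omega> \<partial>P)"
  proof -
    have "\<bar>(\<integral>\<omega>. indicator (path_event \<mu> N P X) \<omega> *\<^sub>R F (\<lambda>t. X t \<omega>) - F (step_fun A j (\<lambda>i. X (\<tau> i) \<omega>)) \<partial>P)\<bar>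
      \<le> (\<integral>\<omega>. \<bar>indicator (path_event \<mu> N P X) \<omega> *\<^sub>R F (\<lambda>t. X t \<omega>) - F (step_fun A j (\<lambda>i. X (\<tau> i) \<omega>))\<bar> \<partial>P)"
      by (rule integral_abs_bound)
    also have "\<dots> \<le> (\<integral>\<omega>. L * ?n \<omega> \<partial>P)"
      using i1 i2 n_int pw by (intro integral_mono_AE) auto
    finally show ?thesis .
  qed
  also have "\<dots> \<le> L * e" using n_exp L(1) by (simp add: mult_left_mono)
  finally show ?thesis .
qed

end

subsection \<open>Normed sums of independent copies\<close>

lemma measurable_field_path:
  assumes "measurable_field \<mu> P X"
  shows "field_path \<mu> X \<in> measurable P (\<Pi>\<^sub>M t\<in>space \<mu>. borel)"
  unfolding field_path_def[abs_def] by (intro measurable_restrict measurable_field_section(2)[OF assms])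

lemma measurable_normed_sum:
  assumes "\<And>i. 1 \<le> i \<Longrightarrow> measurable_field \<mu> Q (Y i)"
  shows "measurable_field \<mu> Q (normed_sum Y n)"
proof -
  have "(\<lambda>z. Y i (fst z) (snd z)) \<in> borel_measurable (\<mu> \<Otimes>\<^sub>M Q)" if "i \<in> {1..n}" for i
    using assms[of i] that by (simp add: measurable_field_def split_beta')
  then show ?thesis
    unfolding measurable_field_def normed_sum_def split_beta'
    by (intro borel_measurable_divide borel_measurable_sum borel_measurable_const)
qed

locale iid_copies = P: prob_space P + Q: prob_space Q
  for \<mu> :: "'t measure" and P :: "'w measure" and \<xi> :: "'t \<Rightarrow> 'w \<Rightarrow> real"
    and Q :: "'v measure" and Y :: "nat \<Rightarrow> 't \<Rightarrow> 'v \<Rightarrow> real" +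
  assumes field: "measurable_field \<mu> P \<xi>" and copies: "independent_copies \<mu> P \<xi> Q Y"
begin

lemma field_copy: "1 \<le> i \<Longrightarrow> measurable_field \<mu> Q (Y i)"
  using copies by (simp add: independent_copies_def)

lemma law_copy:
  assumes i: "1 \<le> i" and \<phi>: "\<phi> \<in> borel_measurable (\<Pi>\<^sub>M t\<in>space \<mu>. borel)"
  shows "distr Q borel (\<lambda>\<omega>. \<phi> (field_path \<mu> (Y i) \<omega>)) = distr P borel (\<lambda>\<omega>. \<phi> (field_path \<mu> \<xi> \<omega>))"
proof -
  have "distr (distr Q (\<Pi>\<^sub>M t\<in>space \<mu>. borel) (field_path \<mu> (Y i))) borel \<phi>
      = distr (distr P (\<Pi>\<^sub>M t\<in>space \<mu>. borel) (field_path \<mu> \<xi>)) borel \<phi>"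
    using copies i by (simp add: independent_copies_def)
  then show ?thesis
    using measurable_field_path[OF field_copy[OF i]] measurable_field_path[OF field] \<phi>
    by (simp add: distr_distr comp_def)
qed

lemma indep_copies:
  assumes \<phi>: "\<phi> \<in> borel_measurable (\<Pi>\<^sub>M t\<in>space \<mu>. borel)"
  shows "Q.indep_vars (\<lambda>_. borel) (\<lambda>i \<omega>. \<phi> (field_path \<mu> (Y i) \<omega>)) {1..}"
  using copies \<phi> unfolding independent_copies_def
  by (intro Q.indep_vars_compose2[where X="\<lambda>i. field_path \<mu> (Y i)" and Y="\<lambda>_. \<phi>"]) auto

text \<open>Equality in law and independence of the copies refer to the product sigma-algebra over
  the index set. Finite linear combinations of values are measurable for it, and they are what the
  Cramer-Wold argument requires.\<close>

lemma law_lincomb: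
  fixes \<tau> :: "nat \<Rightarrow> 't" and c :: "nat \<Rightarrow> real" and m :: nat
  assumes i: "1 \<le> i" and \<tau>: "\<And>j. j < m \<Longrightarrow> \<tau> j \<in> space \<mu>"
  shows "distr Q borel (\<lambda>\<omega>. \<Sum>j<m. c j * Y i (\<tau> j) \<omega>) = distr P borel (\<lambda>\<omega>. \<Sum>j<m. c j * \<xi> (\<tau> j) \<omega>)"
    and "Q.indep_vars (\<lambda>_. borel) (\<lambda>i \<omega>. \<Sum>j<m. c j * Y i (\<tau> j) \<omega>) {1..}"
proof -
  let ?\<phi> = "\<lambda>x. \<Sum>j<m. c j * x (\<tau> j)"
  have \<phi>: "?\<phi> \<in> borel_measurable (\<Pi>\<^sub>M t\<in>space \<mu>. borel)"
    using \<tau> by (intro borel_measurable_sum borel_measurable_times borel_measurable_const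
        measurable_component_singleton) auto
  show "distr Q borel (\<lambda>\<omega>. \<Sum>j<m. c j * Y i (\<tau> j) \<omega>) = distr P borel (\<lambda>\<omega>. \<Sum>j<m. c j * \<xi> (\<tau> j) \<omega>)"
    using law_copy[OF i \<phi>] \<tau> by (simp add: field_path_def)
  show "Q.indep_vars (\<lambda>_. borel) (\<lambda>i \<omega>. \<Sum>j<m. c j * Y i (\<tau> j) \<omega>) {1..}"
    using indep_copies[OF \<phi>] \<tau> by (simp add: field_path_def)
qed

lemma law_point:
  assumes i: "1 \<le> i" and t: "t \<in> space \<mu>"
  shows "distr Q borel (Y i t) = distr P borel (\<xi> t)" and "Q.indep_vars (\<lambda>_. borel) (\<lambda>i. Y i t) {1..}"
  using law_lincomb[OF i, where m = "Suc 0" and \<tau> = "\<lambda>_. t" and c = "\<lambda>_. 1"] t by auto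

lemma nn_integral_copy:
  assumes i: "1 \<le> i" and t: "t \<in> space \<mu>" and [measurable]: "h \<in> borel_measurable borel"
  shows "(\<integral>\<^sup>+\<omega>. h (Y i t \<omega>) \<partial>Q) = (\<integral>\<^sup>+\<omega>. h (\<xi> t \<omega>) \<partial>P)"
proof -
  have [measurable]: "Y i t \<in> borel_measurable Q" "\<xi> t \<in> borel_measurable P"
    using measurable_field_section(2)[OF field_copy[OF i] t] measurable_field_section(2)[OF field t] by auto
  have "(\<integral>\<^sup>+\<omega>. h (Y i t \<omega>) \<partial>Q) = (\<integral>\<^sup>+x. h x \<partial>distr Q borel (Y i t))" by (simp add: nn_integral_distr)
  also have "\<dots> = (\<integral>\<^sup>+\<omega>. h (\<xi> t \<omega>) \<partial>P)" unfolding law_point(1)[OF i t] by (simp add: nn_integral_distr)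
  finally show ?thesis .
qed

lemma expectation_lincomb_copy:
  fixes \<tau> :: "nat \<Rightarrow> 't" and c :: "nat \<Rightarrow> real" and m :: nat and h :: "real \<Rightarrow> real"
  assumes i: "1 \<le> i" and \<tau>: "\<And>j. j < m \<Longrightarrow> \<tau> j \<in> space \<mu>"
    and [measurable]: "h \<in> borel_measurable borel"
  shows "(\<integral>\<omega>. h (\<Sum>j<m. c j * Y i (\<tau> j) \<omega>) \<partial>Q) = (\<integral>\<omega>. h (\<Sum>j<m. c j * \<xi> (\<tau> j) \<omega>) \<partial>P :: real)"
    and "integrable Q (\<lambda>\<omega>. h (\<Sum>j<m. c j * Y i (\<tau> j) \<omega>)) \<longleftrightarrow> integrable P (\<lambda>\<omega>. h (\<Sum>j<m. c j * \<xi> (\<tau> j) \<omega>))"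
proof -
  have [measurable]: "(\<lambda>\<omega>. \<Sum>j<m. c j * Y i (\<tau> j) \<omega>) \<in> borel_measurable Q"
    "(\<lambda>\<omega>. \<Sum>j<m. c j * \<xi> (\<tau> j) \<omega>) \<in> borel_measurable P"
    using measurable_field_section(2)[OF field_copy[OF i] \<tau>] measurable_field_section(2)[OF field \<tau>]
    by (intro borel_measurable_sum borel_measurable_times borel_measurable_const; simp)+
  have law: "distr Q borel (\<lambda>\<omega>. \<Sum>j<m. c j * Y i (\<tau> j) \<omega>) = distr P borel (\<lambda>\<omega>. \<Sum>j<m. c j * \<xi> (\<tau> j) \<omega>)"
    by (rule law_lincomb(1)[OF i]) (rule \<tau>)
  show "(\<integral>\<omega>. h (\<Sum>j<m. c j * Y i (\<tau> j) \<omega>) \<partial>Q) = (\<integral>\<omega>. h (\<Sum>j<m. c j * \<xi> (\<tau> j) \<omega>) \<partial>P)"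
    using arg_cong[OF law, where f = "\<lambda>M. \<integral>x. h x \<partial>M"] by (simp add: integral_distr)
  show "integrable Q (\<lambda>\<omega>. h (\<Sum>j<m. c j * Y i (\<tau> j) \<omega>)) \<longleftrightarrow> integrable P (\<lambda>\<omega>. h (\<Sum>j<m. c j * \<xi> (\<tau> j) \<omega>))"
    using arg_cong[OF law, where f = "\<lambda>M. integrable M h"] by (simp add: integrable_distr_eq)
qed

end

section \<open>Second moments and Gaussian linear combinations\<close>

lemma integrable_mult_of_squares:
  fixes f g :: "'a \<Rightarrow> real"
  assumes "integrable M (\<lambda>x. (f x)\<^sup>2)" "integrable M (\<lambda>x. (g x)\<^sup>2)"
    and [measurable]: "f \<in> borel_measurable M" "g \<in> borel_measurable M"
  shows "integrable M (\<lambda>x. f x * g x)"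
proof (rule Bochner_Integration.integrable_bound)
  show "integrable M (\<lambda>x. (f x)\<^sup>2 + (g x)\<^sup>2)" using assms by simp
  have "\<bar>a * b\<bar> \<le> a\<^sup>2 + b\<^sup>2" for a b :: real
  proof -
    have "0 \<le> (\<bar>a\<bar> - \<bar>b\<bar>)\<^sup>2" by simp
    then have "2 * (\<bar>a\<bar> * \<bar>b\<bar>) \<le> a\<^sup>2 + b\<^sup>2" by (simp add: power2_diff)
    moreover have "0 \<le> \<bar>a\<bar> * \<bar>b\<bar>" by simp
    ultimately show ?thesis unfolding abs_mult by linarith
  qed
  then show "AE x in M. norm (f x * g x) \<le> norm ((f x)\<^sup>2 + (g x)\<^sup>2)"
    by (intro AE_I2) simp
qed measurable

lemma second_moment_lincomb:
  fixes X :: "'t \<Rightarrow> 'w \<Rightarrow> real" and \<tau> :: "nat \<Rightarrow> 't" and c :: "nat \<Rightarrow> real" and m :: nat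
  assumes sq: "\<And>j. j < m \<Longrightarrow> integrable M (\<lambda>\<omega>. (X (\<tau> j) \<omega>)\<^sup>2)"
    and meas: "\<And>j. j < m \<Longrightarrow> X (\<tau> j) \<in> borel_measurable M"
  shows "integrable M (\<lambda>\<omega>. (\<Sum>j<m. c j * X (\<tau> j) \<omega>)\<^sup>2)"
    and "(\<integral>\<omega>. (\<Sum>j<m. c j * X (\<tau> j) \<omega>)\<^sup>2 \<partial>M) = (\<Sum>i<m. \<Sum>j<m. c i * c j * (\<integral>\<omega>. X (\<tau> i) \<omega> * X (\<tau> j) \<omega> \<partial>M))"
proof -
  have eq: "(\<Sum>j<m. c j * X (\<tau> j) \<omega>)\<^sup>2 = (\<Sum>i<m. \<Sum>j<m. c i * c j * (X (\<tau> i) \<omega> * X (\<tau> j) \<omega>))" for \<omega>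
    unfolding power2_eq_square sum_product by (intro sum.cong refl) (simp add: ac_simps)
  have int: "integrable M (\<lambda>\<omega>. c i * c j * (X (\<tau> i) \<omega> * X (\<tau> j) \<omega>))" if "i < m" "j < m" for i j
    using that by (intro integrable_mult_right integrable_mult_of_squares sq meas)
  show "integrable M (\<lambda>\<omega>. (\<Sum>j<m. c j * X (\<tau> j) \<omega>)\<^sup>2)"
    unfolding eq using int by (intro Bochner_Integration.integrable_sum) auto
  show "(\<integral>\<omega>. (\<Sum>j<m. c j * X (\<tau> j) \<omega>)\<^sup>2 \<partial>M) = (\<Sum>i<m. \<Sum>j<m. c i * c j * (\<integral>\<omega>. X (\<tau> i) \<omega> * X (\<tau> j) \<omega> \<partial>M))"
  proof -
    have "(\<integral>\<omega>. (\<Sum>j<m. c j * X (\<tau> j) \<omega>)\<^sup>2 \<partial>M) = (\<Sum>i<m. \<integral>\<omega>. (\<Sum>j<m. c i * c j * (X (\<tau> i) \<omega> * X (\<tau> j) \<omega>)) \<partial>M)"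
      unfolding eq using int by (intro Bochner_Integration.integral_sum Bochner_Integration.integrable_sum) auto
    also have "\<dots> = (\<Sum>i<m. \<Sum>j<m. \<integral>\<omega>. c i * c j * (X (\<tau> i) \<omega> * X (\<tau> j) \<omega>) \<partial>M)"
      using int by (intro sum.cong refl Bochner_Integration.integral_sum) auto
    finally show ?thesis by simp
  qed
qed

text \<open>The points \<open>\<tau> j\<close> may coincide, whereas a Gaussian field is defined
  through sums over sets of points; the coefficients belonging to one point are collected
  first.\<close>

lemma centered_gaussian_lincomb:
  fixes \<tau> :: "nat \<Rightarrow> 't" and c :: "nat \<Rightarrow> real" and m :: nat
  assumes G: "centered_gaussian_field \<mu> R Z" and \<tau>: "\<And>j. j < m \<Longrightarrow> \<tau> j \<in> space \<mu>"
  shows "centered_gaussian R (\<lambda>\<omega>. \<Sum>j<m. c j * Z (\<tau> j) \<omega>)"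
proof -
  have "(\<Sum>j<m. c j * Z (\<tau> j) \<omega>) = (\<Sum>t\<in>\<tau> ` {..<m}. (\<Sum>j | j \<in> {..<m} \<and> \<tau> j = t. c j) * Z t \<omega>)" for \<omega>
  proof -
    have "(\<Sum>j<m. c j * Z (\<tau> j) \<omega>) = (\<Sum>t\<in>\<tau> ` {..<m}. \<Sum>j | j \<in> {..<m} \<and> \<tau> j = t. c j * Z (\<tau> j) \<omega>)"
      by (rule sum.image_gen) simp
    then show ?thesis by (simp add: sum_distrib_right)
  qed
  then show ?thesis
    using G \<tau> unfolding centered_gaussian_field_def by (simp add: image_subset_iff)
qed

lemma centered_gaussian_point:
  assumes G: "centered_gaussian_field \<mu> R Z" and t: "t \<in> space \<mu>"
  shows "centered_gaussian R (Z t)"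
  using centered_gaussian_lincomb[OF G, where m = "Suc 0" and \<tau> = "\<lambda>_. t" and c = "\<lambda>_. 1"] t by simp

lemma Lp_norm_le_imp:
  assumes "Lp_norm P p \<eta> \<le> ennreal b" "0 < p" "0 \<le> b"
  shows "(\<integral>\<^sup>+\<omega>. ennreal (\<bar>\<eta> \<omega>\<bar> powr p) \<partial>P) \<le> ennreal (b powr p)"
proof -
  let ?I = "\<integral>\<^sup>+\<omega>. ennreal (\<bar>\<eta> \<omega>\<bar> powr p) \<partial>P"
  have fin: "?I \<noteq> \<infinity>" using assms(1) by (auto simp: Lp_norm_def Let_def top_unique)
  then have "ennreal (enn2real ?I powr (1 / p)) \<le> ennreal b" using assms(1) by (simp add: Lp_norm_def Let_def)
  then have "enn2real ?I powr (1 / p) \<le> b" using assms(3) by (simp add: ennreal_le_iff)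
  then have "(enn2real ?I powr (1 / p)) powr p \<le> b powr p" using assms(2) by (intro powr_mono2) auto
  then have "enn2real ?I \<le> b powr p" using assms(2) by (simp add: powr_powr)
  then have "ennreal (enn2real ?I) \<le> ennreal (b powr p)" by (rule ennreal_leI)
  moreover have "ennreal (enn2real ?I) = ?I" using fin by (simp add: less_top)
  ultimately show ?thesis by (simp only:)
qed

text \<open>Lyapunov's inequality, obtained from Young's inequality for \<open>1\<close> and
  \<open>\<bar>X \<omega>\<bar> / b\<close>. It lets the bound on \<open>p\<close>-th moments
  control the variance, which is all that determines the Gaussian limit at a point.\<close>

lemma (in prob_space) second_moment_le:
  assumes [measurable]: "X \<in> borel_measurable M" and p: "2 < p" and b: "0 < b"
    and mom: "(\<integral>\<^sup>+\<omega>. ennreal (\<bar>X \<omega>\<bar> powr p) \<partial>M) \<le> ennreal (b powr p)"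
  shows "integrable M (\<lambda>\<omega>. \<bar>X \<omega>\<bar> powr p)" "expectation (\<lambda>\<omega>. \<bar>X \<omega>\<bar> powr p) \<le> b powr p"
    and "expectation (\<lambda>\<omega>. (X \<omega>)\<^sup>2) \<le> b\<^sup>2"
proof -
  show int: "integrable M (\<lambda>\<omega>. \<bar>X \<omega>\<bar> powr p)"
    by (rule integrableI_nonneg) (use le_less_trans[OF mom ennreal_less_top] in auto)
  show E: "expectation (\<lambda>\<omega>. \<bar>X \<omega>\<bar> powr p) \<le> b powr p"
    using mom int by (subst (asm) nn_integral_eq_integral) auto
  have pw: "(X \<omega>)\<^sup>2 \<le> b\<^sup>2 * ((1 - 2 / p) + 2 / p * (\<bar>X \<omega>\<bar> powr p / b powr p))" for \<omega>
  proof -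
    have "1 powr (p - 2) * (\<bar>X \<omega>\<bar> / b)\<^sup>2 \<le> (1 - 2 / p) * 1 powr p + 2 / p * (\<bar>X \<omega>\<bar> / b) powr p"
      using b p by (intro Young_powr_mult_square) auto
    then have "(\<bar>X \<omega>\<bar> / b)\<^sup>2 \<le> (1 - 2 / p) + 2 / p * (\<bar>X \<omega>\<bar> powr p / b powr p)"
      using b by (simp add: powr_divide)
    then have "b\<^sup>2 * (\<bar>X \<omega>\<bar> / b)\<^sup>2 \<le> b\<^sup>2 * ((1 - 2 / p) + 2 / p * (\<bar>X \<omega>\<bar> powr p / b powr p))"
      by (intro mult_left_mono) auto
    then show ?thesis using b by (simp add: power_divide)
  qed
  have "integrable M (\<lambda>\<omega>. \<bar>X \<omega>\<bar> powr 2)" using p by (intro integrable_powr_lower[OF int]) auto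
  then have "expectation (\<lambda>\<omega>. (X \<omega>)\<^sup>2) \<le> expectation (\<lambda>\<omega>. b\<^sup>2 * ((1 - 2 / p) + 2 / p * (\<bar>X \<omega>\<bar> powr p / b powr p)))"
    using int pw by (intro integral_mono) (auto simp: powr_numeral)
  also have "\<dots> = b\<^sup>2 * ((1 - 2 / p) + 2 / p * (expectation (\<lambda>\<omega>. \<bar>X \<omega>\<bar> powr p) / b powr p))"
    using int by (simp add: prob_space)
  also have "\<dots> \<le> b\<^sup>2 * ((1 - 2 / p) + 2 / p * 1)"
    using E b p by (intro mult_left_mono add_left_mono) auto
  finally show "expectation (\<lambda>\<omega>. (X \<omega>)\<^sup>2) \<le> b\<^sup>2" by simp
qed

context iid_copies
begin

lemma moment_normed_sum:
  assumes t: "t \<in> space \<mu>" and p: "2 < p" and b: "0 < b" and mean: "(\<integral>\<omega>. \<xi> t \<omega> \<partial>P) = 0"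
    and mom: "(\<integral>\<^sup>+\<omega>. ennreal (\<bar>\<xi> t \<omega>\<bar> powr p) \<partial>P) \<le> ennreal (b powr p)" and n: "1 \<le> n"
  shows "(\<integral>\<^sup>+\<omega>. ennreal (\<bar>normed_sum Y n t \<omega>\<bar> powr p) \<partial>Q) \<le> ennreal ((4 * sqrt p * b) powr p)"
proof -
  have Ym [measurable]: "Y i t \<in> borel_measurable Q" if "1 \<le> i" for i
    using measurable_field_section(2)[OF field_copy[OF that] t] .
  have momY: "(\<integral>\<^sup>+\<omega>. ennreal (\<bar>Y i t \<omega>\<bar> powr p) \<partial>Q) \<le> ennreal (b powr p)" if "1 \<le> i" for i
    using nn_integral_copy[OF that t, of "\<lambda>x. ennreal (\<bar>x\<bar> powr p)"] mom by simp
  have meanY: "Q.expectation (Y i t) = 0" if "1 \<le> i" for i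
    using expectation_lincomb_copy(1)[OF that, where m = "Suc 0" and \<tau> = "\<lambda>_. t" and h = "\<lambda>x. x" and c = "\<lambda>_. 1"] t mean by simp
  let ?S = "\<lambda>\<omega>. \<bar>\<Sum>i=1..n. Y i t \<omega>\<bar> powr p"
  have S: "integrable Q ?S" "Q.expectation ?S \<le> (4 * sqrt p * sqrt n * b) powr p"
    using Q.moment_sum_le[OF law_point(2)[OF order_refl t] p b Q.second_moment_le(1)[OF Ym p b momY]
        Q.second_moment_le(2)[OF Ym p b momY] meanY, of n] by auto
  have sn: "sqrt n > 0" using n by simp
  have eq: "\<bar>normed_sum Y n t \<omega>\<bar> powr p = ?S \<omega> / sqrt n powr p" for \<omega>
    using sn by (simp add: normed_sum_def powr_divide)
  have "(\<integral>\<^sup>+\<omega>. ennreal (\<bar>normed_sum Y n t \<omega>\<bar> powr p) \<partial>Q) = ennreal (\<integral>\<omega>. ?S \<omega> / sqrt n powr p \<partial>Q)"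
    unfolding eq using S(1) by (intro nn_integral_eq_integral) auto
  also have "\<dots> = ennreal (Q.expectation ?S / sqrt n powr p)" by simp
  also have "\<dots> \<le> ennreal ((4 * sqrt p * sqrt n * b) powr p / sqrt n powr p)"
    using S(2) by (intro ennreal_leI divide_right_mono) auto
  also have "(4 * sqrt p * sqrt n * b) powr p / sqrt n powr p = (4 * sqrt p * b) powr p"
  proof -
    have "(4 * sqrt p * sqrt n * b) powr p = (4 * sqrt p * b) powr p * sqrt n powr p"
      using p b by (simp add: powr_mult)
    then show ?thesis using sn by simp
  qed
  finally show ?thesis .
qed

text \<open>The Cramer-Wold device: for fixed \<open>c\<close>, the combination is a normed sum of
  independent scalars of variance \<open>v\<close>, and the same combination of the Gaussian field
  has variance \<open>v\<close> because the covariances agree. Both sides lead to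
  \<open>exp (- v / 2)\<close>.\<close>

lemma char_normed_sum:
  fixes \<tau> :: "nat \<Rightarrow> 't" and c :: "nat \<Rightarrow> real" and m :: nat
  assumes G: "centered_gaussian_field \<mu> R Z" and R: "prob_space R"
    and cov: "\<And>s t. s \<in> space \<mu> \<Longrightarrow> t \<in> space \<mu> \<Longrightarrow> (\<integral>\<omega>. Z s \<omega> * Z t \<omega> \<partial>R) = (\<integral>\<omega>. \<xi> s \<omega> * \<xi> t \<omega> \<partial>P)"
    and mean: "\<And>t. t \<in> space \<mu> \<Longrightarrow> integrable P (\<xi> t) \<and> (\<integral>\<omega>. \<xi> t \<omega> \<partial>P) = 0"
    and sq: "\<And>t. t \<in> space \<mu> \<Longrightarrow> integrable P (\<lambda>\<omega>. (\<xi> t \<omega>)\<^sup>2)"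
    and \<tau>: "\<And>j. \<tau> j \<in> space \<mu>"
  shows "(\<lambda>n. CLINT \<omega>|Q. iexp (\<Sum>j<m. c j * normed_sum Y n (\<tau> j) \<omega>)) \<longlonglongrightarrow> (CLINT \<omega>|R. iexp (\<Sum>j<m. c j * Z (\<tau> j) \<omega>))"
proof -
  interpret R: prob_space R by fact
  define v where "v = (\<integral>\<omega>. (\<Sum>j<m. c j * \<xi> (\<tau> j) \<omega>)\<^sup>2 \<partial>P)"
  have \<xi>m: "\<xi> (\<tau> j) \<in> borel_measurable P" for j by (rule measurable_field_section(2)[OF field \<tau>])
  have gp: "centered_gaussian R (Z (\<tau> j))" for j by (rule centered_gaussian_point[OF G \<tau>])
  then have Zm: "Z (\<tau> j) \<in> borel_measurable R" for j by (simp add: centered_gaussian_def)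
  have "(\<integral>\<omega>. (\<Sum>j<m. c j * Z (\<tau> j) \<omega>)\<^sup>2 \<partial>R) = (\<Sum>i<m. \<Sum>j<m. c i * c j * (\<integral>\<omega>. Z (\<tau> i) \<omega> * Z (\<tau> j) \<omega> \<partial>R))"
    by (intro second_moment_lincomb R.integrable_square_centered_gaussian gp Zm)
  also have "\<dots> = v"
    unfolding v_def using sq[OF \<tau>] \<xi>m by (subst second_moment_lincomb(2)) (auto simp: cov[OF \<tau> \<tau>])
  finally have "(CLINT \<omega>|R. iexp (\<Sum>j<m. c j * Z (\<tau> j) \<omega>)) = complex_of_real (exp (- v / 2))"
    using R.char_centered_gaussian[OF centered_gaussian_lincomb[OF G \<tau>, where m = m and c = c]] by simp
  moreover have "(\<lambda>n. CLINT \<omega>|Q. iexp ((\<Sum>i=1..n. \<Sum>j<m. c j * Y i (\<tau> j) \<omega>) / sqrt n)) \<longlonglongrightarrow> complex_of_real (exp (- v / 2))"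
  proof (rule Q.char_CLT)
    show "Q.indep_vars (\<lambda>_. borel) (\<lambda>i \<omega>. \<Sum>j<m. c j * Y i (\<tau> j) \<omega>) {1..}"
      by (rule law_lincomb(2)[OF order_refl \<tau>])
    have s: "integrable P (\<lambda>\<omega>. (\<Sum>j<m. c j * \<xi> (\<tau> j) \<omega>)\<^sup>2)"
      by (intro second_moment_lincomb(1) sq[OF \<tau>] \<xi>m)
    have z: "(\<integral>\<omega>. (\<Sum>j<m. c j * \<xi> (\<tau> j) \<omega>) \<partial>P) = 0"
      using mean[OF \<tau>] by (subst Bochner_Integration.integral_sum) auto
    fix i :: nat assume i: "1 \<le> i"
    show "integrable Q (\<lambda>\<omega>. (\<Sum>j<m. c j * Y i (\<tau> j) \<omega>)\<^sup>2)"
      using expectation_lincomb_copy(2)[OF i, where m = m and \<tau> = \<tau> and h = "\<lambda>x. x\<^sup>2" and c = c] \<tau> s by simp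
    show "Q.expectation (\<lambda>\<omega>. \<Sum>j<m. c j * Y i (\<tau> j) \<omega>) = 0"
      using expectation_lincomb_copy(1)[OF i, where m = m and \<tau> = \<tau> and h = "\<lambda>x. x" and c = c] \<tau> z by simp
    show "distr Q borel (\<lambda>\<omega>. \<Sum>j<m. c j * Y i (\<tau> j) \<omega>) = distr P borel (\<lambda>\<omega>. \<Sum>j<m. c j * \<xi> (\<tau> j) \<omega>)"
      by (rule law_lincomb(1)[OF i \<tau>])
  next
    show "Q.expectation (\<lambda>\<omega>. (\<Sum>j<m. c j * Y 1 (\<tau> j) \<omega>)\<^sup>2) = v"
      unfolding v_def using expectation_lincomb_copy(1)[OF order_refl, where m = m and \<tau> = \<tau> and h = "\<lambda>x. x\<^sup>2" and c = c] \<tau> by simp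
  qed
  moreover have "(\<Sum>i=1..n. \<Sum>j<m. c j * Y i (\<tau> j) \<omega>) / sqrt n = (\<Sum>j<m. c j * normed_sum Y n (\<tau> j) \<omega>)" for n \<omega>
    unfolding normed_sum_def
    by (subst sum.swap) (simp add: sum_divide_distrib sum_distrib_left)
  ultimately show ?thesis by (simp only:)
qed

end

subsection \<open>The central limit theorem\<close>

theorem theorem4p2:
  fixes \<mu> :: "'t measure" and N :: "('t \<Rightarrow> ennreal) \<Rightarrow> ennreal"
    and P :: "'w measure" and \<xi> :: "'t \<Rightarrow> 'w \<Rightarrow> real"
    and Q :: "'v measure" and \<xi>s :: "nat \<Rightarrow> 't \<Rightarrow> 'v \<Rightarrow> real"
    and R :: "'u measure" and S_inf :: "'t \<Rightarrow> 'u \<Rightarrow> real"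
    and \<psi> :: "real \<Rightarrow> real" and a :: real
  defines "S \<equiv> extremal_points \<mu> N"
  assumes "separable_measure \<mu>"
    and "rearrangement_invariant_norm \<mu> N"
    and "separable_fspace \<mu> N"
    and norming: "\<And>f. f \<in> fspace \<mu> N \<Longrightarrow>
      enn2ereal (fs_norm N f) = (SUP g\<in>S. ereal (pairing \<mu> g f))"
    \<comment> \<open>the random field\<close>
    and "prob_space P" and "measurable_field \<mu> P \<xi>" and "separable_field \<mu> P \<xi>"
    and "\<And>t. t \<in> space \<mu> \<Longrightarrow> integrable P (\<xi> t) \<and> (\<integral>\<omega>. \<xi> t \<omega> \<partial>P) = 0"
    and "(SUP t\<in>space \<mu>. \<integral>\<^sup>+\<omega>. ennreal ((\<xi> t \<omega>)\<^sup>2) \<partial>P) < \<infinity>"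
    \<comment> \<open>the field is pregaussian\<close>
    and "prob_space R" and "measurable_field \<mu> R S_inf" and "centered_gaussian_field \<mu> R S_inf"
    and "\<And>s t. s \<in> space \<mu> \<Longrightarrow> t \<in> space \<mu> \<Longrightarrow>
      (\<integral>\<omega>. S_inf s \<omega> * S_inf t \<omega> \<partial>R) = (\<integral>\<omega>. \<xi> s \<omega> * \<xi> t \<omega> \<partial>P)"
    and "AE \<omega> in R. (\<lambda>t. S_inf t \<omega>) \<in> fspace \<mu> N"
    \<comment> \<open>independent copies\<close>
    and "prob_space Q" and "independent_copies \<mu> P \<xi> Q \<xi>s"
    \<comment> \<open>the function \<open>\<psi>\<close>, equal to or majorizing the natural function\<close>
    and "1 \<le> a" and "a \<le> 2"
    and "continuous_on {a<..} \<psi>" and "\<And>p. p > a \<Longrightarrow> \<psi> p > 0" and "(INF p\<in>{a<..}. \<psi> p) > 0"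
    and "\<And>p. p > a \<Longrightarrow> natural_fun \<mu> P \<xi> p \<le> ennreal (\<psi> p)"
    and "(SUP t\<in>space \<mu>. grand_norm P {a<..} \<psi> (\<xi> t)) = 1"
    \<comment> \<open>the hypotheses on the associate space\<close>
    and "\<And>g. g \<in> assoc_space \<mu> N \<Longrightarrow> AE \<omega> in P. integrable \<mu> (\<lambda>t. \<xi> t \<omega> * g t)"
    and "diam S (L1_dist \<mu>) < \<infinity>"
    and "entropy_integral \<psi> S (L1_dist \<mu>) < \<infinity>"
  shows "central_limit_theorem_in \<mu> N Q (normed_sum \<xi>s) R S_inf"
proof -
  have [simp]: "S = extremal_points \<mu> N" by (simp add: S_def)
  interpret P: prob_space P by fact
  interpret Q: prob_space Q by fact
  interpret R: prob_space R by fact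
  have banach: "banach_function_norm \<mu> N"
    using \<open>rearrangement_invariant_norm \<mu> N\<close> by (simp add: rearrangement_invariant_norm_def)
  have "normed_by_ext \<mu> N"
    using banach \<open>separable_fspace \<mu> N\<close> norming
    by (simp add: normed_by_ext_def normed_by_ext_axioms_def)
  then interpret normed_by_ext \<mu> N .
  have \<psi>: "0 < \<psi> p" if "2 < p" for p
    using that \<open>a \<le> 2\<close> \<open>\<And>p. p > a \<Longrightarrow> \<psi> p > 0\<close> by force
  have diam: "diam ext (L1_dist \<mu>) < \<infinity>" and ent: "entropy_integral \<psi> ext (L1_dist \<mu>) < \<infinity>"
    using \<open>diam S (L1_dist \<mu>) < \<infinity>\<close> \<open>entropy_integral \<psi> S (L1_dist \<mu>) < \<infinity>\<close> by simp_all
  obtain net \<delta> q where nets: "\<And>k. finite (net k)" "\<And>k. net k \<subseteq> ext"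
    "\<And>k g. g \<in> ext \<Longrightarrow> \<exists>c\<in>net k. L1_dist \<mu> c g \<le> ennreal (\<delta> k)"
    "\<And>k. 0 \<le> \<delta> k" "\<delta> \<longlonglongrightarrow> 0" "\<And>k. 2 < q k"
    "summable (\<lambda>k. \<delta> k * (real (card (net (Suc k))) powr (1 / q (Suc k)) * psi_R \<psi> (q (Suc k))))"
    using entropy_nets[where \<psi> = \<psi>, OF ext_nonempty \<psi> diam ent] by blast
  interpret chaining \<mu> N net \<delta> q "psi_R \<psi>"
    by unfold_locales (use nets psi_R_pos \<psi> in auto)
  \<comment> \<open>Both \<open>g\<close> and \<open>- g\<close> are extremal and their distance is
    twice the L1 norm of \<open>g\<close>, so the finite diameter makes every extremal point
    integrable.\<close>
  have L1: "(\<integral>\<^sup>+t. ennreal \<bar>g t\<bar> \<partial>\<mu>) < \<infinity>" if g: "g \<in> ext" for g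
  proof -
    have "(\<integral>\<^sup>+t. ennreal \<bar>g t\<bar> \<partial>\<mu>) \<le> L1_dist \<mu> g (\<lambda>t. - g t)"
      unfolding L1_dist_def by (intro nn_integral_mono ennreal_leI) simp
    also have "\<dots> \<le> diam ext (L1_dist \<mu>)"
      unfolding diam_def using g uminus_ext[OF g] by (intro SUP_upper2[of g] SUP_upper)
    finally show ?thesis using diam by (rule le_less_trans)
  qed
  have iid_copies: "iid_copies \<mu> P \<xi> Q \<xi>s"
    using \<open>measurable_field \<mu> P \<xi>\<close> \<open>independent_copies \<mu> P \<xi> Q \<xi>s\<close> P.prob_space_axioms Q.prob_space_axioms
    by (simp add: iid_copies_def iid_copies_axioms_def)
  then interpret iid: iid_copies \<mu> P \<xi> Q \<xi>s .
  have \<xi>m: "\<xi> t \<in> borel_measurable P" if "t \<in> space \<mu>" for t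
    using \<open>measurable_field \<mu> P \<xi>\<close> that by (rule measurable_field_section(2))
  have mom: "(\<integral>\<^sup>+\<omega>. ennreal (\<bar>\<xi> t \<omega>\<bar> powr p) \<partial>P) \<le> ennreal (\<psi> p powr p)"
    if t: "t \<in> space \<mu>" and p: "2 < p" for t p
  proof -
    have "Lp_norm P p (\<xi> t) \<le> natural_fun \<mu> P \<xi> p"
      unfolding natural_fun_def using t by (rule SUP_upper)
    also have "\<dots> \<le> ennreal (\<psi> p)"
      using p \<open>a \<le> 2\<close> by (intro \<open>\<And>p. p > a \<Longrightarrow> natural_fun \<mu> P \<xi> p \<le> ennreal (\<psi> p)\<close>) simp
    finally show ?thesis using p \<psi>[OF p] by (intro Lp_norm_le_imp) auto
  qed
  have mean: "integrable P (\<xi> t) \<and> (\<integral>\<omega>. \<xi> t \<omega> \<partial>P) = 0" if "t \<in> space \<mu>" for t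
    using that by fact
  have sq: "integrable P (\<lambda>\<omega>. (\<xi> t \<omega>)\<^sup>2)" if t: "t \<in> space \<mu>" for t
  proof (rule integrableI_nonneg)
    have "(\<integral>\<^sup>+\<omega>. ennreal ((\<xi> t \<omega>)\<^sup>2) \<partial>P) \<le> (SUP t\<in>space \<mu>. \<integral>\<^sup>+\<omega>. ennreal ((\<xi> t \<omega>)\<^sup>2) \<partial>P)"
      using t by (rule SUP_upper)
    then show "(\<integral>\<^sup>+\<omega>. ennreal ((\<xi> t \<omega>)\<^sup>2) \<partial>P) < \<infinity>"
      using \<open>(SUP t\<in>space \<mu>. \<integral>\<^sup>+\<omega>. ennreal ((\<xi> t \<omega>)\<^sup>2) \<partial>P) < \<infinity>\<close> by (rule le_less_trans)
    show "(\<lambda>\<omega>. (\<xi> t \<omega>)\<^sup>2) \<in> borel_measurable P" using \<xi>m[OF t] by measurable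
  qed simp
  have G: "centered_gaussian_field \<mu> R S_inf" by fact
  have cov: "(\<integral>\<omega>. S_inf s \<omega> * S_inf t \<omega> \<partial>R) = (\<integral>\<omega>. \<xi> s \<omega> * \<xi> t \<omega> \<partial>P)"
    if "s \<in> space \<mu>" "t \<in> space \<mu>" for s t
    using that by fact
  have var: "(\<integral>\<omega>. (S_inf t \<omega>)\<^sup>2 \<partial>R) = (\<integral>\<omega>. (\<xi> t \<omega>)\<^sup>2 \<partial>P)" if "t \<in> space \<mu>" for t
    using cov[OF that that] by (simp add: power2_eq_square)
  have scale: "4 * sqrt p * \<psi> p \<le> 8 * psi_R \<psi> p" if p: "2 < p" for p
  proof -
    have "4 * sqrt p * \<psi> p \<le> 8 * (Rosenthal_const * p / ln p) * \<psi> p"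
      using sqrt_le_ratio_ln[OF p] \<psi>[OF p] by (intro mult_right_mono) auto
    then show ?thesis by (simp add: psi_R_def)
  qed
  have mb_sum: "moment_bounded Q (normed_sum \<xi>s n) 8" if n: "1 \<le> n" for n
    unfolding moment_bounded_def
  proof (intro conjI ballI allI impI Q.prob_space_axioms measurable_normed_sum)
    fix t and p :: real assume t: "t \<in> space \<mu>" and p: "2 < p"
    have "(\<integral>\<^sup>+\<omega>. ennreal (\<bar>normed_sum \<xi>s n t \<omega>\<bar> powr p) \<partial>Q) \<le> ennreal ((4 * sqrt p * \<psi> p) powr p)"
      using mean[OF t] by (intro iid.moment_normed_sum[OF t p \<psi>[OF p] _ mom[OF t p] n]) simp
    also have "\<dots> \<le> ennreal ((8 * psi_R \<psi> p) powr p)"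
      using scale[OF p] p \<psi>[OF p] by (intro ennreal_leI powr_mono2) auto
    finally show "(\<integral>\<^sup>+\<omega>. ennreal (\<bar>normed_sum \<xi>s n t \<omega>\<bar> powr p) \<partial>Q) \<le> ennreal ((8 * psi_R \<psi> p) powr p)" .
  qed (use iid.field_copy in auto)
  \<comment> \<open>The variance of the limit at \<open>t\<close> is that of \<open>\<xi> t\<close>,
    hence at most the square of \<open>\<psi> p\<close> for every \<open>p > 2\<close>. With the
    Gaussian constant \<open>2 * sqrt p\<close> the same \<open>K = 8\<close> works as for the
    sums.\<close>
  have mb_lim: "moment_bounded R S_inf 8"
    unfolding moment_bounded_def
  proof (intro conjI ballI allI impI R.prob_space_axioms)
    show "measurable_field \<mu> R S_inf" by fact
    fix t and p :: real assume t: "t \<in> space \<mu>" and p: "2 < p"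
    have "(\<integral>\<omega>. (S_inf t \<omega>)\<^sup>2 \<partial>R) \<le> (\<psi> p)\<^sup>2"
      unfolding var[OF t] by (rule P.second_moment_le(3)[OF \<xi>m[OF t] p \<psi>[OF p] mom[OF t p]])
    then have "(\<integral>\<^sup>+\<omega>. ennreal (\<bar>S_inf t \<omega>\<bar> powr p) \<partial>R) \<le> ennreal ((2 * sqrt p * \<psi> p) powr p)"
      using \<psi>[OF p] by (intro R.moment_centered_gaussian centered_gaussian_point[OF G t] p) auto
    also have "\<dots> \<le> ennreal ((8 * psi_R \<psi> p) powr p)"
    proof (intro ennreal_leI powr_mono2)
      have "2 * sqrt p * \<psi> p \<le> 4 * sqrt p * \<psi> p" using p \<psi>[OF p] by (intro mult_right_mono) auto
      then show "2 * sqrt p * \<psi> p \<le> 8 * psi_R \<psi> p" using scale[OF p] by linarith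
    qed (use p \<psi>[OF p] in auto)
    finally show "(\<integral>\<^sup>+\<omega>. ennreal (\<bar>S_inf t \<omega>\<bar> powr p) \<partial>R) \<le> ennreal ((8 * psi_R \<psi> p) powr p)" .
  qed simp
  have re_sum: "random_element \<mu> N Q (normed_sum \<xi>s n)" if "1 \<le> n" for n
    using L1 mb_sum[OF that] by (rule random_element_of_moment_bounded(2))
  have re_lim: "random_element \<mu> N R S_inf"
    using L1 mb_lim by (rule random_element_of_moment_bounded(2))

  \<comment> \<open>The normalization of the grand norm to 1 excludes a field that vanishes almost
    surely at every point. Equality of variances passes this on to the limit.\<close>
  have nz: "\<exists>t\<in>space \<mu>. \<not> (AE \<omega> in P. \<xi> t \<omega> = 0)"
  proof (rule ccontr)
    assume "\<not> ?thesis"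
    then have z: "AE \<omega> in P. \<xi> t \<omega> = 0" if "t \<in> space \<mu>" for t using that by auto
    have "grand_norm P {a<..} \<psi> (\<xi> t) = 0" if t: "t \<in> space \<mu>" for t
    proof -
      have "Lp_norm P p (\<xi> t) = 0" for p
      proof -
        have "(\<integral>\<^sup>+\<omega>. ennreal (\<bar>\<xi> t \<omega>\<bar> powr p) \<partial>P) = (\<integral>\<^sup>+\<omega>. 0 \<partial>P)"
          using z[OF t] by (intro nn_integral_cong_AE) (auto elim!: AE_mp)
        then show ?thesis by (simp add: Lp_norm_def)
      qed
      then show ?thesis by (simp add: grand_norm_def)
    qed
    then have "(SUP t\<in>space \<mu>. grand_norm P {a<..} \<psi> (\<xi> t)) = (SUP t\<in>space \<mu>. 0)" by simp
    also have "\<dots> = 0" by (cases "space \<mu> = {}") (auto simp: bot_ennreal)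
    finally show False using \<open>(SUP t\<in>space \<mu>. grand_norm P {a<..} \<psi> (\<xi> t)) = 1\<close> by simp
  qed
  have nondegenerate: "\<exists>t\<in>space \<mu>. \<not> (AE \<omega> in R. S_inf t \<omega> = 0)"
  proof -
    obtain t where t: "t \<in> space \<mu>" "\<not> (AE \<omega> in P. \<xi> t \<omega> = 0)" using nz by auto
    have "\<not> (AE \<omega> in R. S_inf t \<omega> = 0)"
    proof
      assume "AE \<omega> in R. S_inf t \<omega> = 0"
      then have "AE \<omega> in R. (S_inf t \<omega>)\<^sup>2 = 0" by eventually_elim simp
      then have "(\<integral>\<omega>. (S_inf t \<omega>)\<^sup>2 \<partial>R) = 0" by (rule integral_eq_zero_AE)
      then have "(\<integral>\<omega>. (\<xi> t \<omega>)\<^sup>2 \<partial>P) = 0" using var[OF t(1)] by simp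
      then have "AE \<omega> in P. (\<xi> t \<omega>)\<^sup>2 = 0"
        using integral_nonneg_eq_0_iff_AE[OF sq[OF t(1)]] by simp
      then have "AE \<omega> in P. \<xi> t \<omega> = 0" by eventually_elim simp
      then show False using t(2) by simp
    qed
    then show ?thesis using t(1) by blast
  qed

  obtain A :: "nat \<Rightarrow> 't set" where A: "disjoint_family A" "\<And>i. indecomposable \<mu> (A i)"
    and cover: "AE t in \<mu>. t \<in> (\<Union>i. A i)"
    using purely_atomic[OF totally_bounded_ext] by blast
  have As: "A i \<in> sets \<mu>" for i using A(2) by (simp add: indecomposable_def)
  let ?const = "\<lambda>i s. (\<forall>k\<in>{1..}. AE \<omega> in Q. AE t in \<mu>. t \<in> A i \<longrightarrow> \<xi>s k t \<omega> = \<xi>s k s \<omega>) \<and>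
    (AE \<omega> in R. AE t in \<mu>. t \<in> A i \<longrightarrow> S_inf t \<omega> = S_inf s \<omega>)"
  \<comment> \<open>One point has to serve all copies and the limit at once, which countably many
    almost-everywhere statements permit on an atom of positive measure. On a null piece any point
    serves, and \<open>nz\<close> shows that there is one.\<close>
  have "\<exists>s\<in>space \<mu>. ?const i s" for i
  proof (cases "A i \<in> null_sets \<mu>")
    case True
    then have n: "AE t in \<mu>. t \<notin> A i" using As by (simp add: AE_iff_null_sets)
    have "AE t in \<mu>. t \<in> A i \<longrightarrow> f t = c" for f :: "'t \<Rightarrow> real" and c
      using n by eventually_elim simp
    then show ?thesis using nz by auto
  next
    case False
    have "AE s in \<mu>. s \<in> A i \<longrightarrow> (AE \<omega> in Q. AE t in \<mu>. t \<in> A i \<longrightarrow> \<xi>s k t \<omega> = \<xi>s k s \<omega>)" if "k \<in> {1..}" for k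
      using that by (intro AE_section_const_on_indecomposable sigma_finite_measure_axioms
          Q.sigma_finite_measure_axioms A(2) iid.field_copy) simp
    then have "AE s in \<mu>. \<forall>k\<in>{1..}. s \<in> A i \<longrightarrow> (AE \<omega> in Q. AE t in \<mu>. t \<in> A i \<longrightarrow> \<xi>s k t \<omega> = \<xi>s k s \<omega>)"
      by (subst AE_ball_countable) auto
    moreover have "AE s in \<mu>. s \<in> A i \<longrightarrow> (AE \<omega> in R. AE t in \<mu>. t \<in> A i \<longrightarrow> S_inf t \<omega> = S_inf s \<omega>)"
      using \<open>measurable_field \<mu> R S_inf\<close>
      by (intro AE_section_const_on_indecomposable sigma_finite_measure_axioms
          R.sigma_finite_measure_axioms A(2))
    ultimately have c: "AE s in \<mu>. s \<in> A i \<longrightarrow> ?const i s" by eventually_elim blast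
    show ?thesis
    proof (rule ccontr)
      assume *: "\<not> ?thesis"
      have "AE s in \<mu>. s \<notin> A i"
        using c AE_space
      proof eventually_elim
        case (elim s)
        then show ?case using * by blast
      qed
      then show False using False As by (simp add: AE_iff_null_sets)
    qed
  qed
  then have "\<forall>i. \<exists>s. s \<in> space \<mu> \<and> ?const i s" by (intro allI) (simp only: Bex_def)
  from choice[OF this] obtain \<tau> where \<tau>': "\<forall>i. \<tau> i \<in> space \<mu> \<and> ?const i (\<tau> i)" ..
  have \<tau>: "\<tau> i \<in> space \<mu>" "?const i (\<tau> i)" for i
    by (rule \<tau>'[THEN spec, THEN conjunct1], rule \<tau>'[THEN spec, THEN conjunct2])
  have const_sum: "AE \<omega> in Q. AE t in \<mu>. t \<in> A i \<longrightarrow> normed_sum \<xi>s n t \<omega> = normed_sum \<xi>s n (\<tau> i) \<omega>" for i n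
  proof -
    have "AE \<omega> in Q. \<forall>k\<in>{1..n}. AE t in \<mu>. t \<in> A i \<longrightarrow> \<xi>s k t \<omega> = \<xi>s k (\<tau> i) \<omega>"
      using \<tau>(2)[of i] by (subst AE_ball_countable) auto
    then show ?thesis
    proof eventually_elim
      case (elim \<omega>)
      then have "AE t in \<mu>. \<forall>k\<in>{1..n}. t \<in> A i \<longrightarrow> \<xi>s k t \<omega> = \<xi>s k (\<tau> i) \<omega>"
        by (subst AE_ball_countable) auto
      then show ?case
        by eventually_elim (auto simp: normed_sum_def intro!: arg_cong[of _ _ "\<lambda>x. x / sqrt (real n)"] sum.cong)
    qed
  qed
  have const_lim: "AE \<omega> in R. AE t in \<mu>. t \<in> A i \<longrightarrow> S_inf t \<omega> = S_inf (\<tau> i) \<omega>" for i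
    using \<tau>(2) by blast

  have "weakly_convergent_to \<mu> N Q (normed_sum \<xi>s) R S_inf"
  proof (rule weak_convergence_of_Lipschitz[OF Q.prob_space_axioms R.prob_space_axioms re_sum re_lim])
    fix F assume "bdd_Lipschitz F"
    then obtain B L where bd: "\<And>f. f \<in> fspace \<mu> N \<Longrightarrow> \<bar>F f\<bar> \<le> B" and L: "0 \<le> L"
      "\<And>f h. f \<in> fspace \<mu> N \<Longrightarrow> h \<in> fspace \<mu> N \<Longrightarrow> \<bar>F f - F h\<bar> \<le> L * nrm (\<lambda>t. f t - h t)"
      unfolding bdd_Lipschitz_def by blast
    show "(\<lambda>n. functional_expectation \<mu> N Q (normed_sum \<xi>s n) F) \<longlonglongrightarrow> functional_expectation \<mu> N R S_inf F"
    proof (rule LIMSEQ_I)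
      fix e :: real assume e: "0 < e"
      \<comment> \<open>The replacement by finitely many atoms costs at most
        \<open>L * d \<le> e / 4\<close> for the sums and again for the limit, leaving
        \<open>e / 2\<close> for the random vectors. Using \<open>L + 1\<close> avoids a division by
        zero.\<close>
      define d where "d = e / (4 * (L + 1))"
      have d: "0 < d" "L * d \<le> e / 4"
      proof -
        show "0 < d" using e L(1) by (simp add: d_def)
        then have "L * d \<le> (L + 1) * d" by (intro mult_right_mono) auto
        also have "\<dots> = e / 4" using L(1) by (simp add: d_def field_simps)
        finally show "L * d \<le> e / 4" .
      qed
      let ?B = "\<lambda>j. space \<mu> - (\<Union>i<j. A i)"
      have Bj: "?B j \<in> sets \<mu>" for j using As by auto
      have null: "AE t in \<mu>. \<forall>\<^sub>F j in sequentially. t \<notin> ?B j"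
        using cover
      proof eventually_elim
        case (elim t)
        then obtain i where "t \<in> A i" by auto
        then show ?case by (intro eventually_sequentiallyI[of "Suc i"]) auto
      qed
      have "\<exists>j m. tail_bound (?B j) m \<le> ennreal (d / 8)"
        using L1 Bj null d(1) by (intro tail_bound_small) auto
      then obtain j m where "tail_bound (?B j) m \<le> ennreal (d / 8)" by blast
      then have "ennreal 8 * tail_bound (?B j) m \<le> ennreal 8 * ennreal (d / 8)" by (intro mult_left_mono) auto
      also have "\<dots> = ennreal d" using d(1) by (simp add: ennreal_mult[symmetric] del: ennreal_numeral)
      finally have tb: "ennreal 8 * tail_bound (?B j) m \<le> ennreal d" .
      note approx = approximation_by_atoms[OF A(2,1) L1 _ \<tau>(1) _ bd L tb less_imp_le[OF d(1)]]
      have ap_sum: "\<bar>functional_expectation \<mu> N Q (normed_sum \<xi>s n) F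
          - (\<integral>\<omega>. F (step_fun A j (\<lambda>i. normed_sum \<xi>s n (\<tau> i) \<omega>)) \<partial>Q)\<bar> \<le> L * d" if "1 \<le> n" for n
        using mb_sum[OF that] const_sum by (intro approx)
      have ap_lim: "\<bar>functional_expectation \<mu> N R S_inf F
          - (\<integral>\<omega>. F (step_fun A j (\<lambda>i. S_inf (\<tau> i) \<omega>)) \<partial>R)\<bar> \<le> L * d"
        using mb_lim const_lim by (intro approx)
      have "(\<lambda>n. \<integral>\<omega>. F (step_fun A j (\<lambda>i. normed_sum \<xi>s n (\<tau> i) \<omega>)) \<partial>Q)
          \<longlonglongrightarrow> (\<integral>\<omega>. F (step_fun A j (\<lambda>i. S_inf (\<tau> i) \<omega>)) \<partial>R)"
      proof (rule tendsto_expectation_of_char[where m = j and V = "\<lambda>n \<omega> i. normed_sum \<xi>s n (\<tau> i) \<omega>"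
            and W = "\<lambda>\<omega> i. S_inf (\<tau> i) \<omega>" and f = "\<lambda>x. F (step_fun A j x)" and B = B
            and c = "\<lambda>i. L * nrm (indicator (A i))", OF Q.prob_space_axioms R.prob_space_axioms])
        show "(\<lambda>\<omega>. normed_sum \<xi>s n (\<tau> i) \<omega>) \<in> borel_measurable Q" for n i
          using measurable_field_section(2)[OF measurable_normed_sum[OF iid.field_copy] \<tau>(1)] by simp
        show "(\<lambda>\<omega>. S_inf (\<tau> i) \<omega>) \<in> borel_measurable R" for i
          using measurable_field_section(2)[OF \<open>measurable_field \<mu> R S_inf\<close> \<tau>(1)] by simp
        show "(\<lambda>n. CLINT \<omega>|Q. iexp (\<Sum>i<j. c i * normed_sum \<xi>s n (\<tau> i) \<omega>))
            \<longlonglongrightarrow> (CLINT \<omega>|R. iexp (\<Sum>i<j. c i * S_inf (\<tau> i) \<omega>))" for c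
          using G R.prob_space_axioms cov mean sq \<tau>(1) by (rule iid.char_normed_sum)
        show "\<bar>F (step_fun A j x)\<bar> \<le> B" for x by (intro bd step_fun_fspace A(2))
        show "\<bar>F (step_fun A j x) - F (step_fun A j y)\<bar> \<le> (\<Sum>i<j. L * nrm (indicator (A i)) * \<bar>x i - y i\<bar>)" for x y
          by (rule step_fun_Lipschitz[OF A(2) L])
      qed
      from LIMSEQ_D[OF this half_gt_zero[OF e]] obtain n0 where n0: "\<And>n. n \<ge> n0 \<Longrightarrow>
          \<bar>(\<integral>\<omega>. F (step_fun A j (\<lambda>i. normed_sum \<xi>s n (\<tau> i) \<omega>)) \<partial>Q)
            - (\<integral>\<omega>. F (step_fun A j (\<lambda>i. S_inf (\<tau> i) \<omega>)) \<partial>R)\<bar> < e / 2"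
        by auto
      show "\<exists>no. \<forall>n\<ge>no. norm (functional_expectation \<mu> N Q (normed_sum \<xi>s n) F - functional_expectation \<mu> N R S_inf F) < e"
      proof (intro exI[of _ "max n0 1"] allI impI)
        fix n assume "max n0 1 \<le> n"
        then have n: "n0 \<le> n" "1 \<le> n" by auto
        show "norm (functional_expectation \<mu> N Q (normed_sum \<xi>s n) F - functional_expectation \<mu> N R S_inf F) < e"
          using n0[OF n(1)] ap_sum[OF n(2)] ap_lim d(2) unfolding real_norm_def by linarith
      qed
    qed
  qed
  then show ?thesis
    unfolding central_limit_theorem_in_def using G nondegenerate by blast
qed

end
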